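(* There exist constants $C_0,C_1>0$ such that for all integers $n\ge 2$ and $N\ge C_0 n^3/(\log n)^2$, there is an $N$-vertex graph $G$ with $\alpha(G)<n$ and at most $$C_1\binom{N}{4}\Big(\frac{\log n}{n}\Big)^{6}\cdot\frac{1}{\log n}$$ cliques of size $4$. Moreover, the constant $C_0$ can be taken so that there is also a constant $c>0$ with $$c\,\binom{N}{4}\Big(\frac{\log n}{n}\Big)^{6}\cdot\frac{1}{\log n}\;\le\; f(N,4,n)\;\le\; C_1\binom{N}{4}\Big(\frac{\log n}{n}\Big)^{6}\cdot\frac{1}{\log n}$$ for all integers $n\ge 2$ and $N\ge C_0n^3/(\log n)^2$.
   Context: Graphs are finite and simple; $\alpha(G)$ is the maximum size of an independent set in $G$. $f(N,4,n)$ denotes the minimum number of (unlabeled) cliques of size $4$ in an $N$-vertex graph with no independent set of size $n$. $\log$ is the natural logarithm. *)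

theory Defs
  imports Complex_Main "HOL-Library.Ramsey"
begin

text \<open>A graph is a vertex set together with a set of two-element subsets of it, the
  representation for which \<^const>\<open>clique\<close> and \<^const>\<open>indep\<close> are defined in the library.\<close>

definition simple_graph :: "'a set \<Rightarrow> 'a set set \<Rightarrow> bool"
  where "simple_graph V E \<longleftrightarrow> finite V \<and> E \<subseteq> nsets V 2"

definition independence_number :: "'a set \<Rightarrow> 'a set set \<Rightarrow> nat"
  where "independence_number V E = Max {card S |S. S \<subseteq> V \<and> indep S E}"

definition num_cliques :: "nat \<Rightarrow> 'a set \<Rightarrow> 'a set set \<Rightarrow> nat"
  where "num_cliques k V E = card {K. K \<subseteq> V \<and> card K = k \<and> clique K E}"

text \<open>Taking the vertices to be natural numbers loses no generality, since every finite graph is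
  isomorphic to one on a set of naturals. For \<open>n \<ge> 2\<close> the complete graph is admissible, so the
  minimum exists; when no graph is admissible (e.g. \<open>n = 0\<close>) the value is unspecified.\<close>

definition min_cliques :: "nat \<Rightarrow> nat \<Rightarrow> nat \<Rightarrow> nat"
  where "min_cliques N k n =
    (LEAST m. \<exists>(V :: nat set) E. simple_graph V E \<and> card V = N \<and>
       \<not> (\<exists>S \<subseteq> V. card S = n \<and> indep S E) \<and> m = num_cliques k V E)"

end

theory Submission
  imports Defs "HOL-Algebra.Algebraic_Closure_Type" "HOL-Library.Z2" "HOL-Analysis.Convex"
    "HOL-Real_Asymp.Real_Asymp"
begin

text \<open>
  Upper bound. Let \<open>q = 2 ^ k\<close> with \<open>q\<^sup>2\<close> of order \<open>n\<close>, and consider the about \<open>q ^ 4\<close> secant lines of a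
  Hermitian unital with about \<open>q ^ 3\<close> points. Four lines never meet pairwise in six distinct points
  (there is no O'Nan configuration). Replace every line by a clique of \<open>q ^ 8\<close> copies, give each pair
  of a point and a copy of a line through it a random label from \<open>{+, -} \<times> {..<s}\<close> with \<open>s\<close> of order
  \<open>q / log q\<close>, and join copies of different lines when their labels at the common point differ in
  the sign only. At each point this gives a bipartite graph, so every clique of size four uses
  two copies of the same line, which makes the expected number of such cliques small. A set of \<open>n\<close> lines has
  on average at least two lines through a point, and disjoint pairs of lines at the points give
  enough independent trials for a union bound over all sets of size \<open>n\<close>. Finally any number \<open>N\<close>
  of vertices is reached by pulling back along a random map into the resulting graph.

  Lower bound. Turan's theorem bounds the number of edges in a common neighbourhood from below.
  If the edge density is at least of order \<open>log n / n\<close>, then so is that of most large neighbourhoods (or they have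
  very many triangles), and summing over vertices, then over edges, gives the bound. A graph with fewer edges
  and few triangles contains a sparse random subset that is almost triangle-free, in which the
  theorem of Ajtai, Komlos and Szemeredi yields an independent set of size \<open>n\<close>; a graph with
  fewer edges and many triangles has more cliques of size four than needed, by convexity.
\<close>

section \<open>Points and lines of a Hermitian unital\<close>

text \<open>One type of clique decides the power of the logarithm. Among quadruples of vertices,
  four copies of one line have density of order \<open>1 / q ^ 12\<close>. Two copies of one side of
  a triangle of lines together with a copy of each other side have that density times
  \<open>(q / s) ^ 5\<close>: there are at most about \<open>card L * q ^ 5\<close> triangles, and
  five independent label coincidences are required. With \<open>q / s\<close> of order log n and
  \<open>q ^ 2\<close> of order n this is \<open>(log n) ^ 5 / n ^ 6\<close>, the claimed rate. Four
  lines in general position would involve six coincidences and, in their expected number, give a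
  sixth power; the absence of O'Nan configurations saves exactly this factor. The
  \<open>q ^ 8\<close> copies bring the number of vertices to order \<open>q ^ 12\<close>. A random
  map is not injective, so quadruples with repeated vertices count as well, and with that many
  vertices they too have density of order \<open>1 / q ^ 12\<close>. The threshold
  \<open>n ^ 3 / (log n) ^ 2\<close> belongs to the lower bound. At edge density of order log n / n
  it brings common neighbourhoods of adjacent vertices to size of order n, from which on Turan's
  theorem forces edges inside them.\<close>

lemma card_roots_eq_degree:
  fixes p :: "'a::alg_closed_field poly"
  assumes "p \<noteq> 0" and "\<And>a. poly p a = 0 \<Longrightarrow> poly (pderiv p) a \<noteq> 0"
  shows "card {x. poly p x = 0} = degree p"
  using assms
proof (induction "degree p" arbitrary: p)
  case 0
  then obtain c where "p = [:c:]" "c \<noteq> 0"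
    by (metis degree_eq_zeroE pCons_0_0)
  then show ?case by simp
next
  case (Suc n)
  then obtain a where a: "poly p a = 0"
    using alg_closed_imp_poly_has_root[of p] by auto
  then obtain r where r: "p = [:-a, 1:] * r"
    by (metis dvdE poly_eq_0_iff_dvd)
  have r0: "r \<noteq> 0" using r Suc.prems(1) by auto
  have deg: "degree p = Suc (degree r)"
    unfolding r using r0 by (subst degree_mult_eq) auto
  have pd: "pderiv p = r + [:-a, 1:] * pderiv r"
    unfolding r by (subst pderiv_mult) (simp add: pderiv_pCons)
  \<comment> \<open>If \<open>a\<close> were also a root of the cofactor, the derivative of
    \<open>p\<close> would vanish at \<open>a\<close>.\<close>
  have ra: "poly r a \<noteq> 0"
    using Suc.prems(2)[OF a] by (simp add: pd)
  have "card {x. poly r x = 0} = degree r"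
  proof (rule Suc.hyps(1))
    show "n = degree r" using Suc.hyps(2) deg by simp
    show "r \<noteq> 0" by fact
  next
    fix b assume b: "poly r b = 0"
    then have "poly p b = 0" by (simp add: r)
    from Suc.prems(2)[OF this] show "poly (pderiv r) b \<noteq> 0"
      using b by (auto simp: pd)
  qed
  moreover have "{x. poly p x = 0} = insert a {x. poly r x = 0}"
    by (auto simp: r)
  moreover have "finite {x. poly r x = 0}" using r0 by (rule poly_roots_finite)
  ultimately show ?case using ra deg by simp
qed

lemma card_nth_roots_alg_closed:
  fixes c :: "'a::alg_closed_field"
  assumes "of_nat n \<noteq> (0::'a)" and "c \<noteq> 0"
  shows "card {x. x ^ n = c} = n"
proof -
  have n: "n > 0" using assms(1) by (cases n) auto
  define p where "p = monom 1 n + [:-c:]"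
  have ev: "poly p x = x ^ n - c" for x by (simp add: p_def poly_monom)
  have deg: "degree p = n"
    unfolding p_def using n by (subst degree_add_eq_left) (auto simp: degree_monom_eq)
  have pd: "poly (pderiv p) x = of_nat n * x ^ (n - 1)" for x
    by (simp add: p_def pderiv_add pderiv_monom poly_monom pderiv_pCons)
  have "card {x. poly p x = 0} = degree p"
  proof (rule card_roots_eq_degree)
    show "p \<noteq> 0" using deg n by auto
    fix a assume "poly p a = 0"
    then have "a ^ n = c" by (simp add: ev)
    then have "a \<noteq> 0" using assms(2) n by auto
    then show "poly (pderiv p) a \<noteq> 0" using assms(1) by (simp add: pd)
  qed
  then show ?thesis by (simp add: ev deg)
qed

text \<open>The derivative of the polynomial is the constant -1, so all its roots are simple.
  Applied with \<open>q ^ 2\<close> in place of \<open>n\<close>, this counts the field over which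
  the unital lives.\<close>

lemma card_frobenius_fixed:
  assumes "of_nat n = (0::'a::alg_closed_field)" and "n > 1"
  shows "card {x::'a. x ^ n = x} = n"
proof -
  define p :: "'a poly" where "p = monom 1 n + [:0, -1:]"
  have ev: "poly p x = x ^ n - x" for x by (simp add: p_def poly_monom)
  have deg: "degree p = n"
    unfolding p_def using assms(2) by (subst degree_add_eq_left) (auto simp: degree_monom_eq)
  have pd: "poly (pderiv p) x = - 1" for x
    using assms(1) by (simp add: p_def pderiv_add pderiv_monom poly_monom pderiv_pCons)
  have "card {x. poly p x = 0} = degree p"
  proof (rule card_roots_eq_degree)
    show "p \<noteq> 0" using deg assms(2) by auto
  qed (simp add: pd)
  then show ?thesis by (simp add: ev deg)
qed

lemma card_trace_fibre_le:
  fixes c :: "'a::field"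
  assumes "n > 1"
  shows "finite {x. x + x ^ n = c}" "card {x. x + x ^ n = c} \<le> n"
proof -
  define p where "p = monom 1 n + [:-c, 1:]"
  have ev: "poly p x = 0 \<longleftrightarrow> x + x ^ n = c" for x by (auto simp: p_def poly_monom algebra_simps)
  have deg: "degree p = n"
    unfolding p_def using assms by (subst degree_add_eq_left) (auto simp: degree_monom_eq)
  have p0: "p \<noteq> 0" using deg assms by auto
  show "finite {x. x + x ^ n = c}" using poly_roots_finite[OF p0] by (simp add: ev)
  show "card {x. x + x ^ n = c} \<le> n" using card_poly_roots_bound[OF p0] by (simp add: ev deg)
qed

text \<open>In the next two lemmas the primed variables stand for the conjugates of the unprimed ones.
  If \<open>(xA,yA)\<close>, \<open>(xB,yB)\<close>, \<open>(xD,yD)\<close> are isotropic and collinear, then the affine coordinates of the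
  third point, scaled by the Hermitian product of the first two, have trace zero.\<close>

lemma isotropic_third_point:
  fixes m :: "'a::comm_ring_1"
  assumes "yA = m * xA + b" "yB = m * xB + b" "yD = m * xD + b"
    and "yA' = m' * xA' + b'" "yB' = m' * xB' + b'" "yD' = m' * xD' + b'"
    and "yA + yA' = xA * xA'" "yB + yB' = xB * xB'" "yD + yD' = xD * xD'"
  shows "(xD - xB) * (xA' - xD') * (yA + yB' - xA * xB')
       + (xA - xD) * (xD' - xB') * (yB + yA' - xB * xA') = 0"
proof -
  have "(xD - xB) * (xA' - xD') * (yA + yB' - xA * xB')
       + (xA - xD) * (xD' - xB') * (yB + yA' - xB * xA')
     = (xA - xB) * (xA' - xB') * (yD + yD' - xD * xD')
       - (xD - xB) * (xD' - xB') * (yA + yA' - xA * xA')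
       - (xA - xD) * (xA' - xD') * (yB + yB' - xB * xB')"
    unfolding assms(1-6) by (simp add: algebra_simps)
  then show ?thesis by (simp add: assms(7-9))
qed

lemma isotropic_gram:
  fixes xA :: "'a::comm_ring_1"
  assumes "yA + yA' = xA * xA'" "yB + yB' = xB * xB'" "yC + yC' = xC * xC'"
  shows "(yA + yB' - xA * xB') * (yB + yC' - xB * xC') * (yC + yA' - xC * xA')
       + (yB + yA' - xB * xA') * (yC + yB' - xC * xB') * (yA + yC' - xA * xC')
     = (xA * (yB - yC) + xB * (yC - yA) + xC * (yA - yB))
       * (xA' * (yB' - yC') + xB' * (yC' - yA') + xC' * (yA' - yB'))"
proof -
  have y: "yA' = xA * xA' - yA" "yB' = xB * xB' - yB" "yC' = xC * xC' - yC"
    using assms by (simp_all add: algebra_simps)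
  show ?thesis unfolding y by (simp add: algebra_simps)
qed

text \<open>D, E, G lie on the sides AB, BC, CA, and the ratios of Menelaus are cleared of
  denominators. After multiplication by the determinant of ABC and interpolation of
  \<open>yD\<close>, \<open>yE\<close>, \<open>yG\<close> along the sides, the expression becomes,
  up to sign, the product of the three side differences with the determinant of DEG, which vanishes
  because D, E, G are collinear.\<close>

lemma menelaus:
  fixes xA :: "'a::idom"
  assumes "yB = m1 * xB + b1" "yC = m1 * xC + b1" "yE = m1 * xE + b1"
    and "yC = m2 * xC + b2" "yA = m2 * xA + b2" "yG = m2 * xG + b2"
    and "yA = m3 * xA + b3" "yB = m3 * xB + b3" "yD = m3 * xD + b3"
    and "yD = m4 * xD + b4" "yE = m4 * xE + b4" "yG = m4 * xG + b4"
    and "xA * (yB - yC) + xB * (yC - yA) + xC * (yA - yB) \<noteq> 0"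
  shows "(xD - xB) * (xE - xC) * (xG - xA) + (xA - xD) * (xB - xE) * (xC - xG) = 0"
proof -
  have d: "(xA - xB) * yD = (xD - xB) * yA + (xA - xD) * yB"
    by (simp add: assms(7,8,9) algebra_simps)
  have e: "(xB - xC) * yE = (xE - xC) * yB + (xB - xE) * yC"
    by (simp add: assms(1,2,3) algebra_simps)
  have g: "(xC - xA) * yG = (xG - xA) * yC + (xC - xG) * yA"
    by (simp add: assms(4,5,6) algebra_simps)
  have "((xD - xB) * (xE - xC) * (xG - xA) + (xA - xD) * (xB - xE) * (xC - xG))
      * (xA * (yB - yC) + xB * (yC - yA) + xC * (yA - yB))
      = (xA - xB) * xD * ((xB - xC) * ((xG - xA) * yC + (xC - xG) * yA) - (xC - xA) * ((xE - xC) * yB + (xB - xE) * yC)) * (-1)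
      + (xB - xC) * xE * ((xC - xA) * ((xD - xB) * yA + (xA - xD) * yB) - (xA - xB) * ((xG - xA) * yC + (xC - xG) * yA)) * (-1)
      + (xC - xA) * xG * ((xA - xB) * ((xE - xC) * yB + (xB - xE) * yC) - (xB - xC) * ((xD - xB) * yA + (xA - xD) * yB)) * (-1)"
    by (simp add: algebra_simps)
  also have "\<dots> = (xA - xB) * xD * ((xB - xC) * ((xC - xA) * yG) - (xC - xA) * ((xB - xC) * yE)) * (-1)
      + (xB - xC) * xE * ((xC - xA) * ((xA - xB) * yD) - (xA - xB) * ((xC - xA) * yG)) * (-1)
      + (xC - xA) * xG * ((xA - xB) * ((xB - xC) * yE) - (xB - xC) * ((xA - xB) * yD)) * (-1)"
    by (simp only: d e g)
  also have "\<dots> = 0" by (simp add: assms(10,11,12) algebra_simps)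
  finally show ?thesis using assms(13) by simp
qed

section \<open>The Hermitian curve and its secants\<close>

locale hermitian_plane =
  fixes q :: nat and cj :: "'a::alg_closed_field \<Rightarrow> 'a"
  assumes cj_power: "cj x = x ^ q"
    and q_gt_1: "q > 1"
    and of_nat_q: "of_nat q = (0::'a)"
    and cj_add: "cj (x + y) = cj x + cj y"
begin

text \<open>The field with \<open>q ^ 2\<close> elements, cut out of the algebraically closed field;
  \<open>cj\<close> restricts to its involution.\<close>

definition K :: "'a set" where "K = {x. cj (cj x) = x}"

text \<open>The affine part of the Hermitian curve: trace of \<open>y\<close> equals norm of
  \<open>x\<close>. The single point at infinity is left out, and with it the vertical lines, all of
  which pass through it.\<close>

definition pts :: "('a \<times> 'a) set"
  where "pts = {(x, y). x \<in> K \<and> y \<in> K \<and> y + cj y = x * cj x}"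

definition line :: "'a \<Rightarrow> 'a \<Rightarrow> ('a \<times> 'a) set"
  where "line m b = {(x, y) \<in> pts. y = m * x + b}"

text \<open>If \<open>m * cj m + b + cj b = 0\<close> the line is a tangent and meets the curve in
  one point; the remaining pairs give the secants.\<close>

definition params :: "('a \<times> 'a) set"
  where "params = {(m, b). m \<in> K \<and> b \<in> K \<and> m * cj m + b + cj b \<noteq> 0}"

definition lines :: "('a \<times> 'a) set set"
  where "lines = (\<lambda>(m, b). line m b) ` params"

lemma cj_0 [simp]: "cj 0 = 0" using q_gt_1 by (simp add: cj_power)

lemma cj_mult: "cj (x * y) = cj x * cj y" by (simp add: cj_power power_mult_distrib)

lemma cj_minus: "cj (- x) = - cj x"
proof -
  have "cj (- x) + cj x = 0" by (simp flip: cj_add)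
  then show ?thesis by (simp add: eq_neg_iff_add_eq_0)
qed

lemma cj_diff: "cj (x - y) = cj x - cj y"
  using cj_add[of x "- y"] by (simp add: cj_minus)

lemmas cj_simps = cj_add cj_mult cj_minus cj_diff

lemma cj_eq_0_iff [simp]: "cj x = 0 \<longleftrightarrow> x = 0"
  using q_gt_1 by (simp add: cj_power)

lemma K_cjcj: "x \<in> K \<Longrightarrow> cj (cj x) = x" by (simp add: K_def)

lemma K_closed [intro, simp]:
  "x \<in> K \<Longrightarrow> y \<in> K \<Longrightarrow> x + y \<in> K"
  "x \<in> K \<Longrightarrow> y \<in> K \<Longrightarrow> x - y \<in> K"
  "x \<in> K \<Longrightarrow> y \<in> K \<Longrightarrow> x * y \<in> K"
  "x \<in> K \<Longrightarrow> cj x \<in> K"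
  by (simp_all add: K_def cj_simps)

lemma card_K: "card K = q\<^sup>2" and finite_K: "finite K"
proof -
  have "K = {x. x ^ (q\<^sup>2) = x}"
    by (simp add: K_def cj_power power2_eq_square flip: power_mult)
  moreover have "card {x::'a. x ^ (q\<^sup>2) = x} = q\<^sup>2"
    by (rule card_frobenius_fixed) (simp add: of_nat_q, rule one_less_power[OF q_gt_1], simp)
  ultimately show c: "card K = q\<^sup>2" by simp
  show "finite K" by (rule card_ge_0_finite) (use c q_gt_1 in auto)
qed

lemma trace_fibre: "finite {y. y + cj y = c}" "card {y. y + cj y = c} \<le> q"
  using card_trace_fibre_le[OF q_gt_1, of c] by (simp_all add: cj_power)

lemma finite_pts: "finite pts" and card_pts_le: "card pts \<le> q ^ 3"
proof -
  have sub: "pts \<subseteq> Sigma K (\<lambda>x. {y. y + cj y = x * cj x})"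
    by (auto simp: pts_def)
  have fin: "finite (Sigma K (\<lambda>x. {y. y + cj y = x * cj x}))"
    using finite_K trace_fibre by blast
  show "finite pts" using sub fin by (rule finite_subset)
  have "card pts \<le> card (Sigma K (\<lambda>x. {y. y + cj y = x * cj x}))"
    using fin sub by (rule card_mono)
  also have "\<dots> = (\<Sum>x\<in>K. card {y. y + cj y = x * cj x})"
    using finite_K trace_fibre by (intro card_SigmaI) auto
  also have "\<dots> \<le> (\<Sum>x\<in>K. q)" by (intro sum_mono trace_fibre)
  also have "\<dots> = q ^ 3" by (simp add: card_K power2_eq_square power3_eq_cube)
  finally show "card pts \<le> q ^ 3" .
qed

lemma line_subset_pts: "line m b \<subseteq> pts" by (auto simp: line_def)

lemma line_coord_eq: "(x, y) \<in> line m b \<Longrightarrow> (x, y') \<in> line m b \<Longrightarrow> y = y'"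
  by (auto simp: line_def)

text \<open>Shifting \<open>x\<close> by \<open>cj m\<close> completes the square: the points of the
  line correspond to the solutions of \<open>z ^ (q + 1) = \<rho>\<close>. There are
  \<open>q + 1\<close> of these, because \<rho> is nonzero and \<open>q + 1\<close> equals 1 in the
  field.\<close>

lemma card_line:
  assumes mb: "(m, b) \<in> params"
  shows "card (line m b) = q + 1"
proof -
  have m: "m \<in> K" and b: "b \<in> K" and rho: "m * cj m + b + cj b \<noteq> 0"
    using mb by (auto simp: params_def)
  define \<rho> where "\<rho> = m * cj m + b + cj b"
  have cjr: "cj \<rho> = \<rho>"
    using m b by (simp add: \<rho>_def cj_simps K_cjcj algebra_simps)
  have norm: "z ^ (q + 1) = z * cj z" for z by (simp add: cj_power)
  have "bij_betw (\<lambda>z. (z + cj m, m * (z + cj m) + b)) {z. z ^ (q + 1) = \<rho>} (line m b)"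
  proof (rule bij_betwI[where g = "\<lambda>(x, y). x - cj m"])
    show "(\<lambda>z. (z + cj m, m * (z + cj m) + b)) \<in> {z. z ^ (q + 1) = \<rho>} \<rightarrow> line m b"
    proof
      fix z assume "z \<in> {z. z ^ (q + 1) = \<rho>}"
      then have z: "z * cj z = \<rho>" by (simp only: mem_Collect_eq norm)
      \<comment> \<open>The solutions are counted in the whole algebraically closed field; they lie
        in \<open>K\<close> because \<rho> is fixed by \<open>cj\<close>.\<close>
      then have "cj (z * cj z) = z * cj z" using cjr by simp
      then have "cj z * cj (cj z) = cj z * z" by (simp add: cj_mult mult.commute)
      moreover have "z \<noteq> 0" using z rho by (auto simp: \<rho>_def)
      ultimately have zK: "z \<in> K" by (simp add: K_def)
      have "m * (z + cj m) + b + cj (m * (z + cj m) + b) = (z + cj m) * cj (z + cj m)"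
        using z m by (simp add: cj_simps K_cjcj \<rho>_def algebra_simps)
      then show "(z + cj m, m * (z + cj m) + b) \<in> line m b"
        using zK m b by (auto simp: line_def pts_def)
    qed
    show "(\<lambda>(x, y). x - cj m) \<in> line m b \<rightarrow> {z. z ^ (q + 1) = \<rho>}"
    proof
      fix p assume "p \<in> line m b"
      then obtain x y where p: "p = (x, y)" and y: "y = m * x + b" and x: "x \<in> K"
        and u: "y + cj y = x * cj x"
        by (auto simp: line_def pts_def)
      have "(x - cj m) * cj (x - cj m) = \<rho>"
        using u m unfolding y by (simp add: cj_simps K_cjcj \<rho>_def algebra_simps)
      then show "(case p of (x, y) \<Rightarrow> x - cj m) \<in> {z. z ^ (q + 1) = \<rho>}"
        by (simp only: p norm prod.case mem_Collect_eq)
    qed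
  qed (auto simp: line_def)
  then have "card (line m b) = card {z. z ^ (q + 1) = \<rho>}"
    by (simp add: bij_betw_same_card)
  also have "\<dots> = q + 1"
    using rho by (intro card_nth_roots_alg_closed) (simp_all add: of_nat_q \<rho>_def)
  finally show ?thesis .
qed

lemma lines_meet_once:
  assumes "P \<in> line m b" "P \<in> line m' b'" "Q \<in> line m b" "Q \<in> line m' b'" "P \<noteq> Q"
  shows "m = m' \<and> b = b'"
proof -
  obtain x y where P: "P = (x, y)" by (cases P)
  obtain u v where Q: "Q = (u, v)" by (cases Q)
  have e: "y = m * x + b" "y = m' * x + b'" "v = m * u + b" "v = m' * u + b'"
    using assms by (auto simp: line_def P Q)
  have "x \<noteq> u" using assms(5) e P Q by auto
  have "(m - m') * (x - u) = (m * x + b - (m' * x + b')) - (m * u + b - (m' * u + b'))"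
    by (simp add: algebra_simps)
  also have "\<dots> = 0" by (simp flip: e)
  finally have "(m - m') * (x - u) = 0" .
  with \<open>x \<noteq> u\<close> have "m = m'" by simp
  with e show ?thesis by simp
qed

lemma inj_on_line: "inj_on (\<lambda>(m, b). line m b) params"
proof (rule inj_onI, clarify)
  fix m b m' b'
  assume p: "(m, b) \<in> params" "(m', b') \<in> params" and e: "line m b = line m' b'"
  have "card (line m b) \<ge> 2" using card_line[OF p(1)] q_gt_1 by simp
  then obtain T where "T \<subseteq> line m b" "card T = 2" by (metis obtain_subset_with_card_n)
  then obtain P Q where "P \<in> line m b" "Q \<in> line m b" "P \<noteq> Q" by (auto simp: card_2_iff)
  then show "m = m' \<and> b = b'" using lines_meet_once[of P m b m' b' Q] e by simp
qed

lemma params_subset: "params \<subseteq> K \<times> K" by (auto simp: params_def)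

lemma finite_params: "finite params"
  using finite_K by (intro finite_subset[OF params_subset]) auto

lemma finite_lines: "finite lines" by (simp add: lines_def finite_params)

lemma card_lines: "card lines = card params"
  unfolding lines_def by (rule card_image) (rule inj_on_line)

lemma card_lines_le: "card lines \<le> q ^ 4"
proof -
  have "card params \<le> card (K \<times> K)"
    using finite_K by (intro card_mono params_subset) auto
  then show ?thesis by (simp add: card_lines card_cartesian_product card_K flip: power_add)
qed

text \<open>Each slope has at most \<open>q\<close> intercepts that give a tangent, so at most
  \<open>q ^ 3\<close> of the \<open>q ^ 4\<close> pairs are lost, which is at most half of
  them.\<close>

lemma card_lines_ge: "q ^ 4 \<le> 2 * card lines"
proof -
  let ?T = "Sigma K (\<lambda>m. {b. b + cj b = - (m * cj m)})"
  have "K \<times> K \<subseteq> params \<union> ?T"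
    by (auto simp: params_def eq_neg_iff_add_eq_0 algebra_simps)
  moreover have fT: "finite ?T" using finite_K trace_fibre by blast
  ultimately have "card (K \<times> K) \<le> card (params \<union> ?T)"
    using finite_params by (intro card_mono) auto
  also have "\<dots> \<le> card params + card ?T" by (rule card_Un_le)
  also have "card ?T = (\<Sum>m\<in>K. card {b. b + cj b = - (m * cj m)})"
    using finite_K trace_fibre by (intro card_SigmaI) auto
  also have "\<dots> \<le> (\<Sum>m\<in>K. q)" by (intro sum_mono trace_fibre)
  also have "\<dots> = q ^ 3" by (simp add: card_K power2_eq_square power3_eq_cube)
  finally have "q ^ 4 \<le> card params + q ^ 3"
    by (simp add: card_cartesian_product card_K flip: power_add)
  moreover have "2 * q ^ 3 \<le> q ^ 4"
    using mult_le_mono1[of 2 q "q ^ 3"] q_gt_1 by (simp add: eval_nat_numeral)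
  ultimately show ?thesis by (simp add: card_lines)
qed

lemma card_lines_through: "finite {l \<in> lines. P \<in> l}" "card {l \<in> lines. P \<in> l} \<le> q\<^sup>2"
proof -
  obtain x y where P: "P = (x, y)" by (cases P)
  have sub: "{l \<in> lines. P \<in> l} \<subseteq> (\<lambda>m. line m (y - m * x)) ` K"
  proof
    fix l assume "l \<in> {l \<in> lines. P \<in> l}"
    then obtain m b where "l = line m b" "m \<in> K" "(x, y) \<in> line m b"
      by (auto simp: lines_def params_def P)
    moreover from this have "b = y - m * x" by (simp add: line_def)
    ultimately show "l \<in> (\<lambda>m. line m (y - m * x)) ` K" by blast
  qed
  show "finite {l \<in> lines. P \<in> l}" using finite_lines by simp
  have "card {l \<in> lines. P \<in> l} \<le> card ((\<lambda>m. line m (y - m * x)) ` K)"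
    using sub finite_K by (intro card_mono) auto
  also have "\<dots> \<le> q\<^sup>2" using card_image_le[OF finite_K] by (simp add: card_K)
  finally show "card {l \<in> lines. P \<in> l} \<le> q\<^sup>2" .
qed

text \<open>The three trace-zero elements attached to the intersections of the fourth line with the sides
  of the triangle \<open>ABC\<close> multiply, by Menelaus, to a trace-zero multiple of the product of the
  Hermitian products of \<open>A\<close>, \<open>B\<close>, \<open>C\<close>; this forces the Gram determinant of the triangle to vanish.\<close>

lemma onan_algebra:
  assumes pts: "(xA, yA) \<in> pts" "(xB, yB) \<in> pts" "(xC, yC) \<in> pts"
      "(xD, yD) \<in> pts" "(xE, yE) \<in> pts" "(xG, yG) \<in> pts"
    and l1: "yB = m1 * xB + b1" "yC = m1 * xC + b1" "yE = m1 * xE + b1"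
    and l2: "yC = m2 * xC + b2" "yA = m2 * xA + b2" "yG = m2 * xG + b2"
    and l3: "yA = m3 * xA + b3" "yB = m3 * xB + b3" "yD = m3 * xD + b3"
    and l4: "yD = m4 * xD + b4" "yE = m4 * xE + b4" "yG = m4 * xG + b4"
    and ne: "xD \<noteq> xA" "xD \<noteq> xB" "xE \<noteq> xB" "xE \<noteq> xC" "xG \<noteq> xC" "xG \<noteq> xA"
    and tri: "xA \<noteq> xB" "yC \<noteq> m3 * xC + b3"
  shows False
proof -
  have inK: "xA \<in> K" "xB \<in> K" "xC \<in> K" "xD \<in> K" "xE \<in> K" "xG \<in> K"
      "yA \<in> K" "yB \<in> K" "yC \<in> K" "yD \<in> K" "yE \<in> K" "yG \<in> K"
    and U: "yA + cj yA = xA * cj xA" "yB + cj yB = xB * cj xB" "yC + cj yC = xC * cj xC"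
      "yD + cj yD = xD * cj xD" "yE + cj yE = xE * cj xE" "yG + cj yG = xG * cj xG"
    using pts by (auto simp: pts_def)
  have cl: "cj y = cj m * cj x + cj b" if "y = m * x + b" for x y m b
    by (simp add: that cj_simps)
  define hAB where "hAB = yA + cj yB - xA * cj xB"
  define hBC where "hBC = yB + cj yC - xB * cj xC"
  define hCA where "hCA = yC + cj yA - xC * cj xA"
  have cjh: "cj hAB = yB + cj yA - xB * cj xA" "cj hBC = yC + cj yB - xC * cj xB"
      "cj hCA = yA + cj yC - xA * cj xC"
    using inK by (simp_all add: hAB_def hBC_def hCA_def cj_simps K_cjcj)
  define det where "det = xA * (yB - yC) + xB * (yC - yA) + xC * (yA - yB)"
  have "det = (xB - xA) * (yC - (m3 * xC + b3))"
    unfolding det_def l3 by (simp add: algebra_simps)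
  with tri have det0: "det \<noteq> 0" by simp
  define P where "P = (xD - xB) * (xE - xC) * (xG - xA)"
  define Q where "Q = (xA - xD) * (xB - xE) * (xC - xG)"
  have PQ: "P + Q = 0"
    unfolding P_def Q_def
    by (rule menelaus[OF l1 l2 l3 l4 det0[unfolded det_def]])
  have P0: "P \<noteq> 0" using ne by (simp add: P_def)
  have t1: "(xD - xB) * cj (xA - xD) * hAB + (xA - xD) * cj (xD - xB) * cj hAB = 0"
    unfolding cjh(1) unfolding hAB_def cj_diff
    by (rule isotropic_third_point[OF l3(1,2,3) cl[OF l3(1)] cl[OF l3(2)] cl[OF l3(3)] U(1,2,4)])
  have t2: "(xE - xC) * cj (xB - xE) * hBC + (xB - xE) * cj (xE - xC) * cj hBC = 0"
    unfolding cjh(2) unfolding hBC_def cj_diff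
    by (rule isotropic_third_point[OF l1(1,2,3) cl[OF l1(1)] cl[OF l1(2)] cl[OF l1(3)] U(2,3,5)])
  have t3: "(xG - xA) * cj (xC - xG) * hCA + (xC - xG) * cj (xG - xA) * cj hCA = 0"
    unfolding cjh(3) unfolding hCA_def cj_diff
    by (rule isotropic_third_point[OF l2(1,2,3) cl[OF l2(1)] cl[OF l2(2)] cl[OF l2(3)] U(3,1,6)])
  define h where "h = hAB * hBC * hCA"
  have "(P * cj Q) * h = ((xD - xB) * cj (xA - xD) * hAB) * ((xE - xC) * cj (xB - xE) * hBC)
      * ((xG - xA) * cj (xC - xG) * hCA)"
    unfolding P_def Q_def h_def by (simp add: cj_mult)
  also have "\<dots> = (- ((xA - xD) * cj (xD - xB) * cj hAB)) * (- ((xB - xE) * cj (xE - xC) * cj hBC))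
      * (- ((xC - xG) * cj (xG - xA) * cj hCA))"
    by (simp only: t1[folded eq_neg_iff_add_eq_0] t2[folded eq_neg_iff_add_eq_0] t3[folded eq_neg_iff_add_eq_0])
  also have "\<dots> = - ((Q * cj P) * cj h)"
    unfolding P_def Q_def h_def by (simp add: cj_mult)
  finally have "(P * cj Q) * h + (Q * cj P) * cj h = 0" by simp
  \<comment> \<open>By Menelaus both terms now share the factor \<open>P * cj P\<close>, which is
    nonzero and can be cancelled.\<close>
  moreover have "Q = - P" using PQ by (simp add: eq_neg_iff_add_eq_0 add.commute)
  then have "(P * cj Q) * h + (Q * cj P) * cj h = - ((P * cj P) * (h + cj h))"
    by (simp add: cj_minus algebra_simps)
  ultimately have "(P * cj P) * (h + cj h) = 0" by simp
  then have "h + cj h = 0" using P0 by simp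
  moreover have "h + cj h = det * cj det"
  proof -
    have "h + cj h = hAB * hBC * hCA
        + (yB + cj yA - xB * cj xA) * (yC + cj yB - xC * cj xB) * (yA + cj yC - xA * cj xC)"
      by (simp only: h_def cj_mult cjh)
    also have "\<dots> = det * (cj xA * (cj yB - cj yC) + cj xB * (cj yC - cj yA) + cj xC * (cj yA - cj yB))"
      unfolding hAB_def hBC_def hCA_def det_def by (rule isotropic_gram[OF U(1,2,3)])
    also have "\<dots> = det * cj det"
      by (simp only: det_def cj_add cj_diff cj_mult)
    finally show ?thesis .
  qed
  ultimately show False using det0 by simp
qed

lemma no_onan:
  assumes L: "l1 \<in> lines" "l2 \<in> lines" "l3 \<in> lines" "l4 \<in> lines"
    and meet: "l1 \<inter> l2 \<noteq> {}" "l1 \<inter> l3 \<noteq> {}" "l2 \<inter> l3 \<noteq> {}"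
      "l1 \<inter> l4 \<noteq> {}" "l2 \<inter> l4 \<noteq> {}" "l3 \<inter> l4 \<noteq> {}"
    and conc: "l1 \<inter> l2 \<inter> l3 = {}" "l1 \<inter> l2 \<inter> l4 = {}" "l1 \<inter> l3 \<inter> l4 = {}" "l2 \<inter> l3 \<inter> l4 = {}"
  shows False
proof -
  obtain m1 b1 m2 b2 m3 b3 m4 b4 where l: "l1 = line m1 b1" "l2 = line m2 b2" "l3 = line m3 b3" "l4 = line m4 b4"
    using L unfolding lines_def by auto
  obtain xA yA where A: "(xA, yA) \<in> l2 \<inter> l3" using meet(3) by (metis ex_in_conv surj_pair)
  obtain xB yB where B: "(xB, yB) \<in> l1 \<inter> l3" using meet(2) by (metis ex_in_conv surj_pair)
  obtain xC yC where C: "(xC, yC) \<in> l1 \<inter> l2" using meet(1) by (metis ex_in_conv surj_pair)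
  obtain xD yD where D: "(xD, yD) \<in> l3 \<inter> l4" using meet(6) by (metis ex_in_conv surj_pair)
  obtain xE yE where E: "(xE, yE) \<in> l1 \<inter> l4" using meet(4) by (metis ex_in_conv surj_pair)
  obtain xG yG where G: "(xG, yG) \<in> l2 \<inter> l4" using meet(5) by (metis ex_in_conv surj_pair)
  \<comment> \<open>No line is vertical, so distinct points of a line differ already in their first
    coordinate, as \<open>onan_algebra\<close> demands.\<close>
  have sep: "x \<noteq> x'" if "l \<in> lines" "(x, y) \<in> l" "(x', y') \<in> l" "(x, y) \<in> S" "(x', y') \<notin> S" for x y x' y' l S
  proof
    assume "x = x'"
    obtain m b where "l = line m b" using \<open>l \<in> lines\<close> by (auto simp: lines_def)
    with that(2,3) \<open>x = x'\<close> have "y = y'" using line_coord_eq by blast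
    with that(4,5) \<open>x = x'\<close> show False by simp
  qed
  have A4: "(xA, yA) \<notin> l4" and B4: "(xB, yB) \<notin> l4" and C4: "(xC, yC) \<notin> l4" and B2: "(xB, yB) \<notin> l2"
      and C3: "(xC, yC) \<notin> l3"
    using A B C conc by blast+
  have xs: "xD \<noteq> xA" "xD \<noteq> xB" "xE \<noteq> xB" "xE \<noteq> xC" "xG \<noteq> xC" "xG \<noteq> xA" "xA \<noteq> xB"
    using sep[OF L(3) IntD1[OF D] IntD2[OF A] IntD2[OF D] A4]
      sep[OF L(3) IntD1[OF D] IntD2[OF B] IntD2[OF D] B4]
      sep[OF L(1) IntD1[OF E] IntD1[OF B] IntD2[OF E] B4]
      sep[OF L(1) IntD1[OF E] IntD1[OF C] IntD2[OF E] C4]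
      sep[OF L(2) IntD1[OF G] IntD2[OF C] IntD2[OF G] C4]
      sep[OF L(2) IntD1[OF G] IntD1[OF A] IntD2[OF G] A4]
      sep[OF L(3) IntD2[OF A] IntD2[OF B] IntD1[OF A] B2] .
  have in_pts: "P \<in> pts" if "l \<in> lines" "P \<in> l" for P l
    using that line_subset_pts by (auto simp: lines_def)
  note p = in_pts[OF L(2) IntD1[OF A]] in_pts[OF L(1) IntD1[OF B]] in_pts[OF L(1) IntD1[OF C]]
    in_pts[OF L(3) IntD1[OF D]] in_pts[OF L(1) IntD1[OF E]] in_pts[OF L(2) IntD1[OF G]]
  have C3': "yC \<noteq> m3 * xC + b3" using p(3) C3 by (auto simp: line_def l)
  have coords: "y = m * x + b \<and> y = m' * x + b'" if "(x, y) \<in> line m b \<inter> line m' b'" for x y m b m' b'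
    using that by (auto simp: line_def)
  note eA = coords[OF A[unfolded l]] and eB = coords[OF B[unfolded l]] and eC = coords[OF C[unfolded l]]
    and eD = coords[OF D[unfolded l]] and eE = coords[OF E[unfolded l]] and eG = coords[OF G[unfolded l]]
  show False
    by (rule onan_algebra[OF p eB[THEN conjunct1] eC[THEN conjunct1] eE[THEN conjunct1]
          eC[THEN conjunct2] eA[THEN conjunct1] eG[THEN conjunct1]
          eA[THEN conjunct2] eB[THEN conjunct2] eD[THEN conjunct1]
          eD[THEN conjunct2] eE[THEN conjunct2] eG[THEN conjunct2] xs C3'])
qed

end

section \<open>Counting labellings\<close>

lemma sum_card_swap:
  assumes "finite A" "finite B"
  shows "(\<Sum>a\<in>A. card {b \<in> B. P a b}) = (\<Sum>b\<in>B. card {a \<in> A. P a b})"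
proof -
  have "(\<Sum>a\<in>A. card {b \<in> B. P a b}) = (\<Sum>a\<in>A. \<Sum>b\<in>B. of_bool (P a b))"
    using assms by (intro sum.cong refl) (simp add: Int_def)
  also have "\<dots> = (\<Sum>b\<in>B. \<Sum>a\<in>A. of_bool (P a b))" by (rule sum.swap)
  also have "\<dots> = (\<Sum>b\<in>B. card {a \<in> A. P a b})"
    using assms by (intro sum.cong refl) (simp add: Int_def)
  finally show ?thesis .
qed

text \<open>Neither \<open>Q\<close> nor \<open>h\<close> looks at coordinate \<open>a\<close>, so
  \<open>f a\<close> is uniform given all other coordinates. This is conditional probability
  \<open>1 / card \<Lambda>\<close>, kept in product form over the naturals.\<close>

lemma card_PiE_fix_coordinate:
  fixes Q :: "('i \<Rightarrow> 'b) \<Rightarrow> bool" and h :: "('i \<Rightarrow> 'b) \<Rightarrow> 'b"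
  assumes "finite I" "a \<in> I" "finite \<Lambda>"
    and Q: "\<And>f z. Q (f(a := z)) \<longleftrightarrow> Q f"
    and h: "\<And>f z. h (f(a := z)) = h f" "\<And>f. f \<in> PiE I (\<lambda>_. \<Lambda>) \<Longrightarrow> h f \<in> \<Lambda>"
  shows "card {f \<in> PiE I (\<lambda>_. \<Lambda>). Q f} = card {f \<in> PiE I (\<lambda>_. \<Lambda>). Q f \<and> f a = h f} * card \<Lambda>"
proof -
  let ?A = "{f \<in> PiE I (\<lambda>_. \<Lambda>). Q f \<and> f a = h f}"
  have upd: "f(a := z) \<in> PiE I (\<lambda>_. \<Lambda>)" if "f \<in> PiE I (\<lambda>_. \<Lambda>)" "z \<in> \<Lambda>" for f z
    using that \<open>a \<in> I\<close> by (auto simp: PiE_iff extensional_def)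
  have "bij_betw (\<lambda>(f, z). f(a := z)) (?A \<times> \<Lambda>) {f \<in> PiE I (\<lambda>_. \<Lambda>). Q f}"
  proof (rule bij_betwI[where g = "\<lambda>f. (f(a := h f), f a)"])
    show "(\<lambda>(f, z). f(a := z)) \<in> ?A \<times> \<Lambda> \<rightarrow> {f \<in> PiE I (\<lambda>_. \<Lambda>). Q f}"
      using upd Q by auto
    show "(\<lambda>f. (f(a := h f), f a)) \<in> {f \<in> PiE I (\<lambda>_. \<Lambda>). Q f} \<rightarrow> ?A \<times> \<Lambda>"
      using upd Q h \<open>a \<in> I\<close> by (auto simp: PiE_mem)
    show "(\<lambda>f. (f(a := h f), f a)) ((\<lambda>(f, z). f(a := z)) x) = x" if "x \<in> ?A \<times> \<Lambda>" for x
    proof -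
      obtain f z where x: "x = (f, z)" by (cases x)
      with that have "f a = h f" by simp
      then show ?thesis using h(1) by (simp add: x flip: \<open>f a = h f\<close>)
    qed
  qed auto
  then have "card (?A \<times> \<Lambda>) = card {f \<in> PiE I (\<lambda>_. \<Lambda>). Q f}" by (rule bij_betw_same_card)
  then show ?thesis by (simp add: card_cartesian_product)
qed

text \<open>Every left side is a coordinate in \<open>A\<close> and every right side reads a
  coordinate outside \<open>A\<close>. The equations can therefore be imposed one at a time, and
  each costs a factor \<open>card \<Lambda>\<close>.\<close>

lemma card_PiE_system:
  fixes \<sigma> :: "'i \<Rightarrow> 'i" and g :: "'i \<Rightarrow> 'b \<Rightarrow> 'b"
  assumes "finite I" "finite \<Lambda>" "A \<subseteq> I"
    and "\<And>a. a \<in> A \<Longrightarrow> \<sigma> a \<in> I - A" "\<And>a z. a \<in> A \<Longrightarrow> z \<in> \<Lambda> \<Longrightarrow> g a z \<in> \<Lambda>"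
  shows "card {f \<in> PiE I (\<lambda>_. \<Lambda>). \<forall>a\<in>A. f a = g a (f (\<sigma> a))} * card \<Lambda> ^ card A = card \<Lambda> ^ card I"
proof -
  have "finite A" using assms(1,3) by (rule rev_finite_subset)
  then show ?thesis using assms(3-5)
  proof (induction A)
    case empty
    then show ?case using assms(1) by (simp add: card_PiE)
  next
    case (insert a A)
    have IH: "card {f \<in> PiE I (\<lambda>_. \<Lambda>). \<forall>a\<in>A. f a = g a (f (\<sigma> a))} * card \<Lambda> ^ card A = card \<Lambda> ^ card I"
      using insert.prems by (intro insert.IH) auto
    have "card {f \<in> PiE I (\<lambda>_. \<Lambda>). \<forall>a\<in>A. f a = g a (f (\<sigma> a))}
      = card {f \<in> PiE I (\<lambda>_. \<Lambda>). (\<forall>a\<in>A. f a = g a (f (\<sigma> a))) \<and> f a = g a (f (\<sigma> a))} * card \<Lambda>"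
    proof (rule card_PiE_fix_coordinate)
      show "a \<in> I" using insert.prems by simp
      have "\<sigma> a \<noteq> a" using insert.prems(2)[of a] by auto
      then show "g a ((f(a := z)) (\<sigma> a)) = g a (f (\<sigma> a))" for f z by simp
      have "\<sigma> b \<noteq> a" "b \<noteq> a" if "b \<in> A" for b
        using insert.prems(2)[of b] insert.hyps(2) that by auto
      then show "(\<forall>b\<in>A. (f(a := z)) b = g b ((f(a := z)) (\<sigma> b))) \<longleftrightarrow> (\<forall>b\<in>A. f b = g b (f (\<sigma> b)))" for f z
        by auto
      show "g a (f (\<sigma> a)) \<in> \<Lambda>" if "f \<in> PiE I (\<lambda>_. \<Lambda>)" for f
        using that insert.prems by (auto simp: PiE_mem)
    qed (use assms in auto)
    moreover have "{f \<in> PiE I (\<lambda>_. \<Lambda>). \<forall>b\<in>insert a A. f b = g b (f (\<sigma> b))}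
      = {f \<in> PiE I (\<lambda>_. \<Lambda>). (\<forall>a\<in>A. f a = g a (f (\<sigma> a))) \<and> f a = g a (f (\<sigma> a))}" by auto
    ultimately show ?case using IH insert.hyps by (simp add: mult_ac)
  qed
qed

text \<open>As soon as there are more coordinates in \<open>Z\<close> than keys, two of them share a key; discarding
  such a pair costs a factor \<open>1 - 1/\<bar>\<Lambda>\<bar>\<close>.\<close>

lemma card_PiE_conflict_free:
  fixes c :: "'b \<Rightarrow> 'b" and \<kappa> :: "'i \<Rightarrow> 'k"
  assumes "finite I" "finite \<Lambda>" "\<Lambda> \<noteq> {}" "Z \<subseteq> I" "finite U" "\<kappa> ` Z \<subseteq> U"
    and c: "\<And>z. z \<in> \<Lambda> \<Longrightarrow> c z \<in> \<Lambda>"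
    and "card U + 2 * t \<le> card Z"
  shows "real (card {f \<in> PiE I (\<lambda>_. \<Lambda>). \<forall>a\<in>Z. \<forall>b\<in>Z. \<kappa> a = \<kappa> b \<longrightarrow> f a \<noteq> c (f b)})
    \<le> (1 - 1 / real (card \<Lambda>)) ^ t * real (card \<Lambda>) ^ card I"
  using assms(4,6,8)
proof (induction t arbitrary: Z)
  case 0
  have "card {f \<in> PiE I (\<lambda>_. \<Lambda>). \<forall>a\<in>Z. \<forall>b\<in>Z. \<kappa> a = \<kappa> b \<longrightarrow> f a \<noteq> c (f b)} \<le> card (PiE I (\<lambda>_. \<Lambda>))"
    using assms(1,2) by (intro card_mono finite_PiE) auto
  also have "\<dots> = card \<Lambda> ^ card I" using assms(1) by (simp add: card_PiE)
  finally show ?case by (simp flip: of_nat_power)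
next
  case (Suc t)
  have finX: "finite Z" using Suc.prems(1) assms(1) by (rule finite_subset)
  have "card (\<kappa> ` Z) \<le> card U" using assms(5) Suc.prems(2) by (rule card_mono)
  then have "\<not> inj_on \<kappa> Z" using Suc.prems(3) card_image by fastforce
  then obtain a b where ab: "a \<in> Z" "b \<in> Z" "a \<noteq> b" "\<kappa> a = \<kappa> b" by (auto simp: inj_on_def)
  define Y where "Y = Z - {a, b}"
  let ?Q = "\<lambda>Z f. \<forall>a\<in>Z. \<forall>b\<in>Z. \<kappa> a = \<kappa> b \<longrightarrow> f a \<noteq> c (f b)"
  let ?F = "\<lambda>Z. {f \<in> PiE I (\<lambda>_. \<Lambda>). ?Q Z f}"
  let ?G = "{f \<in> PiE I (\<lambda>_. \<Lambda>). ?Q Y f \<and> f a = c (f b)}"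
  have "card Y = card Z - 2" using ab finX by (simp add: Y_def card_Diff_subset)
  then have IH: "real (card (?F Y)) \<le> (1 - 1 / real (card \<Lambda>)) ^ t * real (card \<Lambda>) ^ card I"
    using Suc.prems by (intro Suc.IH) (auto simp: Y_def)
  have fin: "finite (PiE I (\<lambda>_. \<Lambda>))" using assms(1,2) by (intro finite_PiE) auto
  \<comment> \<open>The conditions on \<open>Y\<close> do not involve coordinate \<open>a\<close>,
    so among the survivors a fraction of exactly \<open>1 / card \<Lambda>\<close> has the conflict
    between \<open>a\<close> and \<open>b\<close>.\<close>
  have "card (?F Y) = card ?G * card \<Lambda>"
  proof (rule card_PiE_fix_coordinate)
    have "a \<notin> Y" by (simp add: Y_def)
    then show "?Q Y (f(a := z)) \<longleftrightarrow> ?Q Y f" for f z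
      by (intro ball_cong refl) (metis fun_upd_other)
    show "c (f b) \<in> \<Lambda>" if "f \<in> PiE I (\<lambda>_. \<Lambda>)" for f
      using that ab Suc.prems(1) c by (auto simp: PiE_mem subset_iff)
  qed (use ab assms Suc.prems in auto)
  then have G: "real (card ?G) = real (card (?F Y)) / real (card \<Lambda>)"
    using assms(2,3) by (simp add: field_simps)
  have "?F Z \<subseteq> ?F Y - ?G" using ab by (auto simp: Y_def)
  then have "card (?F Z) \<le> card (?F Y - ?G)" using fin by (intro card_mono) auto
  also have "\<dots> = card (?F Y) - card ?G" using fin by (intro card_Diff_subset) auto
  finally have "real (card (?F Z)) \<le> real (card (?F Y)) - real (card ?G)"
    using fin card_mono[of "?F Y" ?G] by (simp add: of_nat_diff subset_iff)
  also have "\<dots> = (1 - 1 / real (card \<Lambda>)) * real (card (?F Y))" by (simp add: G algebra_simps)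
  also have "\<dots> \<le> (1 - 1 / real (card \<Lambda>)) * ((1 - 1 / real (card \<Lambda>)) ^ t * real (card \<Lambda>) ^ card I)"
    using IH assms(2,3) by (intro mult_left_mono) (auto simp: Suc_le_eq card_gt_0_iff)
  finally show ?case by simp
qed

section \<open>Random labels on a space without O'Nan configurations\<close>

definition flip :: "bool \<times> nat \<Rightarrow> bool \<times> nat" where "flip z = (\<not> fst z, snd z)"

lemma flip_flip [simp]: "flip (flip z) = z" by (simp add: flip_def)

lemma flip_neq [simp]: "flip z \<noteq> z" "z \<noteq> flip z" by (auto simp: flip_def prod_eq_iff)

lemma flip_eq_iff [simp]: "flip y = flip z \<longleftrightarrow> y = z" by (auto simp: flip_def prod_eq_iff)

text \<open>Everything that the random construction takes from the unital. The numbers of points and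
  lines stay open until the parameters are chosen.\<close>

locale onan_free_space =
  fixes U :: "'p set" and L :: "'p set set" and q :: nat
  assumes finite_U: "finite U" and finite_L: "finite L" and q_pos: "q > 0"
    and line_subset: "l \<in> L \<Longrightarrow> l \<subseteq> U"
    and line_card: "l \<in> L \<Longrightarrow> card l = q + 1"
    and point_card: "card {l \<in> L. P \<in> l} \<le> q\<^sup>2"
    and meet_once: "l \<in> L \<Longrightarrow> l' \<in> L \<Longrightarrow> P \<in> l \<Longrightarrow> P \<in> l' \<Longrightarrow> Q \<in> l \<Longrightarrow> Q \<in> l' \<Longrightarrow> P \<noteq> Q \<Longrightarrow> l = l'"
    and no_onan: "l1 \<in> L \<Longrightarrow> l2 \<in> L \<Longrightarrow> l3 \<in> L \<Longrightarrow> l4 \<in> L \<Longrightarrow>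
      l1 \<inter> l2 \<noteq> {} \<Longrightarrow> l1 \<inter> l3 \<noteq> {} \<Longrightarrow> l2 \<inter> l3 \<noteq> {} \<Longrightarrow>
      l1 \<inter> l4 \<noteq> {} \<Longrightarrow> l2 \<inter> l4 \<noteq> {} \<Longrightarrow> l3 \<inter> l4 \<noteq> {} \<Longrightarrow>
      l1 \<inter> l2 \<inter> l3 = {} \<Longrightarrow> l1 \<inter> l2 \<inter> l4 = {} \<Longrightarrow> l1 \<inter> l3 \<inter> l4 = {} \<Longrightarrow> l2 \<inter> l3 \<inter> l4 = {} \<Longrightarrow> False"
begin

lemma finite_line: "l \<in> L \<Longrightarrow> finite l"
  using line_card by (metis card.infinite add_is_0 one_neq_zero)

definition meeting_pairs :: "('p set \<times> 'p set) set"
  where "meeting_pairs = {(l, l'). l \<in> L \<and> l' \<in> L \<and> l \<noteq> l' \<and> l \<inter> l' \<noteq> {}}"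

definition triangles :: "('p set \<times> 'p set \<times> 'p set) set"
  where "triangles = {(l, l', l''). (l, l') \<in> meeting_pairs \<and> (l, l'') \<in> meeting_pairs \<and>
    (l', l'') \<in> meeting_pairs \<and> l \<inter> l' \<inter> l'' = {}}"

lemma finite_meeting_pairs: "finite meeting_pairs"
  by (rule finite_subset[of _ "L \<times> L"]) (auto simp: meeting_pairs_def finite_L)

lemma card_meeting_pairs: "card meeting_pairs \<le> 2 * card L * q ^ 3"
proof -
  have "card meeting_pairs \<le> card (SIGMA l:L. \<Union>P\<in>l. {l' \<in> L. P \<in> l'})"
    by (rule card_mono) (auto simp: meeting_pairs_def finite_L finite_line)
  also have "\<dots> = (\<Sum>l\<in>L. card (\<Union>P\<in>l. {l' \<in> L. P \<in> l'}))"
    by (rule card_SigmaI) (auto simp: finite_L finite_line)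
  also have "\<dots> \<le> (\<Sum>l\<in>L. (q + 1) * q\<^sup>2)"
  proof (rule sum_mono)
    fix l assume l: "l \<in> L"
    have "card (\<Union>P\<in>l. {l' \<in> L. P \<in> l'}) \<le> (\<Sum>P\<in>l. card {l' \<in> L. P \<in> l'})"
      using l by (intro card_UN_le finite_line)
    also have "\<dots> \<le> (\<Sum>P\<in>l. q\<^sup>2)" by (intro sum_mono point_card)
    finally show "card (\<Union>P\<in>l. {l' \<in> L. P \<in> l'}) \<le> (q + 1) * q\<^sup>2"
      using l by (simp add: line_card)
  qed
  also have "\<dots> \<le> (\<Sum>l\<in>L. (2 * q) * q\<^sup>2)"
    using q_pos by (intro sum_mono mult_le_mono) auto
  also have "\<dots> = 2 * card L * q ^ 3" by (simp add: power2_eq_square power3_eq_cube)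
  finally show ?thesis .
qed

text \<open>Given two meeting lines, the third side is determined by its points on them, two
  different points since the three lines are not concurrent. This leaves
  \<open>(q + 1) * (q + 1)\<close> choices, at most \<open>4 * q ^ 2\<close>.\<close>

lemma card_triangles: "card triangles \<le> 8 * card L * q ^ 5"
proof -
  let ?T = "\<lambda>l l'. \<Union>P\<in>l. \<Union>P'\<in>l'. {l'' \<in> L. P \<noteq> P' \<and> P \<in> l'' \<and> P' \<in> l''}"
  have finT: "finite (case x of (l, l') \<Rightarrow> ?T l l')" if "x \<in> meeting_pairs" for x
    using that by (auto simp: meeting_pairs_def finite_L finite_line)
  let ?S = "SIGMA x:meeting_pairs. case x of (l, l') \<Rightarrow> ?T l l'"
  have fin: "finite ?S" using finite_meeting_pairs finT by blast
  have "triangles \<subseteq> (\<lambda>((l, l'), l''). (l, l', l'')) ` ?S"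
  proof
    fix t assume "t \<in> triangles"
    then obtain l l' l'' where t: "t = (l, l', l'')" and m: "(l, l') \<in> meeting_pairs"
        "(l, l'') \<in> meeting_pairs" "(l', l'') \<in> meeting_pairs" "l \<inter> l' \<inter> l'' = {}"
      by (auto simp: triangles_def)
    then obtain P P' where P: "P \<in> l" "P \<in> l''" "P' \<in> l'" "P' \<in> l''"
      by (auto simp: meeting_pairs_def)
    moreover have "P \<noteq> P'" using m(4) P by blast
    moreover have "l'' \<in> L" using m(2) by (simp add: meeting_pairs_def)
    ultimately have "((l, l'), l'') \<in> ?S" using m(1) by blast
    then show "t \<in> (\<lambda>((l, l'), l''). (l, l', l'')) ` ?S" using t by force
  qed
  then have "card triangles \<le> card ?S"
    using fin by (meson card_image_le card_mono finite_imageI le_trans)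
  also have "\<dots> = (\<Sum>x\<in>meeting_pairs. card (case x of (l, l') \<Rightarrow> ?T l l'))"
    using finite_meeting_pairs finT by (intro card_SigmaI) auto
  also have "\<dots> \<le> (\<Sum>x\<in>meeting_pairs. 4 * q\<^sup>2)"
  proof (rule sum_mono)
    fix x assume "x \<in> meeting_pairs"
    then obtain l l' where x: "x = (l, l')" and l: "l \<in> L" "l' \<in> L" by (auto simp: meeting_pairs_def)
    have one: "card {l'' \<in> L. P \<noteq> P' \<and> P \<in> l'' \<and> P' \<in> l''} \<le> 1" for P P'
      using meet_once by (intro card_le_Suc0_iff_eq[THEN iffD2, folded One_nat_def]) (auto simp: finite_L)
    have "card (?T l l') \<le> (\<Sum>P\<in>l. card (\<Union>P'\<in>l'. {l'' \<in> L. P \<noteq> P' \<and> P \<in> l'' \<and> P' \<in> l''}))"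
      using l by (intro card_UN_le finite_line)
    also have "\<dots> \<le> (\<Sum>P\<in>l. \<Sum>P'\<in>l'. card {l'' \<in> L. P \<noteq> P' \<and> P \<in> l'' \<and> P' \<in> l''})"
      using l by (intro sum_mono card_UN_le finite_line)
    also have "\<dots> \<le> (\<Sum>P\<in>l. \<Sum>P'\<in>l'. 1)" by (intro sum_mono one)
    also have "\<dots> = (q + 1) * (q + 1)" using l by (simp add: line_card)
    also have "\<dots> \<le> (2 * q) * (2 * q)" using q_pos by (intro mult_le_mono) auto
    finally show "card (case x of (l, l') \<Rightarrow> ?T l l') \<le> 4 * q\<^sup>2" by (simp add: x power2_eq_square)
  qed
  also have "\<dots> = 4 * q\<^sup>2 * card meeting_pairs" by simp
  also have "\<dots> \<le> 4 * q\<^sup>2 * (2 * card L * q ^ 3)" by (intro mult_le_mono card_meeting_pairs) auto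
  also have "\<dots> = 8 * card L * (q\<^sup>2 * q ^ 3)" by simp
  also have "q\<^sup>2 * q ^ 3 = q ^ 5" by (simp flip: power_add)
  finally show ?thesis .
qed

section \<open>The random graph on copies of lines\<close>

definition verts :: "nat \<Rightarrow> ('p set \<times> nat) set" where "verts r = L \<times> {..<r}"

definition labels :: "nat \<Rightarrow> (bool \<times> nat) set" where "labels s = UNIV \<times> {..<s}"

definition labellings :: "nat \<Rightarrow> nat \<Rightarrow> ('p \<times> 'p set \<times> nat \<Rightarrow> bool \<times> nat) set"
  where "labellings r s = PiE (U \<times> verts r) (\<lambda>_. labels s)"

text \<open>Copies of one line are always joined, and a vertex is joined to itself: the reflexive
  form is the one that can be pulled back along a map that is not injective.\<close>

definition joined :: "('p \<times> 'p set \<times> nat \<Rightarrow> bool \<times> nat) \<Rightarrow> 'p set \<times> nat \<Rightarrow> 'p set \<times> nat \<Rightarrow> bool"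
  where "joined f x y \<longleftrightarrow> fst x = fst y \<or> (\<exists>P \<in> fst x \<inter> fst y. f (P, x) = flip (f (P, y)))"

definition quads :: "nat \<Rightarrow> ('p \<times> 'p set \<times> nat \<Rightarrow> bool \<times> nat) \<Rightarrow>
    (('p set \<times> nat) \<times> ('p set \<times> nat) \<times> ('p set \<times> nat) \<times> ('p set \<times> nat)) set"
  where "quads r f = {(w, x, y, z). {w, x, y, z} \<subseteq> verts r \<and> distinct [w, x, y, z] \<and>
    joined f w x \<and> joined f w y \<and> joined f w z \<and> joined f x y \<and> joined f x z \<and> joined f y z}"

lemma joined_refl [simp]: "joined f x x" by (simp add: joined_def)

lemma joined_sym: "joined f x y \<longleftrightarrow> joined f y x"
  unfolding joined_def by (metis Int_commute flip_flip)

lemma finite_verts: "finite (verts r)" by (simp add: verts_def finite_L)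

lemma card_verts: "card (verts r) = card L * r" by (simp add: verts_def card_cartesian_product)

lemma finite_labels: "finite (labels s)" by (simp add: labels_def)

lemma card_labels: "card (labels s) = 2 * s"
  by (simp add: labels_def card_cartesian_product)

lemma flip_labels: "z \<in> labels s \<Longrightarrow> flip z \<in> labels s"
  by (auto simp: labels_def flip_def)

lemma finite_labellings: "finite (labellings r s)"
  unfolding labellings_def using finite_U finite_verts finite_labels by (intro finite_PiE) auto

lemma card_labellings: "card (labellings r s) = card (labels s) ^ card (U \<times> verts r)"
  unfolding labellings_def using finite_U finite_verts by (subst card_PiE) auto

lemma joined_meet: "joined f x y \<Longrightarrow> fst x \<noteq> fst y \<Longrightarrow> fst x \<inter> fst y \<noteq> {}"
  by (auto simp: joined_def)

lemma joined_at:
  assumes "joined f x y" "fst x \<noteq> fst y" "fst x \<in> L" "fst y \<in> L" "P \<in> fst x" "P \<in> fst y"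
  shows "f (P, x) = flip (f (P, y))"
proof -
  obtain Q where "Q \<in> fst x" "Q \<in> fst y" "f (Q, x) = flip (f (Q, y))"
    using assms(1,2) by (auto simp: joined_def)
  moreover from this have "Q = P" using meet_once[OF assms(3,4) _ _ assms(5,6)] assms(2) by blast
  ultimately show ?thesis by simp
qed

text \<open>The two halves of the label set make the graph on the lines through a point bipartite.\<close>

lemma not_concurrent:
  assumes "joined f x y" "joined f x z" "joined f y z"
    and "fst x \<noteq> fst y" "fst x \<noteq> fst z" "fst y \<noteq> fst z" "fst x \<in> L" "fst y \<in> L" "fst z \<in> L"
  shows "fst x \<inter> fst y \<inter> fst z = {}"
proof (rule ccontr)
  assume "fst x \<inter> fst y \<inter> fst z \<noteq> {}"
  then obtain P where P: "P \<in> fst x" "P \<in> fst y" "P \<in> fst z" by blast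
  have "f (P, x) = flip (f (P, y))" "f (P, x) = flip (f (P, z))" "f (P, y) = flip (f (P, z))"
    by (rule joined_at[OF assms(1,4,7,8) P(1,2)], rule joined_at[OF assms(2,5,7,9) P(1,3)],
        rule joined_at[OF assms(3,6,8,9) P(2,3)])
  then show False by (metis flip_neq(1))
qed

lemma quad_lines_not_distinct:
  assumes "(w, x, y, z) \<in> quads r f"
  shows "\<not> distinct [fst w, fst x, fst y, fst z]"
proof
  assume d: "distinct [fst w, fst x, fst y, fst z]"
  have L: "fst w \<in> L" "fst x \<in> L" "fst y \<in> L" "fst z \<in> L"
    and J: "joined f w x" "joined f w y" "joined f w z" "joined f x y" "joined f x z" "joined f y z"
    using assms unfolding quads_def verts_def by (simp_all add: mem_Times_iff)
  have ne: "fst w \<noteq> fst x" "fst w \<noteq> fst y" "fst w \<noteq> fst z" "fst x \<noteq> fst y" "fst x \<noteq> fst z" "fst y \<noteq> fst z"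
    using d by simp_all
  show False
    by (rule no_onan[OF L joined_meet[OF J(1) ne(1)] joined_meet[OF J(2) ne(2)] joined_meet[OF J(4) ne(4)]
          joined_meet[OF J(3) ne(3)] joined_meet[OF J(5) ne(5)] joined_meet[OF J(6) ne(6)]
          not_concurrent[OF J(1,2,4) ne(1,2,4) L(1,2,3)] not_concurrent[OF J(1,3,5) ne(1,3,5) L(1,2,4)]
          not_concurrent[OF J(2,3,6) ne(2,3,6) L(1,3,4)] not_concurrent[OF J(4,5,6) ne(4,5,6) L(2,3,4)]])
qed

section \<open>Cliques of size four sorted by coincidences among their lines\<close>

definition quads4 where
  "quads4 r = {(w, x, y, z). {w, x, y, z} \<subseteq> verts r \<and> fst w = fst x \<and> fst x = fst y \<and> fst y = fst z}"

definition quads31 where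
  "quads31 r f = {(w, x, y, z) \<in> quads r f. fst w = fst x \<and> fst x = fst y \<and> fst y \<noteq> fst z}"

definition quads22 where
  "quads22 r f = {(w, x, y, z) \<in> quads r f. fst w = fst x \<and> fst y = fst z \<and> fst x \<noteq> fst y}"

definition quads211 where
  "quads211 r f = {(w, x, y, z) \<in> quads r f. fst w = fst x \<and> fst x \<noteq> fst y \<and> fst x \<noteq> fst z \<and> fst y \<noteq> fst z}"

lemma finite_quads: "finite (quads r f)"
  by (rule finite_subset[of _ "verts r \<times> verts r \<times> verts r \<times> verts r"]) (auto simp: quads_def finite_verts)

lemma quads_permute:
  assumes "(w, x, y, z) \<in> quads r f"
  shows "(w, x, z, y) \<in> quads r f" "(w, y, x, z) \<in> quads r f" "(x, w, y, z) \<in> quads r f"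
proof -
  have s: "joined f b a" if "joined f a b" for a b using that joined_sym by blast
  show "(w, x, z, y) \<in> quads r f" "(w, y, x, z) \<in> quads r f" "(x, w, y, z) \<in> quads r f"
    using assms unfolding quads_def by (auto intro: s)
qed

text \<open>The coefficients count the placements of each type on four positions: four choices of
  the vertex on a line of its own, three pairings, six choices of the pair on a common line. Four
  different lines are excluded by \<open>quad_lines_not_distinct\<close>.\<close>

lemma card_quads_split:
  "card (quads r f) \<le> card (quads4 r) + 4 * card (quads31 r f) + 3 * card (quads22 r f) + 6 * card (quads211 r f)"
proof -
  let ?A = "quads4 r" and ?B = "quads31 r f" and ?C = "quads22 r f" and ?D = "quads211 r f"
  let ?perm = "\<lambda>\<pi> T. \<pi> -` T"
  have fin: "finite ?B" "finite ?C" "finite ?D"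
    using finite_quads[of r f] by (auto simp: quads31_def quads22_def quads211_def intro: finite_subset[rotated])
  have finA: "finite ?A"
    by (rule finite_subset[of _ "verts r \<times> verts r \<times> verts r \<times> verts r"]) (auto simp: quads4_def finite_verts)
  have sub: "quads r f \<subseteq> ?A \<union>
     (((\<lambda>(w, x, y, z). (w, x, y, z)) -` ?B \<union> (\<lambda>(w, x, y, z). (w, x, z, y)) -` ?B) \<union>
      ((\<lambda>(w, x, y, z). (w, y, z, x)) -` ?B \<union> (\<lambda>(w, x, y, z). (x, y, z, w)) -` ?B)) \<union>
     ((\<lambda>(w, x, y, z). (w, x, y, z)) -` ?C \<union> (\<lambda>(w, x, y, z). (w, y, x, z)) -` ?C \<union>
      (\<lambda>(w, x, y, z). (w, z, x, y)) -` ?C) \<union>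
     (((\<lambda>(w, x, y, z). (w, x, y, z)) -` ?D \<union> (\<lambda>(w, x, y, z). (w, y, x, z)) -` ?D \<union>
      (\<lambda>(w, x, y, z). (w, z, x, y)) -` ?D) \<union> ((\<lambda>(w, x, y, z). (x, y, w, z)) -` ?D \<union>
      (\<lambda>(w, x, y, z). (x, z, w, y)) -` ?D \<union> (\<lambda>(w, x, y, z). (y, z, w, x)) -` ?D))"
    (is "_ \<subseteq> ?A \<union> ((?B1 \<union> ?B2) \<union> (?B3 \<union> ?B4)) \<union> (?C1 \<union> ?C2 \<union> ?C3) \<union> ((?D1 \<union> ?D2 \<union> ?D3) \<union> (?D4 \<union> ?D5 \<union> ?D6))")
  proof
    fix t assume t: "t \<in> quads r f"
    obtain w x y z where t_eq: "t = (w, x, y, z)" by (cases t) auto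
    note p0 = t[unfolded t_eq]
    note p1 = quads_permute(1)[OF p0] and p2 = quads_permute(2)[OF p0] and p3 = quads_permute(3)[OF p0]
    note p4 = quads_permute(1)[OF p2] and p5 = quads_permute(2)[OF p3] and p6 = quads_permute(2)[OF p1]
      and p7 = quads_permute(2)[OF quads_permute(1)[OF p3]]
    note perms = p0 p1 p2 p4 p5 p6 p7 quads_permute(1)[OF p5] quads_permute(2)[OF quads_permute(3)[OF p4]]
    have nd: "\<not> distinct [fst w, fst x, fst y, fst z]" by (rule quad_lines_not_distinct[OF p0])
    have "{w, x, y, z} \<subseteq> verts r" using p0 by (auto simp: quads_def)
    note W = this
    show "t \<in> ?A \<union> ((?B1 \<union> ?B2) \<union> (?B3 \<union> ?B4)) \<union> (?C1 \<union> ?C2 \<union> ?C3) \<union> ((?D1 \<union> ?D2 \<union> ?D3) \<union> (?D4 \<union> ?D5 \<union> ?D6))"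
      unfolding t_eq quads4_def quads31_def quads22_def quads211_def
      apply (simp only: Un_iff vimage_eq prod.case mem_Collect_eq perms W simp_thms)
      using nd by (cases "fst w = fst x"; cases "fst w = fst y"; cases "fst w = fst z"; cases "fst x = fst y";
          cases "fst x = fst z"; cases "fst y = fst z") simp_all
  qed
  have un: "card (Z \<union> Y) \<le> a + b" if "card Z \<le> a" "card Y \<le> b" for Z Y :: "(('p set \<times> nat) \<times> ('p set \<times> nat) \<times> ('p set \<times> nat) \<times> ('p set \<times> nat)) set" and a b
    using card_Un_le[of Z Y] that by linarith
  have "card (quads r f) \<le> card (?A \<union> ((?B1 \<union> ?B2) \<union> (?B3 \<union> ?B4)) \<union> (?C1 \<union> ?C2 \<union> ?C3) \<union> ((?D1 \<union> ?D2 \<union> ?D3) \<union> (?D4 \<union> ?D5 \<union> ?D6)))"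
    by (rule card_mono[OF _ sub]) (intro finite_UnI finA finite_vimageI fin; auto simp: inj_def)
  also have "\<dots> \<le> card ?A + ((card ?B + card ?B) + (card ?B + card ?B)) + (card ?C + card ?C + card ?C)
      + ((card ?D + card ?D + card ?D) + (card ?D + card ?D + card ?D))"
    by (intro un order_refl card_vimage_inj_on_le[where D = UNIV, unfolded Int_UNIV_right] fin; auto simp: inj_def)
  finally show ?thesis by simp
qed

end

text \<open>First moment bound in integers: \<open>J\<close> parametrises through
  \<open>\<phi>\<close> every member that can occur, and each one occurs with probability at most
  \<open>1 / c\<close>.\<close>

lemma sum_card_family_bound:
  fixes c :: nat
  assumes "finite \<Omega>" "finite J" "\<And>f. f \<in> \<Omega> \<Longrightarrow> A f \<subseteq> \<phi> ` J"
    and "\<And>t. card {f \<in> \<Omega>. t \<in> A f} * c \<le> card \<Omega>"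
  shows "(\<Sum>f\<in>\<Omega>. card (A f)) * c \<le> card J * card \<Omega>"
proof -
  have "card (A f) \<le> card {t \<in> J. \<phi> t \<in> A f}" if "f \<in> \<Omega>" for f
  proof -
    have "A f \<subseteq> \<phi> ` {t \<in> J. \<phi> t \<in> A f}" using assms(3)[OF that] by auto
    then show ?thesis using assms(2) by (intro surj_card_le) auto
  qed
  then have "(\<Sum>f\<in>\<Omega>. card (A f)) \<le> (\<Sum>f\<in>\<Omega>. card {t \<in> J. \<phi> t \<in> A f})" by (rule sum_mono)
  also have "\<dots> = (\<Sum>t\<in>J. card {f \<in> \<Omega>. \<phi> t \<in> A f})" using assms by (intro sum_card_swap)
  finally have "(\<Sum>f\<in>\<Omega>. card (A f)) * c \<le> (\<Sum>t\<in>J. card {f \<in> \<Omega>. \<phi> t \<in> A f} * c)"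
    by (simp add: mult_le_mono1 flip: sum_distrib_right)
  also have "\<dots> \<le> (\<Sum>t\<in>J. card \<Omega>)" by (intro sum_mono assms)
  finally show ?thesis by simp
qed

context onan_free_space
begin

lemma card_labellings_system:
  assumes "A \<subseteq> U \<times> verts r" "\<And>a. a \<in> A \<Longrightarrow> \<sigma> a \<in> U \<times> verts r - A"
    and "\<And>a z. a \<in> A \<Longrightarrow> z \<in> labels s \<Longrightarrow> g a z \<in> labels s"
    and "\<And>f. f \<in> labellings r s \<Longrightarrow> Q f \<Longrightarrow> \<forall>a\<in>A. f a = g a (f (\<sigma> a))"
  shows "card {f \<in> labellings r s. Q f} * (2 * s) ^ card A \<le> card (labellings r s)"
proof -
  have "card {f \<in> labellings r s. Q f} \<le> card {f \<in> labellings r s. \<forall>a\<in>A. f a = g a (f (\<sigma> a))}"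
    using finite_labellings[of r s] assms(4) by (intro card_mono) auto
  then have "card {f \<in> labellings r s. Q f} * card (labels s) ^ card A
      \<le> card {f \<in> labellings r s. \<forall>a\<in>A. f a = g a (f (\<sigma> a))} * card (labels s) ^ card A"
    by (rule mult_le_mono1)
  also have "\<dots> = card (labellings r s)"
    unfolding card_labellings unfolding labellings_def
    by (rule card_PiE_system) (use assms finite_labels finite_U finite_verts in auto)
  finally show ?thesis by (simp only: card_labels)
qed

lemma quads_facts:
  assumes "(w, x, y, z) \<in> quads r f"
  shows "w \<in> verts r" "x \<in> verts r" "y \<in> verts r" "z \<in> verts r"
    "fst w \<in> L" "fst x \<in> L" "fst y \<in> L" "fst z \<in> L"
    "w \<noteq> x" "w \<noteq> y" "w \<noteq> z" "x \<noteq> y" "x \<noteq> z" "y \<noteq> z"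
    "joined f w x" "joined f w y" "joined f w z" "joined f x y" "joined f x z" "joined f y z"
  using assms unfolding quads_def by (simp_all add: verts_def mem_Times_iff)

text \<open>Where the line of \<open>z\<close> meets the common line of the other three vertices,
  the label of \<open>z\<close> forces theirs.\<close>

lemma card_labellings_quads31:
  "card {f \<in> labellings r s. t \<in> quads31 r f} * (2 * s) ^ 3 \<le> card (labellings r s)"
proof (cases "{f \<in> labellings r s. t \<in> quads31 r f} = {}")
  case False
  obtain w x y z where t: "t = (w, x, y, z)" by (cases t) auto
  obtain f0 where "t \<in> quads31 r f0" using False by blast
  then have f0: "(w, x, y, z) \<in> quads r f0" and
    ls: "fst w = fst x" "fst x = fst y" "fst y \<noteq> fst z"
    unfolding t quads31_def mem_Collect_eq prod.case by blast+
  note F = quads_facts[OF f0]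
  have ne: "fst w \<noteq> fst z" "fst x \<noteq> fst z" "fst y \<noteq> fst z" by (simp_all add: ls)
  obtain P where P: "P \<in> fst w" "P \<in> fst z" using joined_meet[OF F(17) ne(1)] by blast
  have P': "P \<in> fst x" "P \<in> fst y" using P ls by simp_all
  have PU: "P \<in> U" using P(1) line_subset[OF F(5)] by blast
  let ?A = "{(P, w), (P, x), (P, y)}"
  have A: "card ?A = 3" using F by simp
  have "card {f \<in> labellings r s. t \<in> quads31 r f} * (2 * s) ^ card ?A \<le> card (labellings r s)"
  proof (rule card_labellings_system[where \<sigma> = "\<lambda>_. (P, z)" and g = "\<lambda>_. flip"])
    fix f assume "t \<in> quads31 r f"
    then have "(w, x, y, z) \<in> quads r f" by (simp add: t quads31_def)
    note G = quads_facts[OF this]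
    show "\<forall>a\<in>?A. f a = flip (f (P, z))"
      using joined_at[OF G(17) ne(1) G(5,8) P] joined_at[OF G(19) ne(2) G(6,8) P'(1) P(2)]
        joined_at[OF G(20) ne(3) G(7,8) P'(2) P(2)] by simp
  qed (use F PU in \<open>auto intro: flip_labels\<close>)
  then show ?thesis by (simp only: A)
qed (simp only: card.empty)

text \<open>The four joins all happen at one point and form a cycle of length four, so only three of
  them are independent: the label of \<open>y\<close> forces the flipped label on \<open>w\<close>
  and \<open>x\<close> and its own label on \<open>z\<close>. This explains \<open>id\<close> next
  to \<open>flip\<close>.\<close>

lemma card_labellings_quads22:
  "card {f \<in> labellings r s. t \<in> quads22 r f} * (2 * s) ^ 3 \<le> card (labellings r s)"
proof (cases "{f \<in> labellings r s. t \<in> quads22 r f} = {}")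
  case False
  obtain w x y z where t: "t = (w, x, y, z)" by (cases t) auto
  obtain f0 where "t \<in> quads22 r f0" using False by blast
  then have f0: "(w, x, y, z) \<in> quads r f0" and
    ls: "fst w = fst x" "fst y = fst z" "fst x \<noteq> fst y"
    unfolding t quads22_def mem_Collect_eq prod.case by blast+
  note F = quads_facts[OF f0]
  have ne: "fst w \<noteq> fst y" "fst x \<noteq> fst y" "fst w \<noteq> fst z" using ls by simp_all
  obtain P where P: "P \<in> fst w" "P \<in> fst y" using joined_meet[OF F(16) ne(1)] by blast
  have P': "P \<in> fst x" "P \<in> fst z" using P ls by simp_all
  have PU: "P \<in> U" using P(1) line_subset[OF F(5)] by blast
  let ?A = "{(P, w), (P, x), (P, z)}"
  have A: "card ?A = 3" using F by simp
  have "card {f \<in> labellings r s. t \<in> quads22 r f} * (2 * s) ^ card ?A \<le> card (labellings r s)"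
  proof (rule card_labellings_system[where \<sigma> = "\<lambda>_. (P, y)" and g = "\<lambda>a. if a = (P, z) then id else flip"])
    fix f assume "t \<in> quads22 r f"
    then have "(w, x, y, z) \<in> quads r f" by (simp add: t quads22_def)
    note G = quads_facts[OF this]
    have e: "f (P, w) = flip (f (P, y))" "f (P, x) = flip (f (P, y))" "f (P, w) = flip (f (P, z))"
      using joined_at[OF G(16) ne(1) G(5,7) P] joined_at[OF G(18) ne(2) G(6,7) P'(1) P(2)]
        joined_at[OF G(17) ne(3) G(5,8) P(1) P'(2)] by simp_all
    then have "f (P, z) = f (P, y)" by simp
    then show "\<forall>a\<in>?A. f a = (if a = (P, z) then id else flip) (f (P, y))"
      using e F by simp
  qed (use F PU in \<open>auto intro: flip_labels\<close>)
  then show ?thesis by (simp only: A)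
qed (simp only: card.empty)

text \<open>By \<open>not_concurrent\<close> the three corners of the triangle are different, so
  labels at them are different coordinates. Both corners on the doubled side impose two equations
  and the opposite corner one.\<close>

lemma card_labellings_quads211:
  "card {f \<in> labellings r s. t \<in> quads211 r f} * (2 * s) ^ 5 \<le> card (labellings r s)"
proof (cases "{f \<in> labellings r s. t \<in> quads211 r f} = {}")
  case False
  obtain w x y z where t: "t = (w, x, y, z)" by (cases t) auto
  obtain f0 where "t \<in> quads211 r f0" using False by blast
  then have f0: "(w, x, y, z) \<in> quads r f0" and
    ls: "fst w = fst x" "fst x \<noteq> fst y" "fst x \<noteq> fst z" "fst y \<noteq> fst z"
    unfolding t quads211_def mem_Collect_eq prod.case by blast+
  note F = quads_facts[OF f0]
  have lw: "fst w \<noteq> fst y" "fst w \<noteq> fst z" using ls by simp_all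
  obtain P where P: "P \<in> fst x" "P \<in> fst y" using joined_meet[OF F(18) ls(2)] by blast
  obtain R where R: "R \<in> fst x" "R \<in> fst z" using joined_meet[OF F(19) ls(3)] by blast
  obtain T where T: "T \<in> fst y" "T \<in> fst z" using joined_meet[OF F(20) ls(4)] by blast
  have w: "P \<in> fst w" "R \<in> fst w" using P R ls by simp_all
  have "fst x \<inter> fst y \<inter> fst z = {}" by (rule not_concurrent[OF F(18,19,20) ls(2,3,4) F(6,7,8)])
  then have ne: "P \<noteq> R" "P \<noteq> T" "R \<noteq> T" using P R T by blast+
  have inU: "P \<in> U" "R \<in> U" "T \<in> U"
    using line_subset[OF F(6)] line_subset[OF F(7)] P R T by blast+
  let ?A = "{(P, w), (P, x), (R, w), (R, x), (T, y)}"
  \<comment> \<open>The right sides are the labels of \<open>y\<close> at \<open>P\<close> and of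
    \<open>z\<close> at \<open>R\<close> and \<open>T\<close>. Although \<open>y\<close> has a
    determined label at \<open>T\<close>, the one at \<open>P\<close> is still free.\<close>
  let ?\<sigma> = "\<lambda>a. if fst a = P then (P, y) else (fst a, z)"
  have A: "card ?A = 5" using F ne by simp
  have "card {f \<in> labellings r s. t \<in> quads211 r f} * (2 * s) ^ card ?A \<le> card (labellings r s)"
  proof (rule card_labellings_system[where \<sigma> = ?\<sigma> and g = "\<lambda>_. flip"])
    fix f assume "t \<in> quads211 r f"
    then have "(w, x, y, z) \<in> quads r f" by (simp add: t quads211_def)
    note G = quads_facts[OF this]
    have "f (P, w) = flip (f (P, y))" "f (P, x) = flip (f (P, y))" "f (R, w) = flip (f (R, z))"
      "f (R, x) = flip (f (R, z))" "f (T, y) = flip (f (T, z))"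
      by (rule joined_at[OF G(16) lw(1) G(5,7) w(1) P(2)] joined_at[OF G(18) ls(2) G(6,7) P]
        joined_at[OF G(17) lw(2) G(5,8) w(2) R(2)] joined_at[OF G(19) ls(3) G(6,8) R]
        joined_at[OF G(20) ls(4) G(7,8) T])+
    then show "\<forall>a\<in>?A. f a = flip (f (?\<sigma> a))" using ne by auto
  next
    show "?\<sigma> a \<in> U \<times> verts r - ?A" if "a \<in> ?A" for a
      using that F ne inU by auto
  qed (use F inU in \<open>auto intro: flip_labels\<close>)
  then show ?thesis by (simp only: A)
qed (simp only: card.empty)

lemma card_box4: "card (Z \<times> {..<r} \<times> {..<r} \<times> {..<r} \<times> {..<r::nat}) = card Z * r ^ 4"
  by (simp add: card_cartesian_product eval_nat_numeral)

lemma card_quads4: "card (quads4 r) \<le> card L * r ^ 4"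
proof -
  let ?\<phi> = "\<lambda>(l, a, b, c, d). ((l, a), (l, b), (l, c), (l, d))"
  have "quads4 r \<subseteq> ?\<phi> ` (L \<times> {..<r} \<times> {..<r} \<times> {..<r} \<times> {..<r})"
    by (force simp: quads4_def verts_def)
  then have "card (quads4 r) \<le> card (L \<times> {..<r} \<times> {..<r} \<times> {..<r} \<times> {..<r})"
    using finite_L by (intro surj_card_le) auto
  then show ?thesis by (simp only: card_box4)
qed

lemma sum_quads31:
  "(\<Sum>f\<in>labellings r s. card (quads31 r f)) * (2 * s) ^ 3 \<le> (2 * card L * q ^ 3 * r ^ 4) * card (labellings r s)"
proof -
  let ?J = "meeting_pairs \<times> {..<r} \<times> {..<r} \<times> {..<r} \<times> {..<r}"
  let ?\<phi> = "\<lambda>((l, l'), a, b, c, d). ((l, a), (l, b), (l, c), (l', d))"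
  have "(\<Sum>f\<in>labellings r s. card (quads31 r f)) * (2 * s) ^ 3 \<le> card ?J * card (labellings r s)"
  proof (rule sum_card_family_bound[where \<phi> = ?\<phi>])
    fix f
    show "quads31 r f \<subseteq> ?\<phi> ` ?J"
    proof
      fix t assume tq: "t \<in> quads31 r f"
      obtain w x y z where t: "t = (w, x, y, z)" by (cases t) auto
      from tq have qd: "(w, x, y, z) \<in> quads r f"
        and ls: "fst w = fst x" "fst x = fst y" "fst y \<noteq> fst z" unfolding t quads31_def mem_Collect_eq prod.case
        by blast+
      note F = quads_facts[OF qd]
      have "((fst y, fst z), snd w, snd x, snd y, snd z) \<in> ?J"
        using F(1-8) joined_meet[OF F(20) ls(3)] ls by (auto simp: meeting_pairs_def verts_def)
      moreover have "t = ?\<phi> ((fst y, fst z), snd w, snd x, snd y, snd z)" using ls by (simp add: t prod_eq_iff)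
      ultimately show "t \<in> ?\<phi> ` ?J" by (rule rev_image_eqI)
    qed
  qed (use finite_labellings finite_meeting_pairs card_labellings_quads31 in auto)
  also have "card ?J \<le> 2 * card L * q ^ 3 * r ^ 4"
    unfolding card_box4 by (intro mult_le_mono1 card_meeting_pairs)
  finally show ?thesis by (simp add: mult_le_mono1)
qed

lemma sum_quads22:
  "(\<Sum>f\<in>labellings r s. card (quads22 r f)) * (2 * s) ^ 3 \<le> (2 * card L * q ^ 3 * r ^ 4) * card (labellings r s)"
proof -
  let ?J = "meeting_pairs \<times> {..<r} \<times> {..<r} \<times> {..<r} \<times> {..<r}"
  let ?\<phi> = "\<lambda>((l, l'), a, b, c, d). ((l, a), (l, b), (l', c), (l', d))"
  have "(\<Sum>f\<in>labellings r s. card (quads22 r f)) * (2 * s) ^ 3 \<le> card ?J * card (labellings r s)"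
  proof (rule sum_card_family_bound[where \<phi> = ?\<phi>])
    fix f
    show "quads22 r f \<subseteq> ?\<phi> ` ?J"
    proof
      fix t assume tq: "t \<in> quads22 r f"
      obtain w x y z where t: "t = (w, x, y, z)" by (cases t) auto
      from tq have qd: "(w, x, y, z) \<in> quads r f"
        and ls: "fst w = fst x" "fst y = fst z" "fst x \<noteq> fst y" unfolding t quads22_def mem_Collect_eq prod.case
        by blast+
      note F = quads_facts[OF qd]
      have "((fst x, fst y), snd w, snd x, snd y, snd z) \<in> ?J"
        using F(1-8) joined_meet[OF F(18) ls(3)] ls by (auto simp: meeting_pairs_def verts_def)
      moreover have "t = ?\<phi> ((fst x, fst y), snd w, snd x, snd y, snd z)" using ls by (simp add: t prod_eq_iff)
      ultimately show "t \<in> ?\<phi> ` ?J" by (rule rev_image_eqI)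
    qed
  qed (use finite_labellings finite_meeting_pairs card_labellings_quads22 in auto)
  also have "card ?J \<le> 2 * card L * q ^ 3 * r ^ 4"
    unfolding card_box4 by (intro mult_le_mono1 card_meeting_pairs)
  finally show ?thesis by (simp add: mult_le_mono1)
qed

lemma finite_triangles: "finite triangles"
  by (rule finite_subset[of _ "L \<times> L \<times> L"]) (auto simp: triangles_def meeting_pairs_def finite_L)

lemma sum_quads211:
  "(\<Sum>f\<in>labellings r s. card (quads211 r f)) * (2 * s) ^ 5 \<le> (8 * card L * q ^ 5 * r ^ 4) * card (labellings r s)"
proof -
  let ?J = "triangles \<times> {..<r} \<times> {..<r} \<times> {..<r} \<times> {..<r}"
  let ?\<phi> = "\<lambda>((l, l', l''), a, b, c, d). ((l, a), (l, b), (l', c), (l'', d))"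
  have "(\<Sum>f\<in>labellings r s. card (quads211 r f)) * (2 * s) ^ 5 \<le> card ?J * card (labellings r s)"
  proof (rule sum_card_family_bound[where \<phi> = ?\<phi>])
    fix f
    show "quads211 r f \<subseteq> ?\<phi> ` ?J"
    proof
      fix t assume tq: "t \<in> quads211 r f"
      obtain w x y z where t: "t = (w, x, y, z)" by (cases t) auto
      from tq have qd: "(w, x, y, z) \<in> quads r f"
        and ls: "fst w = fst x" "fst x \<noteq> fst y" "fst x \<noteq> fst z" "fst y \<noteq> fst z" unfolding t quads211_def mem_Collect_eq prod.case
        by blast+
      note F = quads_facts[OF qd]
      have "(fst x, fst y, fst z) \<in> triangles"
        using joined_meet[OF F(18) ls(2)] joined_meet[OF F(19) ls(3)] joined_meet[OF F(20) ls(4)]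
          not_concurrent[OF F(18,19,20) ls(2,3,4) F(6,7,8)] ls(2-4) F(6-8)
        by (simp add: triangles_def meeting_pairs_def)
      moreover have "snd w < r" "snd x < r" "snd y < r" "snd z < r"
        using F(1-4) by (simp_all add: verts_def mem_Times_iff)
      ultimately have "((fst x, fst y, fst z), snd w, snd x, snd y, snd z) \<in> ?J" by simp
      moreover have "t = ?\<phi> ((fst x, fst y, fst z), snd w, snd x, snd y, snd z)" using ls by (simp add: t prod_eq_iff)
      ultimately show "t \<in> ?\<phi> ` ?J" by (rule rev_image_eqI)
    qed
  qed (use finite_labellings finite_triangles card_labellings_quads211 in auto)
  also have "card ?J \<le> 8 * card L * q ^ 5 * r ^ 4"
    unfolding card_box4 by (intro mult_le_mono1 card_triangles)
  finally show ?thesis by (simp add: mult_le_mono1)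
qed

text \<open>14 = 4 * 2 + 3 * 2 and 48 = 6 * 8 combine the multiplicities from
  \<open>card_quads_split\<close> with the constants in the counts of meeting pairs and triangles.
  The fifth power, coming from triangles, is the dominant term in the application.\<close>

lemma sum_quads:
  assumes "s > 0"
  shows "real (\<Sum>f\<in>labellings r s. card (quads r f))
    \<le> (1 + 14 * (q / (2 * s)) ^ 3 + 48 * (q / (2 * s)) ^ 5) * (card L * r ^ 4) * card (labellings r s)"
proof -
  let ?N = "real (card (labellings r s))" and ?M = "real (card L) * real r ^ 4"
  have S4: "real (\<Sum>f\<in>labellings r s. card (quads4 r)) \<le> ?M * ?N"
    using card_quads4[of r] by (simp add: mult_left_mono mult_ac flip: of_nat_mult of_nat_power)
  have S31: "real (\<Sum>f\<in>labellings r s. card (quads31 r f)) \<le> 2 * (q / (2 * s)) ^ 3 * ?M * ?N"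
    using of_nat_mono[OF sum_quads31[of r s], where 'a = real] assms by (simp add: field_simps)
  have S22: "real (\<Sum>f\<in>labellings r s. card (quads22 r f)) \<le> 2 * (q / (2 * s)) ^ 3 * ?M * ?N"
    using of_nat_mono[OF sum_quads22[of r s], where 'a = real] assms by (simp add: field_simps)
  have S211: "real (\<Sum>f\<in>labellings r s. card (quads211 r f)) \<le> 8 * (q / (2 * s)) ^ 5 * ?M * ?N"
    using of_nat_mono[OF sum_quads211[of r s], where 'a = real] assms by (simp add: field_simps)
  have "(\<Sum>f\<in>labellings r s. card (quads r f)) \<le> (\<Sum>f\<in>labellings r s. card (quads4 r) + 4 * card (quads31 r f)
      + 3 * card (quads22 r f) + 6 * card (quads211 r f))"
    by (intro sum_mono card_quads_split)
  also have "\<dots> = (\<Sum>f\<in>labellings r s. card (quads4 r)) + 4 * (\<Sum>f\<in>labellings r s. card (quads31 r f))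
      + 3 * (\<Sum>f\<in>labellings r s. card (quads22 r f)) + 6 * (\<Sum>f\<in>labellings r s. card (quads211 r f))"
    by (simp only: sum.distrib sum_distrib_left)
  finally have "real (\<Sum>f\<in>labellings r s. card (quads r f)) \<le> real (\<Sum>f\<in>labellings r s. card (quads4 r))
      + 4 * real (\<Sum>f\<in>labellings r s. card (quads31 r f)) + 3 * real (\<Sum>f\<in>labellings r s. card (quads22 r f))
      + 6 * real (\<Sum>f\<in>labellings r s. card (quads211 r f))"
    by linarith
  also have "\<dots> \<le> ?M * ?N + 4 * (2 * (q / (2 * s)) ^ 3 * ?M * ?N) + 3 * (2 * (q / (2 * s)) ^ 3 * ?M * ?N)
      + 6 * (8 * (q / (2 * s)) ^ 5 * ?M * ?N)"
    by (intro add_mono mult_left_mono S4 S31 S22 S211) auto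
  also have "\<dots> = (1 + 14 * (q / (2 * s)) ^ 3 + 48 * (q / (2 * s)) ^ 5) * ?M * ?N"
    by (simp add: algebra_simps)
  finally show ?thesis by simp
qed

end

text \<open>These are homomorphisms from the complete graph on four vertices rather than cliques:
  entries may repeat, since \<open>J\<close> will be reflexive and the random map into
  \<open>W\<close> may identify vertices.\<close>

definition joined_quads where
  "joined_quads W J = {(w, x, y, z). {w, x, y, z} \<subseteq> W \<and> J w x \<and> J w y \<and> J w z \<and> J x y \<and> J x z \<and> J y z}"

context onan_free_space
begin

definition scattered where
  "scattered f S \<longleftrightarrow> (\<forall>x\<in>S. \<forall>y\<in>S. x \<noteq> y \<longrightarrow> \<not> joined f x y)"

text \<open>The members of \<open>S\<close> have \<open>n * (q + 1)\<close> incidences with at most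
  \<open>card U\<close> points. The coordinates of these incidences are keyed by their points, and a
  conflict is a pair of labels that are flips of each other.\<close>

lemma card_scattered_le:
  assumes "s > 0" "S \<subseteq> verts r" "card S = n" "card U + 2 * t \<le> n * (q + 1)"
  shows "real (card {f \<in> labellings r s. scattered f S})
    \<le> (1 - 1 / (2 * real s)) ^ t * card (labellings r s)"
proof -
  define Z where "Z = (SIGMA x:S. fst x)"
  let ?Y = "{(P, x). x \<in> S \<and> P \<in> fst x}"
  let ?I = "U \<times> verts r"
  have finS: "finite S" using assms(2) finite_verts by (rule finite_subset)
  have SL: "fst x \<in> L" if "x \<in> S" for x
    using that assms(2) by (auto simp: verts_def)
  have "card Z = (\<Sum>x\<in>S. card (fst x))"
    unfolding Z_def using finS SL finite_line by (intro card_SigmaI) auto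
  also have "\<dots> = n * (q + 1)" using SL assms(3) by (simp add: line_card)
  finally have cX: "card Z = n * (q + 1)" .
  have "?Y = (\<lambda>(x, P). (P, x)) ` Z" by (auto simp: Z_def image_iff)
  moreover have "inj_on (\<lambda>(x, P). (P, x)) Z" by (auto simp: inj_on_def)
  ultimately have cY: "card ?Y = n * (q + 1)" using cX by (simp add: card_image)
  have "{f \<in> labellings r s. scattered f S}
      \<subseteq> {f \<in> PiE ?I (\<lambda>_. labels s). \<forall>a\<in>?Y. \<forall>b\<in>?Y. fst a = fst b \<longrightarrow> f a \<noteq> flip (f b)}"
  proof clarify
    fix f assume f: "f \<in> labellings r s" and sc: "scattered f S"
    show "f \<in> PiE ?I (\<lambda>_. labels s) \<and> (\<forall>a\<in>?Y. \<forall>b\<in>?Y. fst a = fst b \<longrightarrow> f a \<noteq> flip (f b))"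
    proof (intro conjI ballI impI)
      show "f \<in> PiE ?I (\<lambda>_. labels s)" using f by (simp add: labellings_def)
      fix a b assume "a \<in> ?Y" "b \<in> ?Y" and e: "fst a = fst b"
      then obtain x y P where a: "a = (P, x)" "b = (P, y)" "x \<in> S" "y \<in> S" "P \<in> fst x" "P \<in> fst y"
        by (cases a; cases b) simp
      show "f a \<noteq> flip (f b)"
      \<comment> \<open>For equal vertices the two labels are the same, and no label is its own
        flip.\<close>
      proof (cases "x = y")
        case False
        then have "\<not> joined f x y" using sc a by (auto simp: scattered_def)
        then show ?thesis using a by (auto simp: joined_def)
      qed (use a in simp)
    qed
  qed
  then have "real (card {f \<in> labellings r s. scattered f S})
    \<le> real (card {f \<in> PiE ?I (\<lambda>_. labels s). \<forall>a\<in>?Y. \<forall>b\<in>?Y. fst a = fst b \<longrightarrow> f a \<noteq> flip (f b)})"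
    using finite_labellings[of r s, unfolded labellings_def]
    by (intro of_nat_mono card_mono) (rule finite_Collect_conjI, rule disjI1, simp_all)
  also have "\<dots> \<le> (1 - 1 / real (card (labels s))) ^ t * real (card (labels s)) ^ card ?I"
  proof (rule card_PiE_conflict_free)
    show "labels s \<noteq> {}" using assms(1) by (auto simp: labels_def)
    show "?Y \<subseteq> ?I" using assms(2) SL line_subset by blast
    show "fst ` ?Y \<subseteq> U" using SL line_subset by (clarsimp, blast)
    show "card U + 2 * t \<le> card ?Y" using assms(4) cY by simp
  qed (use finite_U finite_verts finite_labels flip_labels in auto)
  finally show ?thesis by (simp add: card_labellings card_labels)
qed

text \<open>By the union bound more than half of the labellings leave no scattered
  \<open>n\<close>-set. If each of those had more than twice the bound on the mean number of
  quadruples, the total over all labellings would be too large.\<close>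

lemma good_labelling_exists:
  assumes "s > 0" "card U + 2 * t \<le> n * (q + 1)"
    and small: "(real (card L) * real r) ^ n * (1 - 1 / (2 * real s)) ^ t < 1 / 2"
  shows "\<exists>f. (\<forall>S \<subseteq> verts r. card S = n \<longrightarrow> \<not> scattered f S) \<and>
    real (card (quads r f))
      \<le> 2 * (1 + 14 * (q / (2 * s)) ^ 3 + 48 * (q / (2 * s)) ^ 5) * (card L * real r ^ 4)"
proof (rule ccontr)
  assume neg: "\<not> ?thesis"
  let ?\<Omega> = "labellings r s"
  let ?E = "(1 + 14 * (q / (2 * s)) ^ 3 + 48 * (q / (2 * s)) ^ 5) * (real (card L) * real r ^ 4)"
  let ?F = "{S. S \<subseteq> verts r \<and> card S = n}"
  define bad where "bad = (\<Union>S\<in>?F. {f \<in> ?\<Omega>. scattered f S})"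
  define good where "good = ?\<Omega> - bad"
  have \<Omega>: "card ?\<Omega> > 0" unfolding card_labellings card_labels using assms(1) by simp
  have finF: "finite ?F" using finite_verts[of r] by simp
  have cF: "real (card ?F) \<le> (real (card L) * real r) ^ n"
  proof -
    have "card ?F = card (verts r) choose n" by (rule n_subsets[OF finite_verts])
    also have "\<dots> \<le> card (verts r) ^ n"
      by (cases "n \<le> card (verts r)") (simp_all add: binomial_le_pow binomial_eq_0)
    finally show ?thesis by (simp add: card_verts flip: of_nat_mult of_nat_power)
  qed
  have p0: "0 \<le> 1 - 1 / (2 * real s)" using assms(1) by (simp add: field_simps)
  have "real (card bad) \<le> (\<Sum>S\<in>?F. real (card {f \<in> ?\<Omega>. scattered f S}))"
    unfolding bad_def of_nat_sum[symmetric] by (intro of_nat_mono card_UN_le finF)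
  also have "\<dots> \<le> (\<Sum>S\<in>?F. (1 - 1 / (2 * real s)) ^ t * card ?\<Omega>)"
    using assms by (intro sum_mono card_scattered_le) auto
  also have "\<dots> = real (card ?F) * (1 - 1 / (2 * real s)) ^ t * card ?\<Omega>" by simp
  also have "\<dots> \<le> (real (card L) * real r) ^ n * (1 - 1 / (2 * real s)) ^ t * card ?\<Omega>"
    using cF p0 by (intro mult_right_mono) auto
  also have "\<dots> < 1 / 2 * card ?\<Omega>" using small \<Omega> by (intro mult_strict_right_mono) auto
  finally have cb: "real (card bad) < card ?\<Omega> / 2" by simp
  have fin: "finite ?\<Omega>" by (rule finite_labellings)
  have "bad \<subseteq> ?\<Omega>" by (auto simp: bad_def)
  then have "card good = card ?\<Omega> - card bad" "card bad \<le> card ?\<Omega>"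
    unfolding good_def using fin by (auto intro: card_Diff_subset finite_subset card_mono)
  with cb have cg: "real (card good) > card ?\<Omega> / 2" by (simp add: of_nat_diff)
  have fg: "finite good" using fin by (simp add: good_def)
  have ne: "good \<noteq> {}" using cg by auto
  have E0: "?E \<ge> 0" by simp
  have big: "2 * ?E < real (card (quads r f))" if "f \<in> good" for f
  proof -
    have "\<forall>S \<subseteq> verts r. card S = n \<longrightarrow> \<not> scattered f S"
      using that by (auto simp: good_def bad_def)
    then have "\<not> real (card (quads r f))
        \<le> 2 * (1 + 14 * (q / (2 * s)) ^ 3 + 48 * (q / (2 * s)) ^ 5) * (card L * real r ^ 4)"
      using neg by (intro notI) (erule notE, intro exI conjI, assumption, simp)
    then show ?thesis by (simp only: not_le mult.assoc of_nat_mult of_nat_power)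
  qed
  have "card ?\<Omega> * ?E \<le> card good * (2 * ?E)"
    using cg mult_right_mono[of "card ?\<Omega> / 2" "card good" "2 * ?E"] E0 by simp
  also have "\<dots> = (\<Sum>f\<in>good. 2 * ?E)" by simp
  also have "\<dots> < (\<Sum>f\<in>good. real (card (quads r f)))"
    using fg ne big by (rule sum_strict_mono)
  also have "\<dots> \<le> (\<Sum>f\<in>?\<Omega>. real (card (quads r f)))"
    using fin by (intro sum_mono2) (auto simp: good_def)
  also have "\<dots> \<le> ?E * card ?\<Omega>"
    using sum_quads[OF assms(1), of r] by simp
  finally show False by (simp add: mult.commute)
qed

text \<open>Any of the six pairs of positions may coincide, which leaves three vertices to
  choose.\<close>

lemma card_joined_quads:
  "card (joined_quads (verts r) (joined f)) \<le> card (quads r f) + 6 * card (verts r) ^ 3"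
proof -
  let ?V = "verts r"
  let ?T = "?V \<times> ?V \<times> ?V"
  let ?D = "(\<lambda>(a, b, c). (a, a, b, c)) ` ?T \<union> (\<lambda>(a, b, c). (a, b, a, c)) ` ?T \<union> (\<lambda>(a, b, c). (a, b, c, a)) ` ?T
    \<union> ((\<lambda>(a, b, c). (a, b, b, c)) ` ?T \<union> (\<lambda>(a, b, c). (a, b, c, b)) ` ?T \<union> (\<lambda>(a, b, c). (a, b, c, c)) ` ?T)"
  have fin: "finite ?T" by (simp add: finite_verts)
  have cT: "card ?T = card ?V ^ 3" by (simp add: card_cartesian_product power3_eq_cube)
  have im: "card (h ` ?T) \<le> card ?V ^ 3" for h :: "_ \<Rightarrow> ('p set \<times> nat) \<times> ('p set \<times> nat) \<times> ('p set \<times> nat) \<times> ('p set \<times> nat)"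
    using card_image_le[OF fin, of h] by (simp add: cT)
  have un: "card (Z \<union> Y) \<le> a + b" if "card Z \<le> a" "card Y \<le> b" for Z Y :: "(('p set \<times> nat) \<times> ('p set \<times> nat) \<times> ('p set \<times> nat) \<times> ('p set \<times> nat)) set" and a b
    using card_Un_le[of Z Y] that by linarith
  have "joined_quads ?V (joined f) \<subseteq> quads r f \<union> ?D"
  proof
    fix t assume t: "t \<in> joined_quads ?V (joined f)"
    obtain w x y z where e: "t = (w, x, y, z)" by (cases t) auto
    have V: "w \<in> ?V" "x \<in> ?V" "y \<in> ?V" "z \<in> ?V" using t by (simp_all add: e joined_quads_def)
    show "t \<in> quads r f \<union> ?D"
    proof (cases "distinct [w, x, y, z]")
      case True
      then show ?thesis using t by (simp add: e joined_quads_def quads_def)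
    next
      case False
      then consider "w = x" | "w = y" | "w = z" | "x = y" | "x = z" | "y = z" by auto
      then have "t \<in> ?D"
      proof cases
        case 1
        then show ?thesis
          by - (rule UnI1, rule UnI1, rule UnI1, rule image_eqI[of _ _ "(w, y, z)"], use V in \<open>auto simp: e\<close>)
      next
        case 2
        then show ?thesis
          by - (rule UnI1, rule UnI1, rule UnI2, rule image_eqI[of _ _ "(w, x, z)"], use V in \<open>auto simp: e\<close>)
      next
        case 3
        then show ?thesis
          by - (rule UnI1, rule UnI2, rule image_eqI[of _ _ "(w, x, y)"], use V in \<open>auto simp: e\<close>)
      next
        case 4
        then show ?thesis
          by - (rule UnI2, rule UnI1, rule UnI1, rule image_eqI[of _ _ "(w, x, z)"], use V in \<open>auto simp: e\<close>)
      next
        case 5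
        then show ?thesis
          by - (rule UnI2, rule UnI1, rule UnI2, rule image_eqI[of _ _ "(w, x, y)"], use V in \<open>auto simp: e\<close>)
      next
        case 6
        then show ?thesis
          by - (rule UnI2, rule UnI2, rule image_eqI[of _ _ "(w, x, y)"], use V in \<open>auto simp: e\<close>)
      qed
      then show ?thesis by blast
    qed
  qed
  then have "card (joined_quads ?V (joined f)) \<le> card (quads r f \<union> ?D)"
    by (rule card_mono[rotated]) (use finite_quads fin in auto)
  also have "\<dots> \<le> card (quads r f) + (card ?V ^ 3 + card ?V ^ 3 + card ?V ^ 3 + (card ?V ^ 3 + card ?V ^ 3 + card ?V ^ 3))"
    by (intro un im order_refl)
  finally show ?thesis by simp
qed

end

section \<open>Graphs with few cliques of size four\<close>

lemma (in hermitian_plane) onan_free_space_lines: "onan_free_space pts lines q"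
proof
  show "finite pts" by (rule finite_pts)
  show "finite lines" by (rule finite_lines)
  show "q > 0" using q_gt_1 by simp
  show "l \<subseteq> pts" if "l \<in> lines" for l
    using that line_subset_pts by (auto simp: lines_def)
  show "card l = q + 1" if "l \<in> lines" for l
    using that card_line by (auto simp: lines_def)
  show "card {l \<in> lines. P \<in> l} \<le> q\<^sup>2" for P by (rule card_lines_through)
  show "l = l'" if h: "l \<in> lines" "l' \<in> lines" "P \<in> l" "P \<in> l'" "Q \<in> l" "Q \<in> l'" "P \<noteq> Q" for l l' P Q
  proof -
    obtain m b m' b' where e: "l = line m b" "l' = line m' b'" using h(1,2) by (auto simp: lines_def)
    then show ?thesis using lines_meet_once[of P m b m' b' Q] h by simp
  qed
qed (fact no_onan)

text \<open>Characteristic two: a power \<open>q\<close> of two is zero in the field, and taking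
  \<open>q\<close>-th powers is additive.\<close>

lemma onan_free_space_exists:
  assumes "k > 0" and "q = 2 ^ k"
  shows "\<exists>(U :: (bit alg_closure \<times> bit alg_closure) set) L. onan_free_space U L q \<and>
    card U \<le> q ^ 3 \<and> q ^ 4 \<le> 2 * card L \<and> card L \<le> q ^ 4"
proof -
  have c2: "CHAR(bit alg_closure) = 2"
  proof -
    have "CHAR(bit) = 2"
    proof (rule CHAR_eq_posI)
      fix x :: nat assume "x > 0" "x < 2"
      then have "x = 1" by simp
      then show "of_nat x \<noteq> (0 :: bit)" by simp
    qed auto
    then show ?thesis by simp
  qed
  interpret hermitian_plane q "\<lambda>x :: bit alg_closure. x ^ q"
  proof
    show "q > 1" using assms one_less_power[of "2 :: nat" k] by simp
    show "of_nat q = (0 :: bit alg_closure)"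
      by (subst of_nat_eq_0_iff_char_dvd) (use assms c2 in simp)
    show "(x + y) ^ q = x ^ q + y ^ q" for x y :: "bit alg_closure"
      by (rule freshmans_dream') (use assms c2 in auto)
  qed simp
  show ?thesis
    using onan_free_space_lines card_pts_le card_lines_ge card_lines_le by blast
qed

lemma sparse_reflexive_graph_exists:
  assumes k: "12 \<le> k" and q: "q = 2 ^ k" and n: "2 * q\<^sup>2 \<le> n"
  shows "\<exists>(W :: ((bit alg_closure \<times> bit alg_closure) set \<times> nat) set) J.
    finite W \<and> W \<noteq> {} \<and> (\<forall>x. J x x) \<and> (\<forall>x y. J x y \<longrightarrow> J y x) \<and>
    (\<forall>S \<subseteq> W. card S = n \<longrightarrow> (\<exists>x\<in>S. \<exists>y\<in>S. x \<noteq> y \<and> J x y)) \<and>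
    real (card (joined_quads W J)) \<le> (1008 * 256 ^ 5 + 12) * real k ^ 5 / real q ^ 12 * real (card W) ^ 4"
proof -
  have "k > 0" using k by simp
  from onan_free_space_exists[OF this q]
  obtain U :: "(bit alg_closure \<times> bit alg_closure) set" and L where sp: "onan_free_space U L q"
    and cU: "card U \<le> q ^ 3" and L1: "q ^ 4 \<le> 2 * card L" and L2: "card L \<le> q ^ 4"
    by blast
  interpret onan_free_space U L q by (rule sp)
  define r where "r = q ^ 8"
  \<comment> \<open>The factor 256 makes \<open>t / (2 * s)\<close> at least
    \<open>16 * n * k\<close>, which beats the exponent \<open>12 * n * k\<close> from the number of
    candidate \<open>n\<close>-sets.\<close>
  define s where "s = q div (256 * k)"
  \<comment> \<open>At least half of the \<open>n * q\<close> incidences exceed the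
    \<open>q ^ 3\<close> points that serve as keys; grouped in pairs, that half yields
    \<open>n * q / 4\<close> trials.\<close>
  define t where "t = n * q div 4"
  \<comment> \<open>From \<open>k = 12\<close> on the power of two stays ahead; this keeps
    \<open>s\<close> positive.\<close>
  have kq: "256 * k \<le> q"
    using k unfolding q by (induction k rule: dec_induct) auto
  then have s1: "s \<ge> 1" unfolding s_def using k by (simp add: div_greater_zero_iff Suc_le_eq)
  have s_le: "s * (256 * k) \<le> q" unfolding s_def by (rule div_times_less_eq_dividend)
  have "q < (s + 1) * (256 * k)"
    unfolding s_def using k dividend_less_times_div[of "256 * k" q] by (simp add: algebra_simps)
  also have "\<dots> \<le> (2 * s) * (256 * k)" using s1 by (intro mult_le_mono1) simp
  finally have q_le: "q \<le> (2 * s) * (256 * k)" by simp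
  have q8: "q \<ge> 8" using kq k by simp
  have n1: "n \<ge> 1" proof -
    have "0 < q\<^sup>2" using q8 by simp
    with n show ?thesis by linarith
  qed
  have nq: "2 * q ^ 3 \<le> n * q"
    using mult_le_mono1[OF n, of q] by (simp add: power2_eq_square power3_eq_cube)
  have card_t: "card U + 2 * t \<le> n * (q + 1)"
  proof -
    have "2 * t \<le> n * q div 2" unfolding t_def by linarith
    moreover have "q ^ 3 \<le> n * q div 2" using nq by simp
    ultimately have "card U + 2 * t \<le> n * q" using cU by linarith
    then show ?thesis by simp
  qed
  have small: "(real (card L) * real r) ^ n * (1 - 1 / (2 * real s)) ^ t < 1 / 2"
  proof -
    have "real (card L) * real r \<le> real (q ^ 4) * real (q ^ 8)"
      unfolding r_def using L2 by (intro mult_right_mono of_nat_mono) auto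
    also have "\<dots> = 2 ^ (12 * k)" unfolding q by (simp flip: power_mult power_add)
    also have "\<dots> \<le> exp 1 ^ (12 * k)" using exp_ge_add_one_self[of 1] by (intro power_mono) auto
    also have "\<dots> = exp (12 * real k)" by (simp flip: exp_of_nat_mult)
    finally have "(real (card L) * real r) ^ n \<le> exp (12 * real k) ^ n" by (intro power_mono) auto
    then have A: "(real (card L) * real r) ^ n \<le> exp (real n * (12 * real k))"
      by (simp add: exp_of_nat_mult)
    have "(1 - 1 / (2 * real s)) ^ t \<le> exp (- (1 / (2 * real s))) ^ t"
      using exp_ge_add_one_self[of "- (1 / (2 * real s))"] s1 by (intro power_mono) auto
    also have "\<dots> = exp (- (real t / (2 * real s)))" by (simp flip: exp_of_nat_mult)
    also have "\<dots> \<le> exp (- (16 * real n * real k))"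
    proof -
      have nq8: "8 \<le> n * q" using mult_le_mono[OF n1 q8] by simp
      have "n * q < 4 * t + 4" unfolding t_def using dividend_less_times_div[of 4 "n * q"] by simp
      then have "n * q \<le> 8 * t" using nq8 by linarith
      then have t8: "real n * real q \<le> 8 * real t" using of_nat_mono[of "n * q" "8 * t", where 'a = real] by simp
      have "real s * (256 * real k) \<le> real q"
        using of_nat_mono[OF s_le, where 'a = real] by simp
      then have "real n * (real s * (256 * real k)) \<le> real n * real q"
        by (rule mult_left_mono) simp
      with t8 have "16 * real n * real k * (2 * real s) \<le> real t" by (simp add: mult_ac)
      then have "16 * real n * real k \<le> real t / (2 * real s)"
        using s1 by (simp add: pos_le_divide_eq)
      then show ?thesis by simp
    qed
    finally have B: "(1 - 1 / (2 * real s)) ^ t \<le> exp (- (16 * real n * real k))" .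
    have "(real (card L) * real r) ^ n * (1 - 1 / (2 * real s)) ^ t
      \<le> exp (real n * (12 * real k)) * exp (- (16 * real n * real k))"
      using A B s1 by (intro mult_mono) auto
    also have "\<dots> = exp (- (4 * real n * real k))" by (simp flip: exp_add)
    also have "\<dots> = 1 / exp (4 * real n * real k)" by (simp add: exp_minus field_simps)
    also have "\<dots> < 1 / 2"
    proof -
      have "1 \<le> real n * real k" using n1 k mult_mono[of 1 "real n" 1 "real k"] by simp
      then have "2 < 1 + 4 * real n * real k" by simp
      also have "\<dots> \<le> exp (4 * real n * real k)" by (rule exp_ge_add_one_self)
      finally show ?thesis by (intro divide_strict_left_mono) auto
    qed
    finally show ?thesis .
  qed
  obtain f where f1: "\<And>S. S \<subseteq> verts r \<Longrightarrow> card S = n \<Longrightarrow> \<not> scattered f S"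
    and f2: "real (card (quads r f))
      \<le> 2 * (1 + 14 * (q / (2 * s)) ^ 3 + 48 * (q / (2 * s)) ^ 5) * (card L * real r ^ 4)"
    using good_labelling_exists[OF _ card_t small] s1 by auto
  define M where "M = real (card L)"
  define R where "R = real r"
  define Q where "Q = real q ^ 12"
  have Q0: "Q > 0" using q8 by (simp add: Q_def)
  have Mq: "real q ^ 4 \<le> 2 * M" using of_nat_mono[OF L1, where 'a = real] by (simp add: M_def)
  have M0: "M > 0" proof -
    have "0 < real q ^ 4" using q8 by simp
    with Mq show ?thesis by linarith
  qed
  have R0: "R > 0" using q8 by (simp add: R_def r_def)
  have W: "real (card (verts r)) = M * R" by (simp add: card_verts M_def R_def)
  have a: "q / (2 * s) \<le> 256 * real k"
  proof -
    have "real q \<le> (2 * real s) * (256 * real k)"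
      using of_nat_mono[OF q_le, where 'a = real] by simp
    then show ?thesis using s1 by (simp add: divide_le_eq mult_ac)
  qed
  have k1: "1 \<le> 256 * real k" using k by simp
  \<comment> \<open>All three terms are raised to the fifth power of \<open>256 * k\<close>. The
    constants are 63 = 1 + 14 + 48 and, in the end, 1008 = 2 * 63 * 8, where the 8 comes from
    \<open>q ^ 4 \<le> 2 * card L\<close> cubed.\<close>
  have "1 + 14 * (q / (2 * s)) ^ 3 + 48 * (q / (2 * s)) ^ 5 \<le> (256 * real k) ^ 5 + 14 * (256 * real k) ^ 5 + 48 * (256 * real k) ^ 5"
  proof (intro add_mono mult_left_mono)
    show "1 \<le> (256 * real k) ^ 5" using k1 by (rule one_le_power)
    have "(q / (2 * s)) ^ 3 \<le> (256 * real k) ^ 3" using a by (intro power_mono) auto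
    also have "\<dots> \<le> (256 * real k) ^ 5" using k1 by (intro power_increasing) auto
    finally show "(q / (2 * s)) ^ 3 \<le> (256 * real k) ^ 5" .
    show "(q / (2 * s)) ^ 5 \<le> (256 * real k) ^ 5" using a by (intro power_mono) auto
  qed auto
  also have "\<dots> = 63 * 256 ^ 5 * real k ^ 5" by (simp add: power_mult_distrib)
  finally have coef: "1 + 14 * (q / (2 * s)) ^ 3 + 48 * (q / (2 * s)) ^ 5 \<le> 63 * 256 ^ 5 * real k ^ 5" .
  have QM: "Q \<le> 8 * M ^ 3"
  proof -
    have "Q = (real q ^ 4) ^ 3" by (simp add: Q_def flip: power_mult)
    also have "\<dots> \<le> (2 * M) ^ 3" using Mq by (intro power_mono) auto
    finally show ?thesis by (simp add: power_mult_distrib)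
  qed
  have QW: "Q \<le> 2 * (M * R)"
  proof -
    have "Q = real q ^ 4 * real q ^ 8" by (simp add: Q_def flip: power_add)
    also have "\<dots> \<le> (2 * M) * real q ^ 8" using Mq by (intro mult_right_mono) auto
    finally show ?thesis by (simp add: R_def r_def)
  qed
  have "M * R ^ 4 * Q \<le> M * R ^ 4 * (8 * M ^ 3)" using QM M0 R0 by (intro mult_left_mono) auto
  then have MR: "M * R ^ 4 \<le> 8 * (M * R) ^ 4 / Q"
    using Q0 by (simp add: pos_le_divide_eq power_mult_distrib) (simp add: eval_nat_numeral mult_ac)
  have "(M * R) ^ 3 * Q \<le> (M * R) ^ 3 * (2 * (M * R))" using QW M0 R0 by (intro mult_left_mono) auto
  then have MR3: "(M * R) ^ 3 \<le> 2 * (M * R) ^ 4 / Q"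
    using Q0 by (simp add: pos_le_divide_eq) (simp add: eval_nat_numeral mult_ac)
  have "real (card (joined_quads (verts r) (joined f))) \<le> real (card (quads r f)) + 6 * (M * R) ^ 3"
    using of_nat_mono[OF card_joined_quads[of r f], where 'a = real] by (simp flip: W)
  also have "real (card (quads r f)) \<le> 2 * (63 * 256 ^ 5 * real k ^ 5) * (8 * (M * R) ^ 4 / Q)"
  proof -
    have "real (card (quads r f)) \<le> 2 * (1 + 14 * (q / (2 * s)) ^ 3 + 48 * (q / (2 * s)) ^ 5) * (M * R ^ 4)"
      using f2 by (simp add: M_def R_def)
    also have "\<dots> \<le> 2 * (63 * 256 ^ 5 * real k ^ 5) * (8 * (M * R) ^ 4 / Q)"
      using coef MR M0 R0 by (intro mult_mono mult_left_mono) auto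
    finally show ?thesis .
  qed
  also have "6 * (M * R) ^ 3 \<le> 6 * (real k ^ 5 * (2 * (M * R) ^ 4 / Q))"
  proof -
    have "1 \<le> real k ^ 5" using k by (intro one_le_power) simp
    then have "1 * (2 * (M * R) ^ 4 / Q) \<le> real k ^ 5 * (2 * (M * R) ^ 4 / Q)"
      using M0 R0 Q0 by (intro mult_right_mono) auto
    then show ?thesis using MR3 by simp
  qed
  also have "2 * (63 * 256 ^ 5 * real k ^ 5) * (8 * (M * R) ^ 4 / Q) + 6 * (real k ^ 5 * (2 * (M * R) ^ 4 / Q))
      = (1008 * 256 ^ 5 + 12) * real k ^ 5 / Q * (M * R) ^ 4"
    by (simp add: field_simps)
  finally have fin: "real (card (joined_quads (verts r) (joined f)))
      \<le> (1008 * 256 ^ 5 + 12) * real k ^ 5 / real q ^ 12 * real (card (verts r)) ^ 4"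
    by (simp add: W Q_def)
  have "real (card (verts r)) > 0" using W M0 R0 by simp
  then have ne: "verts r \<noteq> {}" by auto
  have "\<forall>S \<subseteq> verts r. card S = n \<longrightarrow> (\<exists>x\<in>S. \<exists>y\<in>S. x \<noteq> y \<and> joined f x y)"
    using f1 by (auto simp: scattered_def)
  then show ?thesis
    using fin ne finite_verts[of r] joined_sym[of f]
    by (intro exI[of _ "verts r"] exI[of _ "joined f"]) auto
qed

text \<open>Average over all maps from \<open>N\<close> points to \<open>W\<close>: four given
  points have a uniformly random image in \<open>W ^ 4\<close>, so they span a clique with
  probability at most \<open>card (joined_quads W J) / card W ^ 4\<close>. Some map does no worse
  than the average, whatever the relation between \<open>N\<close> and
  \<open>card W\<close>.\<close>

lemma pullback_graph_exists:
  assumes W: "finite W" "W \<noteq> {}" and refl: "\<And>x. J x x" and sym: "\<And>x y. J x y \<Longrightarrow> J y x"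
    and dep: "\<And>S. S \<subseteq> W \<Longrightarrow> card S = n \<Longrightarrow> \<exists>x\<in>S. \<exists>y\<in>S. x \<noteq> y \<and> J x y"
  shows "\<exists>E. simple_graph {..<N} E \<and> \<not> (\<exists>S \<subseteq> {..<N}. card S = n \<and> indep S E) \<and>
    num_cliques 4 {..<N} E * card W ^ 4 \<le> (N choose 4) * card (joined_quads W J)"
proof -
  define G where "G = PiE {..<N} (\<lambda>_. W)"
  define E where "E g = {e. \<exists>i j. e = {i, j} \<and> i < N \<and> j < N \<and> i \<noteq> j \<and> J (g i) (g j)}" for g :: "nat \<Rightarrow> 'a"
  let ?K = "{K. K \<subseteq> {..<N} \<and> card K = 4}"
  have finG: "finite G" unfolding G_def using W by (intro finite_PiE) auto
  have cG: "card G = card W ^ N" by (simp add: G_def card_PiE)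
  have edge: "{i, j} \<in> E g \<longleftrightarrow> J (g i) (g j)" if "i < N" "j < N" "i \<noteq> j" for g i j
    using that sym by (auto simp: E_def doubleton_eq_iff)
  have graph: "simple_graph {..<N} (E g)" for g
    by (auto simp: simple_graph_def E_def)
  have ind: "\<not> (\<exists>S \<subseteq> {..<N}. card S = n \<and> indep S (E g))" if g: "g \<in> G" for g
  proof
    assume "\<exists>S \<subseteq> {..<N}. card S = n \<and> indep S (E g)"
    then obtain S where S: "S \<subseteq> {..<N}" "card S = n" "indep S (E g)" by blast
    have nJ: "\<not> J (g i) (g j)" if "i \<in> S" "j \<in> S" "i \<noteq> j" for i j
      using that S edge[of i j g] unfolding indep_def by blast
    \<comment> \<open>Reflexivity of \<open>J\<close> makes points with equal images adjacent, so an
      independent set keeps its size in \<open>W\<close>.\<close>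
    have "inj_on g S" by (rule inj_onI) (metis nJ refl)
    then have "card (g ` S) = n" using S by (simp add: card_image)
    moreover have "g ` S \<subseteq> W" using S g by (auto simp: G_def)
    ultimately obtain x y where "x \<in> g ` S" "y \<in> g ` S" "x \<noteq> y" "J x y" using dep by blast
    then show False using nJ by blast
  qed
  have cliq: "card {g \<in> G. clique K (E g)} * card W ^ 4 \<le> card (joined_quads W J) * card W ^ N" if K: "K \<in> ?K" for K
  proof -
    from K obtain a b c d where abcd: "K = {a, b, c, d}" "distinct [a, b, c, d]"
      by (auto simp: card_Suc_eq eval_nat_numeral)
    have lt: "a < N" "b < N" "c < N" "d < N" using K abcd by auto
    have N4: "4 \<le> N" using K card_mono[of "{..<N}" K] by auto
    \<comment> \<open>A map is determined by its values on \<open>K\<close> and its restriction to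
      the rest; for a clique the former range over \<open>joined_quads W J\<close> only.\<close>
    let ?h = "\<lambda>g. ((g a, g b, g c, g d), restrict g ({..<N} - K))"
    let ?C = "{g \<in> G. clique K (E g)}"
    have "inj_on ?h ?C"
    proof (rule inj_onI)
      fix g g' assume g: "g \<in> ?C" "g' \<in> ?C" and e: "?h g = ?h g'"
      show "g = g'"
      proof
        fix i
        consider "i \<in> K" | "i \<in> {..<N} - K" | "i \<notin> {..<N}" by blast
        then show "g i = g' i"
        proof cases
          case 1 then show ?thesis using e abcd by auto
        next
          case 2 then show ?thesis using e by (metis Pair_inject restrict_apply')
        next
          case 3 then show ?thesis using g by (auto simp: G_def PiE_def extensional_def)
        qed
      qed
    qed
    moreover have "?h ` ?C \<subseteq> joined_quads W J \<times> PiE ({..<N} - K) (\<lambda>_. W)"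
    proof (rule image_subsetI)
      fix g assume "g \<in> ?C"
      then have g: "g \<in> G" "clique K (E g)" by simp_all
      have gW: "g i \<in> W" if "i < N" for i using that g by (auto simp: G_def)
      have "J (g i) (g j)" if "i \<in> K" "j \<in> K" "i \<noteq> j" for i j
        using g(2) that K edge[of i j g] unfolding clique_def by blast
      then have "(g a, g b, g c, g d) \<in> joined_quads W J"
        using abcd gW lt by (simp add: joined_quads_def)
      moreover have "restrict g ({..<N} - K) \<in> PiE ({..<N} - K) (\<lambda>_. W)" using gW by auto
      ultimately show "?h g \<in> joined_quads W J \<times> PiE ({..<N} - K) (\<lambda>_. W)" by simp
    qed
    moreover have "finite (joined_quads W J \<times> PiE ({..<N} - K) (\<lambda>_. W))"
    proof -
      have "finite (joined_quads W J)"
        by (rule finite_subset[of _ "W \<times> W \<times> W \<times> W"]) (use W in \<open>auto simp: joined_quads_def\<close>)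
      then show ?thesis using W by (intro finite_SigmaI finite_PiE) auto
    qed
    ultimately have "card ?C \<le> card (joined_quads W J \<times> PiE ({..<N} - K) (\<lambda>_. W))"
      by (rule card_inj_on_le)
    also have "\<dots> = card (joined_quads W J) * card W ^ (N - 4)"
      using K by (auto simp: card_cartesian_product card_PiE card_Diff_subset finite_subset)
    finally have "card ?C * card W ^ 4 \<le> card (joined_quads W J) * card W ^ (N - 4) * card W ^ 4"
      by (rule mult_le_mono1)
    then show ?thesis using N4 by (simp add: mult.assoc flip: power_add)
  qed
  have finK: "finite ?K" by simp
  have "(\<Sum>g\<in>G. num_cliques 4 {..<N} (E g)) = (\<Sum>g\<in>G. card {K \<in> ?K. clique K (E g)})"
    by (simp add: num_cliques_def conj_assoc)
  also have "\<dots> = (\<Sum>K\<in>?K. card {g \<in> G. clique K (E g)})"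
    by (rule sum_card_swap[OF finG finK])
  finally have "(\<Sum>g\<in>G. num_cliques 4 {..<N} (E g) * card W ^ 4) = (\<Sum>K\<in>?K. card {g \<in> G. clique K (E g)} * card W ^ 4)"
    by (simp flip: sum_distrib_right)
  also have "\<dots> \<le> (\<Sum>K\<in>?K. card (joined_quads W J) * card W ^ N)" by (intro sum_mono cliq)
  also have "\<dots> = (\<Sum>g\<in>G. (N choose 4) * card (joined_quads W J))"
    by (simp add: cG n_subsets mult_ac)
  finally have le: "(\<Sum>g\<in>G. num_cliques 4 {..<N} (E g) * card W ^ 4) \<le> (\<Sum>g\<in>G. (N choose 4) * card (joined_quads W J))" .
  have "G \<noteq> {}" using W by (auto simp: G_def PiE_eq_empty_iff)
  then have "\<exists>g\<in>G. num_cliques 4 {..<N} (E g) * card W ^ 4 \<le> (N choose 4) * card (joined_quads W J)"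
    using sum_strict_mono[OF finG, of "\<lambda>_. (N choose 4) * card (joined_quads W J)" "\<lambda>g. num_cliques 4 {..<N} (E g) * card W ^ 4"] le
    by (meson not_le)
  then show ?thesis using graph ind by blast
qed

section \<open>Independent sets in locally sparse graphs\<close>

lemma sum_card_Pow: "finite F \<Longrightarrow> 2 * (\<Sum>Y\<in>Pow F. card Y) = card F * 2 ^ card F"
proof -
  assume F: "finite F"
  have "(\<Sum>Y\<in>Pow F. card Y) = (\<Sum>Y\<in>Pow F. card (F - Y))"
    by (rule sum.reindex_bij_witness[of _ "\<lambda>Y. F - Y" "\<lambda>Y. F - Y"]) (auto simp: double_diff)
  then have "2 * (\<Sum>Y\<in>Pow F. card Y) = (\<Sum>Y\<in>Pow F. card Y + card (F - Y))"
    by (simp add: sum.distrib)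
  also have "\<dots> = (\<Sum>Y\<in>Pow F. card F)"
  proof (rule sum.cong)
    fix Y assume "Y \<in> Pow F"
    then show "card Y + card (F - Y) = card F"
      using F by (simp add: card_Diff_subset card_mono finite_subset)
  qed simp
  finally show ?thesis using F by (simp add: card_Pow)
qed

text \<open>Here \<open>x\<close> is the number of neighbours left free by the conditioning in
  \<open>local_weight\<close>. If \<open>2 ^ x\<close> is at most the square root of
  \<open>D\<close>, the term \<open>D\<close> suffices alone; otherwise \<open>x\<close> is at least
  of order \<open>ln D\<close> and the second term does.\<close>

lemma hard_core_inequality:
  assumes "1 \<le> (D::real)"
  shows "ln D / 8 * (2 ^ x + 1) \<le> D + real x * 2 ^ x / 2"
proof (cases "2 ^ x \<le> sqrt D")
  case True
  have s1: "1 \<le> sqrt D" using assms by simp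
  have "ln D = 2 * ln (sqrt D)" using assms by (simp add: ln_sqrt)
  also have "\<dots> \<le> 2 * sqrt D" using ln_le_minus_one[of "sqrt D"] s1 by linarith
  finally have l: "ln D \<le> 2 * sqrt D" .
  have "ln D / 8 * (2 ^ x + 1) \<le> (2 * sqrt D) / 8 * (2 * sqrt D)"
    using l True s1 assms by (intro mult_mono) (linarith | simp)+
  also have "\<dots> = D / 2" using assms by (simp add: field_simps)
  also have "\<dots> \<le> D + real x * 2 ^ x / 2" using assms by simp
  finally show ?thesis .
next
  case False
  then have "ln (sqrt D) < ln (2 ^ x)" using assms by (subst ln_less_cancel_iff) auto
  then have "ln D < 2 * (real x * ln 2)" using assms by (simp add: ln_sqrt ln_realpow)
  also have "\<dots> \<le> 2 * (real x * 1)" using ln_le_minus_one[of 2] by (intro mult_left_mono) auto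
  finally have "ln D / 8 \<le> real x / 4" by simp
  then have "ln D / 8 * (2 ^ x + 1) \<le> real x / 4 * (2 * 2 ^ x)"
    by (intro mult_mono) auto
  also have "\<dots> = real x * 2 ^ x / 2" by simp
  finally show ?thesis using assms by simp
qed

section \<open>Turan's theorem and the hard-core argument\<close>

locale adjacency =
  fixes adj :: "'a \<Rightarrow> 'a \<Rightarrow> bool"
  assumes adj_sym: "adj x y \<Longrightarrow> adj y x" and adj_irrefl: "\<not> adj x x"
begin

definition nbrs where "nbrs A v = {u \<in> A. adj v u}"
definition independent where "independent S \<longleftrightarrow> (\<forall>x\<in>S. \<forall>y\<in>S. \<not> adj x y)"
definition e2 where "e2 A = (\<Sum>v\<in>A. card (nbrs A v))"
definition t3 where "t3 A = (\<Sum>v\<in>A. e2 (nbrs A v))"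
definition k4 where "k4 A = (\<Sum>v\<in>A. t3 (nbrs A v))"

text \<open>\<open>e2\<close>, \<open>t3\<close> and \<open>k4\<close> count ordered tuples, so they are \<open>2\<close>, \<open>6\<close> and \<open>24\<close> times the
  numbers of edges, triangles and cliques of size four.\<close>

lemma nbrs_subset: "nbrs A v \<subseteq> A" by (auto simp: nbrs_def)

lemma finite_nbrs: "finite A \<Longrightarrow> finite (nbrs A v)" by (simp add: nbrs_def)

lemma independent_subset: "independent S \<Longrightarrow> T \<subseteq> S \<Longrightarrow> independent T"
  by (auto simp: independent_def)

text \<open>Induction by removing a vertex of minimum degree \<open>\<delta>\<close> together with
  its neighbours. At least \<open>\<delta> * (\<delta> + 1)\<close> ordered edges disappear, since
  each of the \<open>\<delta> + 1\<close> removed vertices has degree at least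
  \<open>\<delta>\<close>.\<close>

lemma turan:
  assumes "finite A"
  shows "\<exists>I \<subseteq> A. independent I \<and> (card A)\<^sup>2 \<le> card I * (card A + e2 A)"
  using assms
proof (induction "card A" arbitrary: A rule: less_induct)
  case less
  show ?case
  proof (cases "A = {}")
    case True
    then show ?thesis by (intro exI[of _ "{}"]) (simp add: independent_def)
  next
    case False
    define \<delta> where "\<delta> = Min ((\<lambda>v. card (nbrs A v)) ` A)"
    have "\<delta> \<in> (\<lambda>v. card (nbrs A v)) ` A" unfolding \<delta>_def using less.prems False by (intro Min_in) auto
    then obtain v where v: "v \<in> A" "card (nbrs A v) = \<delta>" by auto
    have min: "\<delta> \<le> card (nbrs A u)" if "u \<in> A" for u
      unfolding \<delta>_def using less.prems that by simp
    define B where "B = insert v (nbrs A v)"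
    have BA: "B \<subseteq> A" using v by (auto simp: B_def nbrs_def)
    have "v \<notin> nbrs A v" using adj_irrefl by (simp add: nbrs_def)
    then have cB: "card B = \<delta> + 1" using v less.prems by (simp add: B_def finite_nbrs)
    have finB: "finite B" using BA less.prems by (rule finite_subset)
    have cA: "card A = card (A - B) + (\<delta> + 1)"
      using card_Diff_subset[OF finB BA] card_mono[OF less.prems BA] cB by simp
    obtain I where I: "I \<subseteq> A - B" "independent I"
      and IH: "(card (A - B))\<^sup>2 \<le> card I * (card (A - B) + e2 (A - B))"
      using less.hyps[of "A - B"] less.prems cA by auto
    have "e2 A = (\<Sum>u\<in>B. card (nbrs A u)) + (\<Sum>u\<in>A - B. card (nbrs A u))"
      unfolding e2_def using sum.subset_diff[OF BA less.prems] by (simp add: add.commute)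
    also have "\<dots> \<ge> (\<Sum>u\<in>B. \<delta>) + e2 (A - B)"
      unfolding e2_def
    proof (intro add_mono sum_mono)
      show "\<delta> \<le> card (nbrs A u)" if "u \<in> B" for u using that BA min by blast
      show "card (nbrs (A - B) u) \<le> card (nbrs A u)" if "u \<in> A - B" for u
        using less.prems by (intro card_mono) (auto simp: nbrs_def)
    qed
    finally have e: "\<delta> * (\<delta> + 1) + e2 (A - B) \<le> e2 A" by (simp add: cB mult.commute)
    have fI: "finite I" and vI: "v \<notin> I" using I less.prems finite_subset by (auto simp: B_def)
    have indI: "independent (insert v I)"
      using I adj_sym adj_irrefl unfolding independent_def B_def nbrs_def by blast
    \<comment> \<open>The induction step is \<open>(a + x) ^ 2 \<le> (i + 1) * (b + x ^ 2)\<close>,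
      a Cauchy-Schwarz inequality: its cross term \<open>2 * a * x\<close> is bounded from
      \<open>a ^ 2 \<le> i * b\<close> by arithmetic and geometric means.\<close>
    define a b i x where "a = real (card (A - B))" and "b = a + real (e2 (A - B))"
      and "i = real (card I)" and "x = real (\<delta> + 1)"
    have IH': "a\<^sup>2 \<le> i * b"
      using of_nat_mono[OF IH, where 'a = real] by (simp add: a_def b_def i_def)
    have pos: "0 \<le> a" "0 \<le> b" "0 \<le> i" "0 \<le> x" by (simp_all add: a_def b_def i_def x_def)
    have "(2 * a * x)\<^sup>2 = 4 * x\<^sup>2 * a\<^sup>2" by (simp add: power2_eq_square)
    also have "\<dots> \<le> 4 * x\<^sup>2 * (i * b)" using IH' by (intro mult_left_mono) auto
    also have "\<dots> \<le> (i * x\<^sup>2 + b)\<^sup>2"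
      using zero_le_power2[of "i * x\<^sup>2 - b"] by (simp add: power2_eq_square algebra_simps)
    finally have am: "2 * a * x \<le> i * x\<^sup>2 + b"
      using pos by (intro power2_le_imp_le[of "2 * a * x"]) auto
    have "real (\<delta> * (\<delta> + 1)) = x\<^sup>2 - x" by (simp add: x_def power2_eq_square algebra_simps)
    then have "b + x\<^sup>2 \<le> real (card A + e2 A)"
      using of_nat_mono[OF e, where 'a = real] by (simp add: cA b_def a_def x_def)
    then have "(i + 1) * (b + x\<^sup>2) \<le> (i + 1) * real (card A + e2 A)"
      using pos by (intro mult_left_mono) auto
    moreover have "(a + x)\<^sup>2 \<le> (i + 1) * (b + x\<^sup>2)"
      using am IH' by (simp add: power2_eq_square algebra_simps)
    moreover have "real (card A) = a + x" by (simp add: cA a_def x_def)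
    moreover have "i + 1 = real (card (insert v I))" using fI vI by (simp add: i_def)
    ultimately have "real ((card A)\<^sup>2) \<le> real (card (insert v I) * (card A + e2 A))"
      by simp
    then have "(card A)\<^sup>2 \<le> card (insert v I) * (card A + e2 A)"
      by (simp only: of_nat_le_iff)
    moreover have "insert v I \<subseteq> A" using I v by auto
    ultimately show ?thesis using indI by blast
  qed
qed

lemma edges_lower_bound:
  assumes "finite A" "n > 0" and no: "\<And>I. I \<subseteq> A \<Longrightarrow> independent I \<Longrightarrow> card I \<noteq> n"
  shows "(real (card A))\<^sup>2 / n - card A \<le> e2 A"
proof -
  obtain I where I: "I \<subseteq> A" "independent I" "(card A)\<^sup>2 \<le> card I * (card A + e2 A)"
    using turan[OF assms(1)] by blast
  have "card I \<le> n"
  proof (rule ccontr)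
    assume "\<not> card I \<le> n"
    then obtain T where "T \<subseteq> I" "card T = n" by (meson nat_le_linear obtain_subset_with_card_n)
    then show False using no[of T] I independent_subset by blast
  qed
  then have "(card A)\<^sup>2 \<le> n * (card A + e2 A)" using I(3) by (meson le_trans mult_le_mono1)
  then have "(real (card A))\<^sup>2 \<le> real n * (real (card A) + real (e2 A))"
    using of_nat_mono[where 'a = real] by fastforce
  then show ?thesis using assms(2) by (simp add: field_simps)
qed

text \<open>For a uniformly random independent set \<open>I\<close> and a vertex \<open>v\<close>, the weight
  \<open>D\<close> if \<open>v \<in> I\<close>, plus the number of neighbours of \<open>v\<close> in \<open>I\<close>, has mean at least \<open>ln D / 8\<close>,
  even conditionally on \<open>I\<close> outside the closed neighbourhood of \<open>v\<close>.\<close>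

lemma local_weight:
  fixes D :: real
  assumes fin: "finite A" and v: "v \<in> A" and D: "1 \<le> D" and free: "independent (nbrs A v)"
  shows "(\<Sum>I | I \<subseteq> A \<and> independent I. ln D / 8)
    \<le> (\<Sum>I | I \<subseteq> A \<and> independent I. D * of_bool (v \<in> I) + real (card (nbrs A v \<inter> I)))"
proof -
  let ?\<I> = "{I. I \<subseteq> A \<and> independent I}"
  let ?X = "\<lambda>I. D * of_bool (v \<in> I) + real (card (nbrs A v \<inter> I))"
  define B where "B = insert v (nbrs A v)"
  let ?\<J> = "(\<lambda>I. I - B) ` ?\<I>"
  have fin\<I>: "finite ?\<I>" using fin by simp
  have cls: "(\<Sum>I | I \<in> ?\<I> \<and> I - B = J. ln D / 8) \<le> (\<Sum>I | I \<in> ?\<I> \<and> I - B = J. ?X I)" if J: "J \<in> ?\<J>" for J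
  proof -
    from J have JA: "J \<subseteq> A - B" and Ji: "independent J"
      by (auto intro: independent_subset)
    define F where "F = {u \<in> nbrs A v. \<forall>y\<in>J. \<not> adj u y}"
    have finF: "finite F" using fin by (simp add: F_def finite_nbrs)
    have vn: "v \<notin> nbrs A v" using adj_irrefl by (simp add: nbrs_def)
    \<comment> \<open>\<open>F\<close> consists of the neighbours of \<open>v\<close> compatible
      with \<open>J\<close>. Given \<open>J\<close>, the set is either \<open>J\<close> with
      \<open>v\<close>, or \<open>J\<close> with an arbitrary subset of \<open>F\<close>, because
      the neighbourhood of \<open>v\<close> is independent. These are \<open>2 ^ card F + 1\<close>
      possibilities.\<close>
    have C: "{I. I \<in> ?\<I> \<and> I - B = J} = insert (insert v J) ((\<lambda>Y. J \<union> Y) ` Pow F)"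
    proof (intro equalityI subsetI)
      fix I assume "I \<in> {I. I \<in> ?\<I> \<and> I - B = J}"
      then have I: "I \<subseteq> A" "independent I" "I - B = J" by auto
      show "I \<in> insert (insert v J) ((\<lambda>Y. J \<union> Y) ` Pow F)"
      proof (cases "v \<in> I")
        case True
        then have "nbrs A v \<inter> I = {}" using I(2) by (auto simp: independent_def nbrs_def)
        then have "I = insert v J" using True I(3) by (auto simp: B_def)
        then show ?thesis by simp
      next
        case False
        then have "I = J \<union> (I \<inter> nbrs A v)" using I(3) by (auto simp: B_def)
        moreover have "I \<inter> nbrs A v \<in> Pow F"
          using I(2,3) by (auto simp: F_def independent_def)
        ultimately show ?thesis by blast
      qed
    next
      fix I assume "I \<in> insert (insert v J) ((\<lambda>Y. J \<union> Y) ` Pow F)"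
      then consider "I = insert v J" | Y where "Y \<subseteq> F" "I = J \<union> Y" by auto
      then show "I \<in> {I. I \<in> ?\<I> \<and> I - B = J}"
      proof cases
        case 1
        have "\<not> adj v y \<and> \<not> adj y v" if "y \<in> J" for y
          using that JA adj_sym by (auto simp: B_def nbrs_def)
        then have "independent I" using Ji adj_irrefl 1 by (auto simp: independent_def)
        then show ?thesis using 1 JA v by (auto simp: B_def)
      next
        case 2
        have "\<not> adj u y \<and> \<not> adj y u" if "y \<in> J" "u \<in> Y" for u y
          using that 2 adj_sym by (auto simp: F_def)
        moreover have "independent Y" using free 2 by (auto simp: F_def intro: independent_subset)
        ultimately have "independent I" using Ji 2 by (auto simp: independent_def)
        moreover have "Y \<subseteq> B" "Y \<subseteq> A" using 2 by (auto simp: B_def F_def nbrs_def)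
        ultimately show ?thesis using 2 JA by auto
      qed
    qed
    have nin: "insert v J \<notin> (\<lambda>Y. J \<union> Y) ` Pow F"
      using JA vn by (auto simp: B_def F_def)
    have inj: "inj_on (\<lambda>Y. J \<union> Y) (Pow F)"
    proof (rule inj_onI)
      fix Y Z assume "Y \<in> Pow F" "Z \<in> Pow F" "J \<union> Y = J \<union> Z"
      moreover have "J \<inter> F = {}" using JA by (auto simp: B_def F_def)
      ultimately show "Y = Z" by blast
    qed
    have "(\<Sum>I | I \<in> ?\<I> \<and> I - B = J. ln D / 8) = ln D / 8 * (2 ^ card F + 1)"
      unfolding C using nin inj finF by (simp add: card_image card_Pow algebra_simps)
    also have "\<dots> \<le> D + real (card F) * 2 ^ card F / 2" by (rule hard_core_inequality[OF D])
    also have "\<dots> = D + (\<Sum>Y\<in>Pow F. real (card Y))"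
      using arg_cong[OF sum_card_Pow[OF finF], of real] by simp
    also have "\<dots> \<le> ?X (insert v J) + (\<Sum>Y\<in>Pow F. ?X (J \<union> Y))"
    proof (intro add_mono sum_mono)
      show "D \<le> ?X (insert v J)" by simp
      fix Y assume Y: "Y \<in> Pow F"
      have "card Y \<le> card (nbrs A v \<inter> (J \<union> Y))"
        using Y fin by (intro card_mono) (auto simp: F_def finite_nbrs)
      then show "real (card Y) \<le> ?X (J \<union> Y)" using D by (simp add: add_increasing)
    qed
    also have "\<dots> = (\<Sum>I | I \<in> ?\<I> \<and> I - B = J. ?X I)"
      unfolding C using nin inj finF by (simp add: sum.reindex)
    finally show ?thesis .
  qed
  have "(\<Sum>I\<in>?\<I>. ln D / 8) = (\<Sum>J\<in>?\<J>. \<Sum>I | I \<in> ?\<I> \<and> I - B = J. ln D / 8)"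
    by (rule sum.image_gen[OF fin\<I>])
  also have "\<dots> \<le> (\<Sum>J\<in>?\<J>. \<Sum>I | I \<in> ?\<I> \<and> I - B = J. ?X I)" by (rule sum_mono[OF cls])
  also have "\<dots> = (\<Sum>I\<in>?\<I>. ?X I)" by (rule sum.image_gen[OF fin\<I>, symmetric])
  finally show ?thesis .
qed

text \<open>Summed over \<open>v\<close>, the weight of \<open>I\<close> is at most
  \<open>2 * D * card I\<close>: each member contributes \<open>D\<close> for itself and at most
  \<open>D\<close> through its neighbours. Averaging over all independent sets and comparing with
  \<open>local_weight\<close> yields a large one.\<close>

lemma triangle_free_independent:
  fixes D :: real
  assumes fin: "finite A" and D: "1 \<le> D" and deg: "\<And>v. v \<in> A \<Longrightarrow> card (nbrs A v) \<le> D"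
    and free: "\<And>v. v \<in> A \<Longrightarrow> independent (nbrs A v)"
  shows "\<exists>I \<subseteq> A. independent I \<and> card A * (ln D / 8) \<le> 2 * D * card I"
proof (rule ccontr)
  assume neg: "\<not> ?thesis"
  let ?\<I> = "{I. I \<subseteq> A \<and> independent I}"
  let ?X = "\<lambda>v I. D * of_bool (v \<in> I) + real (card (nbrs A v \<inter> I))"
  have fin\<I>: "finite ?\<I>" using fin by simp
  have ne: "?\<I> \<noteq> {}" by (auto simp: independent_def intro!: exI[of _ "{}"])
  have up: "(\<Sum>v\<in>A. ?X v I) \<le> 2 * D * card I" if I: "I \<in> ?\<I>" for I
  proof -
    have IA: "I \<subseteq> A" and fI: "finite I" using I fin finite_subset by auto
    have "(\<Sum>v\<in>A. card (nbrs A v \<inter> I)) = (\<Sum>v\<in>A. card {u \<in> I. adj v u})"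
      using IA by (intro sum.cong arg_cong[of _ _ card]) (auto simp: nbrs_def)
    also have "\<dots> = (\<Sum>u\<in>I. card {v \<in> A. adj v u})" by (rule sum_card_swap[OF fin fI])
    also have "\<dots> = (\<Sum>u\<in>I. card (nbrs A u))"
      unfolding nbrs_def using adj_sym by (intro sum.cong arg_cong[of _ _ card]) auto
    finally have "(\<Sum>v\<in>A. real (card (nbrs A v \<inter> I))) = (\<Sum>u\<in>I. real (card (nbrs A u)))"
      by (simp flip: of_nat_sum)
    also have "\<dots> \<le> (\<Sum>u\<in>I. D)" using IA deg by (intro sum_mono) auto
    finally have "(\<Sum>v\<in>A. real (card (nbrs A v \<inter> I))) \<le> D * card I" by (simp add: mult.commute)
    moreover have "(\<Sum>v\<in>A. D * of_bool (v \<in> I)) = D * card I"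
      using fin IA by (simp add: Int_absorb1 flip: sum_distrib_left)
    ultimately show ?thesis by (simp add: sum.distrib)
  qed
  have "card A * (\<Sum>I\<in>?\<I>. ln D / 8) = (\<Sum>v\<in>A. \<Sum>I\<in>?\<I>. ln D / 8)" by simp
  also have "\<dots> \<le> (\<Sum>v\<in>A. \<Sum>I\<in>?\<I>. ?X v I)" by (intro sum_mono local_weight fin D free)
  also have "\<dots> = (\<Sum>I\<in>?\<I>. \<Sum>v\<in>A. ?X v I)" by (rule sum.swap)
  also have "\<dots> \<le> (\<Sum>I\<in>?\<I>. 2 * D * card I)" by (intro sum_mono up)
  also have "\<dots> < (\<Sum>I\<in>?\<I>. card A * (ln D / 8))"
    using neg by (intro sum_strict_mono fin\<I> ne) (auto simp: not_le)
  finally show False by (simp flip: sum_distrib_left)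
qed

end

section \<open>Random subsets of fixed size\<close>

lemma binomial_ratio_le:
  "k \<le> m \<Longrightarrow> m \<le> N \<Longrightarrow> ((N - k) choose (m - k)) * N ^ k \<le> (N choose m) * m ^ k"
proof (induction k)
  case (Suc k)
  have absorb: "(m - k) * ((N - k) choose (m - k)) = (N - k) * ((N - Suc k) choose (m - Suc k))"
    using times_binomial_minus1_eq[of "m - k" "N - k"] Suc.prems by simp
  \<comment> \<open>The next factor of the ratio, \<open>(m - k) / (N - k)\<close>, is at most
    \<open>m / N\<close>.\<close>
  have "(m - k) * N \<le> m * (N - k)"
    using Suc.prems by (simp add: diff_mult_distrib diff_mult_distrib2 mult.commute diff_le_mono2)
  then have cross: "(m - k) * N * ((N choose m) * m ^ k) \<le> m * (N - k) * ((N choose m) * m ^ k)"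
    by (rule mult_le_mono1)
  have "(N - k) * (((N - Suc k) choose (m - Suc k)) * N ^ Suc k)
      = (m - k) * N * (((N - k) choose (m - k)) * N ^ k)"
    using absorb by (simp add: mult_ac)
  also have "\<dots> \<le> (m - k) * N * ((N choose m) * m ^ k)"
    using Suc by (intro mult_le_mono2) simp
  also have "\<dots> \<le> m * (N - k) * ((N choose m) * m ^ k)" by (rule cross)
  also have "\<dots> = (N - k) * ((N choose m) * m ^ Suc k)" by simp
  finally show ?case using Suc.prems by simp
qed simp

lemma card_supersets:
  assumes "finite V" "K \<subseteq> V" "card K \<le> m"
  shows "card {A. A \<subseteq> V \<and> card A = m \<and> K \<subseteq> A} = (card V - card K) choose (m - card K)"
proof -
  have fK: "finite K" using assms finite_subset by blast
  have "bij_betw (\<lambda>A. A - K) {A. A \<subseteq> V \<and> card A = m \<and> K \<subseteq> A} {B. B \<subseteq> V - K \<and> card B = m - card K}"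
  proof (rule bij_betwI[where g = "\<lambda>B. B \<union> K"])
    show "(\<lambda>A. A - K) \<in> {A. A \<subseteq> V \<and> card A = m \<and> K \<subseteq> A} \<rightarrow> {B. B \<subseteq> V - K \<and> card B = m - card K}"
      using fK by (auto simp: card_Diff_subset)
    show "(\<lambda>B. B \<union> K) \<in> {B. B \<subseteq> V - K \<and> card B = m - card K} \<rightarrow> {A. A \<subseteq> V \<and> card A = m \<and> K \<subseteq> A}"
    proof
      fix B assume B: "B \<in> {B. B \<subseteq> V - K \<and> card B = m - card K}"
      then have "finite B" "B \<inter> K = {}" using assms(1) finite_subset by blast+
      then have "card (B \<union> K) = card B + card K" using fK by (simp add: card_Un_disjoint)
      then show "B \<union> K \<in> {A. A \<subseteq> V \<and> card A = m \<and> K \<subseteq> A}" using B assms by auto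
    qed
  qed auto
  then have "card {A. A \<subseteq> V \<and> card A = m \<and> K \<subseteq> A} = card {B. B \<subseteq> V - K \<and> card B = m - card K}"
    by (rule bij_betw_same_card)
  also have "\<dots> = card (V - K) choose (m - card K)" using assms by (intro n_subsets) simp
  finally show ?thesis using fK assms by (simp add: card_Diff_subset)
qed

text \<open>Linearity of expectation for a uniformly random \<open>m\<close>-subset, in which
  \<open>k\<close> given vertices survive with probability at most
  \<open>(m / card V) ^ k\<close>.\<close>

lemma sum_sampled_tuples:
  assumes "finite V" "finite T" "m \<le> card V"
    and s: "\<And>t. t \<in> T \<Longrightarrow> s t \<subseteq> V \<and> card (s t) = k"
  shows "(\<Sum>A | A \<subseteq> V \<and> card A = m. card {t \<in> T. s t \<subseteq> A}) * card V ^ k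
    \<le> card T * m ^ k * (card V choose m)"
proof -
  let ?A = "{A. A \<subseteq> V \<and> card A = m}"
  have one: "card {A \<in> ?A. s t \<subseteq> A} * card V ^ k \<le> (card V choose m) * m ^ k" if t: "t \<in> T" for t
  proof (cases "k \<le> m")
    case True
    have "{A \<in> ?A. s t \<subseteq> A} = {A. A \<subseteq> V \<and> card A = m \<and> s t \<subseteq> A}" by auto
    then show ?thesis
      using card_supersets[OF assms(1), of "s t" m] s[OF t] True binomial_ratio_le[OF True assms(3)] by simp
  next
    case False
    have "card (s t) \<le> card A" if "A \<subseteq> V" "s t \<subseteq> A" for A
      using that assms(1) by (meson card_mono finite_subset)
    then have "{A \<in> ?A. s t \<subseteq> A} = {}" using s[OF t] False by auto
    then show ?thesis by (simp only: card.empty mult_0) 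
  qed
  have "(\<Sum>A\<in>?A. card {t \<in> T. s t \<subseteq> A}) = (\<Sum>t\<in>T. card {A \<in> ?A. s t \<subseteq> A})"
    using assms(1,2) by (intro sum_card_swap) auto
  then have "(\<Sum>A\<in>?A. card {t \<in> T. s t \<subseteq> A}) * card V ^ k = (\<Sum>t\<in>T. card {A \<in> ?A. s t \<subseteq> A} * card V ^ k)"
    by (simp add: sum_distrib_right)
  also have "\<dots> \<le> (\<Sum>t\<in>T. (card V choose m) * m ^ k)" by (rule sum_mono[OF one])
  finally show ?thesis by (simp add: mult_ac)
qed

context adjacency
begin

lemma e2_tuples:
  assumes "finite A"
  shows "e2 A = card {(u, v). u \<in> A \<and> v \<in> A \<and> adj u v}"
proof -
  have "e2 A = card (SIGMA v:A. nbrs A v)"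
    unfolding e2_def using assms finite_nbrs by (intro card_SigmaI[symmetric]) auto
  also have "(SIGMA v:A. nbrs A v) = {(u, v). u \<in> A \<and> v \<in> A \<and> adj u v}"
    by (auto simp: nbrs_def)
  finally show ?thesis .
qed

lemma t3_tuples:
  assumes "finite A"
  shows "t3 A = card {(u, v, w). u \<in> A \<and> v \<in> A \<and> w \<in> A \<and> adj u v \<and> adj u w \<and> adj v w}"
proof -
  have fin: "finite {(v, w). v \<in> nbrs A u \<and> w \<in> nbrs A u \<and> adj v w}" for u
    by (rule finite_subset[of _ "A \<times> A"]) (use assms in \<open>auto simp: nbrs_def\<close>)
  have "t3 A = (\<Sum>u\<in>A. card {(v, w). v \<in> nbrs A u \<and> w \<in> nbrs A u \<and> adj v w})"
    unfolding t3_def using assms finite_nbrs by (simp add: e2_tuples)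
  also have "\<dots> = card (SIGMA u:A. {(v, w). v \<in> nbrs A u \<and> w \<in> nbrs A u \<and> adj v w})"
    using assms fin by (intro card_SigmaI[symmetric]) auto
  also have "(SIGMA u:A. {(v, w). v \<in> nbrs A u \<and> w \<in> nbrs A u \<and> adj v w})
      = {(u, v, w). u \<in> A \<and> v \<in> A \<and> w \<in> A \<and> adj u v \<and> adj u w \<and> adj v w}"
    by (auto simp: nbrs_def)
  finally show ?thesis .
qed

lemma k4_tuples:
  assumes "finite A"
  shows "k4 A = card {(u, v, w, x). {u, v, w, x} \<subseteq> A \<and> adj u v \<and> adj u w \<and> adj u x \<and> adj v w \<and> adj v x \<and> adj w x}"
proof -
  let ?T = "\<lambda>u. {(v, w, x). v \<in> nbrs A u \<and> w \<in> nbrs A u \<and> x \<in> nbrs A u \<and> adj v w \<and> adj v x \<and> adj w x}"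
  have fin: "finite (?T u)" for u
    by (rule finite_subset[of _ "A \<times> A \<times> A"]) (use assms in \<open>auto simp: nbrs_def\<close>)
  have "k4 A = (\<Sum>u\<in>A. card (?T u))"
    unfolding k4_def using assms finite_nbrs by (simp add: t3_tuples)
  also have "\<dots> = card (SIGMA u:A. ?T u)"
    using assms fin by (intro card_SigmaI[symmetric]) auto
  also have "(SIGMA u:A. ?T u)
      = {(u, v, w, x). {u, v, w, x} \<subseteq> A \<and> adj u v \<and> adj u w \<and> adj u x \<and> adj v w \<and> adj v x \<and> adj w x}"
    by (auto simp: nbrs_def)
  finally show ?thesis .
qed

lemma sparse_sample_exists:
  fixes a b :: real
  assumes fin: "finite V" and m: "0 < m" "m \<le> card V" and ab: "0 < a" "0 < b"
    and e: "e2 V \<le> a * card V ^ 2" and t: "t3 V \<le> b * card V ^ 3"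
  shows "\<exists>A \<subseteq> V. card A = m \<and> e2 A \<le> 2 * a * m ^ 2 \<and> t3 A \<le> 2 * b * m ^ 3"
proof (rule ccontr)
  assume neg: "\<not> ?thesis"
  let ?A = "{A. A \<subseteq> V \<and> card A = m}"
  let ?T2 = "{(u, v). u \<in> V \<and> v \<in> V \<and> adj u v}"
  let ?T3 = "{(u, v, w). u \<in> V \<and> v \<in> V \<and> w \<in> V \<and> adj u v \<and> adj u w \<and> adj v w}"
  have f2: "finite ?T2" by (rule finite_subset[of _ "V \<times> V"]) (use fin in auto)
  have f3: "finite ?T3" by (rule finite_subset[of _ "V \<times> V \<times> V"]) (use fin in auto)
  have fA: "finite A" if "A \<in> ?A" for A using that fin finite_subset by auto
  have E: "(\<Sum>A\<in>?A. e2 A) = (\<Sum>A\<in>?A. card {t \<in> ?T2. (case t of (u, v) \<Rightarrow> {u, v}) \<subseteq> A})"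
    using fA by (intro sum.cong refl) (auto simp: e2_tuples intro!: arg_cong[of _ _ card])
  have T: "(\<Sum>A\<in>?A. t3 A) = (\<Sum>A\<in>?A. card {t \<in> ?T3. (case t of (u, v, w) \<Rightarrow> {u, v, w}) \<subseteq> A})"
    using fA by (intro sum.cong refl) (auto simp: t3_tuples intro!: arg_cong[of _ _ card])
  have ne: "u \<noteq> v" if "adj u v" for u v using that adj_irrefl by auto
  have "(\<Sum>A\<in>?A. e2 A) * card V ^ 2 \<le> card ?T2 * m ^ 2 * (card V choose m)"
    unfolding E by (rule sum_sampled_tuples[OF fin f2 m(2)]) (auto dest: ne simp: card_insert_if)
  then have E2: "real (\<Sum>A\<in>?A. e2 A) * card V ^ 2 \<le> real (e2 V) * m ^ 2 * (card V choose m)"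
    using of_nat_mono[where 'a = real] e2_tuples[OF fin] by fastforce
  have "(\<Sum>A\<in>?A. t3 A) * card V ^ 3 \<le> card ?T3 * m ^ 3 * (card V choose m)"
    unfolding T by (rule sum_sampled_tuples[OF fin f3 m(2)]) (auto dest: ne simp: card_insert_if)
  then have T3: "real (\<Sum>A\<in>?A. t3 A) * card V ^ 3 \<le> real (t3 V) * m ^ 3 * (card V choose m)"
    using of_nat_mono[where 'a = real] t3_tuples[OF fin] by fastforce
  have V0: "real (card V) > 0" using m by simp
  have "real (e2 V) * m ^ 2 * (card V choose m) \<le> a * card V ^ 2 * m ^ 2 * (card V choose m)"
    using e by (intro mult_right_mono) auto
  with E2 have "real (\<Sum>A\<in>?A. e2 A) * card V ^ 2 \<le> (a * m ^ 2 * (card V choose m)) * card V ^ 2"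
    by (simp add: mult_ac)
  then have E4: "real (\<Sum>A\<in>?A. e2 A) / (a * m ^ 2) \<le> card V choose m"
    using V0 ab m by (simp add: pos_divide_le_eq mult_ac)
  have "real (t3 V) * m ^ 3 * (card V choose m) \<le> b * card V ^ 3 * m ^ 3 * (card V choose m)"
    using t by (intro mult_right_mono) auto
  with T3 have "real (\<Sum>A\<in>?A. t3 A) * card V ^ 3 \<le> (b * m ^ 3 * (card V choose m)) * card V ^ 3"
    by (simp add: mult_ac)
  then have T4: "real (\<Sum>A\<in>?A. t3 A) / (b * m ^ 3) \<le> card V choose m"
    using V0 ab m by (simp add: pos_divide_le_eq mult_ac)
  \<comment> \<open>Both normalised counts have mean at most 1, so on some sample their sum is at
    most 2, which bounds each of them.\<close>
  have big: "2 < e2 A / (a * m ^ 2) + t3 A / (b * m ^ 3)" if "A \<in> ?A" for A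
  proof -
    have "2 * a * m ^ 2 < e2 A \<or> 2 * b * m ^ 3 < t3 A" using neg that by (auto simp: not_le)
    then have "2 < e2 A / (a * m ^ 2) \<or> 2 < t3 A / (b * m ^ 3)"
      using ab m by (simp add: pos_less_divide_eq mult_ac)
    moreover have "0 \<le> e2 A / (a * m ^ 2)" "0 \<le> t3 A / (b * m ^ 3)" using ab by simp_all
    ultimately show ?thesis by linarith
  qed
  have cA: "card ?A = card V choose m" by (rule n_subsets[OF fin])
  have finA: "finite ?A" using fin by simp
  have "?A \<noteq> {}"
  proof
    assume "?A = {}"
    then have "card ?A = 0" by (simp only: card.empty)
    then show False using cA m by simp
  qed
  then have "(\<Sum>A\<in>?A. 2) < (\<Sum>A\<in>?A. e2 A / (a * m ^ 2) + t3 A / (b * m ^ 3))"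
    by (intro sum_strict_mono finA big)
  also have "\<dots> = real (\<Sum>A\<in>?A. e2 A) / (a * m ^ 2) + real (\<Sum>A\<in>?A. t3 A) / (b * m ^ 3)"
    by (simp add: sum.distrib sum_divide_distrib)
  also have "\<dots> \<le> 2 * real (card V choose m)" using E4 T4 by simp
  finally show False by (simp add: cA)
qed

text \<open>If both alternatives fail, a random sample of \<open>n * k\<close> vertices has average
  degree at most \<open>D / 4\<close> and at most \<open>n * k / 8\<close> ordered triangles.
  Deleting vertices of degree above \<open>D\<close> and vertices in triangles leaves at least half
  of the sample, free of triangles, and \<open>ln D \<ge> l / 8\<close> makes its independent set
  reach size \<open>n\<close>.\<close>

lemma density_dichotomy:
  fixes l :: real
  assumes fin: "finite V" and n: "0 < n" and k: "0 < k" "n * k \<le> card V" and l: "0 < l"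
    and D1: "1 \<le> k * l / 256" and D2: "l / 8 \<le> ln (k * l / 256)"
    and no: "\<And>I. I \<subseteq> V \<Longrightarrow> independent I \<Longrightarrow> card I \<noteq> n"
  shows "card V ^ 2 * l / (2048 * n) < e2 V \<or> card V ^ 3 / (16 * n ^ 2 * k ^ 2) < t3 V"
proof (rule ccontr)
  assume neg: "\<not> ?thesis"
  \<comment> \<open>The divisor 256 makes \<open>n * (2 * D)\<close> equal to
    \<open>m / 2 * (l / 64)\<close>, so the final comparison yields exactly
    \<open>n\<close>.\<close>
  define D where "D = k * l / 256"
  have D0: "1 \<le> D" using D1 by (simp only: D_def)
  define m where "m = n * k"
  have m0: "0 < m" using n k by (simp add: m_def)
  have e: "e2 V \<le> (l / (2048 * n)) * card V ^ 2" using neg by (simp add: not_less mult_ac)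
  have t: "t3 V \<le> (1 / (16 * n ^ 2 * k ^ 2)) * card V ^ 3" using neg by (simp add: not_less)
  obtain A where A: "A \<subseteq> V" "card A = m" and eA0: "e2 A \<le> 2 * (l / (2048 * n)) * m ^ 2"
    and tA0: "t3 A \<le> 2 * (1 / (16 * n ^ 2 * k ^ 2)) * m ^ 3"
    using sparse_sample_exists[OF fin m0 k(2)[folded m_def] _ _ e t] l n k by auto
  have eA: "real (e2 A) \<le> m * D / 4"
    using eA0 n by (simp add: m_def D_def power2_eq_square field_simps)
  have tA: "8 * t3 A \<le> m"
  proof -
    have "real (t3 A) \<le> m / 8"
      using tA0 n k by (simp add: m_def power2_eq_square power3_eq_cube field_simps)
    then show ?thesis by linarith
  qed
  have fA: "finite A" using A fin finite_subset by blast
  define T where "T = {u \<in> A. \<exists>v w. v \<in> A \<and> w \<in> A \<and> adj u v \<and> adj u w \<and> adj v w}"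
  define B where "B = {v \<in> A. D < card (nbrs A v)}"
  have "T \<subseteq> fst ` {(u, v, w). u \<in> A \<and> v \<in> A \<and> w \<in> A \<and> adj u v \<and> adj u w \<and> adj v w}"
    by (force simp: T_def)
  moreover have "finite {(u, v, w). u \<in> A \<and> v \<in> A \<and> w \<in> A \<and> adj u v \<and> adj u w \<and> adj v w}"
    by (rule finite_subset[of _ "A \<times> A \<times> A"]) (use fA in auto)
  ultimately have "card T \<le> t3 A" unfolding t3_tuples[OF fA] by (rule surj_card_le[rotated])
  then have cT: "real (card T) \<le> m / 8" using tA by linarith
  have fB: "finite B" using fA by (simp add: B_def)
  have "card B * D = (\<Sum>v\<in>B. D)" by simp
  also have "\<dots> \<le> (\<Sum>v\<in>B. real (card (nbrs A v)))" by (intro sum_mono) (simp add: B_def)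
  also have "\<dots> \<le> (\<Sum>v\<in>A. real (card (nbrs A v)))"
    using fA by (intro sum_mono2) (auto simp: B_def)
  also have "\<dots> \<le> m * D / 4" using eA by (simp add: e2_def)
  finally have "real (card B) * D \<le> m / 4 * D" by simp
  then have cB: "real (card B) \<le> m / 4"
    by (rule mult_right_le_imp_le) (use D1 in \<open>simp add: D_def\<close>)
  define A' where "A' = A - (T \<union> B)"
  have "card A \<le> card (A' \<union> (T \<union> B))"
    using fA by (intro card_mono) (auto simp: A'_def T_def B_def)
  also have "\<dots> \<le> card A' + (card T + card B)"
    using card_Un_le[of A' "T \<union> B"] card_Un_le[of T B] by linarith
  finally have cA': "m / 2 \<le> real (card A')" using cT cB A(2) by linarith
  have fA': "finite A'" using fA by (simp add: A'_def)
  have "\<exists>I \<subseteq> A'. independent I \<and> card A' * (ln D / 8) \<le> 2 * D * card I"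
  proof (rule triangle_free_independent[OF fA'])
    show "1 \<le> D" using D1 by (simp add: D_def)
    fix v assume v: "v \<in> A'"
    have "card (nbrs A' v) \<le> card (nbrs A v)"
      using fA by (intro card_mono) (auto simp: nbrs_def A'_def)
    moreover have "card (nbrs A v) \<le> D" using v by (auto simp: A'_def B_def)
    ultimately show "card (nbrs A' v) \<le> D" by linarith
    show "independent (nbrs A' v)"
      unfolding independent_def
    proof (intro ballI notI)
      fix x y assume "x \<in> nbrs A' v" "y \<in> nbrs A' v" "adj x y"
      then have "x \<in> A" "y \<in> A" "adj v x" "adj v y" by (simp_all add: nbrs_def A'_def)
      moreover have "v \<in> A" "v \<notin> T" using v by (simp_all add: A'_def)
      ultimately show False using \<open>adj x y\<close> unfolding T_def by blast
    qed
  qed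
  then obtain I where I: "I \<subseteq> A'" "independent I" "card A' * (ln D / 8) \<le> 2 * D * card I" by blast
  have "real n * (2 * D) = m / 2 * (l / 8 / 8)" by (simp add: D_def m_def field_simps)
  also have "\<dots> \<le> card A' * (ln D / 8)"
    using cA' D2 l by (intro mult_mono) (auto simp: D_def)
  also have "\<dots> \<le> 2 * D * card I" by (rule I(3))
  finally have "real n * (2 * D) \<le> real (card I) * (2 * D)" by (simp add: mult_ac)
  then have "real n \<le> real (card I)"
    by (rule mult_right_le_imp_le) (use D0 in linarith)
  then have "n \<le> card I" by simp
  then obtain J where "J \<subseteq> I" "card J = n" by (meson obtain_subset_with_card_n)
  moreover from this have "independent J" "J \<subseteq> V"
    using I A independent_subset by (auto simp: A'_def)
  ultimately show False using no by blast
qed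

end

section \<open>Counting cliques of size four from below\<close>

context adjacency
begin

text \<open>Turan's bound added up by Cauchy-Schwarz. With \<open>P\<close> the vertices and
  \<open>H\<close> their neighbourhoods it bounds triangles; with \<open>P\<close> the ordered edges
  and \<open>H\<close> the common neighbourhoods it bounds cliques of size four.\<close>

lemma sum_edges_lower_bound:
  assumes "finite P" "n > 0"
    and "\<And>p. p \<in> P \<Longrightarrow> real (card (H p)) ^ 2 / n - card (H p) \<le> f p"
  shows "real (\<Sum>p\<in>P. card (H p)) ^ 2 / (card P * n) - real (\<Sum>p\<in>P. card (H p)) \<le> (\<Sum>p\<in>P. f p)"
proof (cases "P = {}")
  case False
  have "(\<Sum>p\<in>P. real (card (H p)))\<^sup>2 \<le> (\<Sum>p\<in>P. (real (card (H p)))\<^sup>2) * card P"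
    by (rule sum_squared_le_sum_of_squares)
  then have "(\<Sum>p\<in>P. real (card (H p)))\<^sup>2 / card P \<le> (\<Sum>p\<in>P. (real (card (H p)))\<^sup>2)"
    using False assms(1) by (simp add: divide_le_eq card_gt_0_iff)
  then have "(\<Sum>p\<in>P. real (card (H p)))\<^sup>2 / card P / n \<le> (\<Sum>p\<in>P. (real (card (H p)))\<^sup>2) / n"
    using assms(2) by (intro divide_right_mono) auto
  then have "real (\<Sum>p\<in>P. card (H p)) ^ 2 / (card P * n) - real (\<Sum>p\<in>P. card (H p))
    \<le> (\<Sum>p\<in>P. real (card (H p)) ^ 2 / n - card (H p))"
    by (simp add: sum_subtractf sum_divide_distrib)
  also have "\<dots> \<le> (\<Sum>p\<in>P. f p)" by (rule sum_mono[OF assms(3)])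
  finally show ?thesis .
qed simp

lemma t3_lower_bound:
  assumes fin: "finite A" and n: "n > 0" and no: "\<And>I. I \<subseteq> A \<Longrightarrow> independent I \<Longrightarrow> card I \<noteq> n"
  shows "real (e2 A) ^ 2 / (card A * n) - e2 A \<le> t3 A"
proof -
  have "real (\<Sum>v\<in>A. card (nbrs A v)) ^ 2 / (card A * n) - real (\<Sum>v\<in>A. card (nbrs A v))
    \<le> (\<Sum>v\<in>A. real (e2 (nbrs A v)))"
  proof (rule sum_edges_lower_bound[OF fin n])
    fix v assume "v \<in> A"
    show "real (card (nbrs A v)) ^ 2 / n - card (nbrs A v) \<le> e2 (nbrs A v)"
      using no nbrs_subset by (intro edges_lower_bound finite_nbrs fin n) blast
  qed
  then show ?thesis by (simp add: e2_def[of A] t3_def)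
qed

lemma k4_lower_bound:
  assumes fin: "finite A" and n: "n > 0" and no: "\<And>I. I \<subseteq> A \<Longrightarrow> independent I \<Longrightarrow> card I \<noteq> n"
  shows "real (t3 A) ^ 2 / (e2 A * n) - t3 A \<le> k4 A"
proof -
  let ?P = "SIGMA v:A. nbrs A v"
  let ?H = "\<lambda>(v, u). nbrs (nbrs A v) u"
  have fP: "finite ?P" using fin finite_nbrs by blast
  have "real (\<Sum>p\<in>?P. card (?H p)) ^ 2 / (card ?P * n) - real (\<Sum>p\<in>?P. card (?H p))
    \<le> (\<Sum>p\<in>?P. real (e2 (?H p)))"
  proof (rule sum_edges_lower_bound[OF fP n])
    fix p
    have "?H p \<subseteq> A" using nbrs_subset by (cases p) (auto simp: nbrs_def)
    then have "card I \<noteq> n" if "I \<subseteq> ?H p" "independent I" for I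
      using no[OF _ that(2)] that(1) by (meson order_trans)
    moreover have "finite (?H p)" using \<open>?H p \<subseteq> A\<close> fin by (rule finite_subset)
    ultimately show "real (card (?H p)) ^ 2 / n - card (?H p) \<le> e2 (?H p)"
      by (intro edges_lower_bound n)
  qed
  moreover have "(\<Sum>p\<in>?P. card (?H p)) = t3 A"
    unfolding t3_def e2_def using fin finite_nbrs by (subst sum.Sigma) (auto intro!: sum.cong)
  moreover have "card ?P = e2 A"
    unfolding e2_def using fin finite_nbrs by (intro card_SigmaI) auto
  moreover have "(\<Sum>p\<in>?P. e2 (?H p)) = k4 A"
    unfolding k4_def t3_def using fin finite_nbrs by (subst sum.Sigma) (auto intro!: sum.cong)
  then have "(\<Sum>p\<in>?P. real (e2 (?H p))) = k4 A" by (simp flip: of_nat_sum)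
  ultimately show ?thesis by simp
qed

text \<open>\<open>large\<close> and \<open>e\<close> give at least \<open>2 * card A * n\<close>
  ordered edges, so the term subtracted in \<open>t3_lower_bound\<close> is at most half of the main
  term.\<close>

lemma dense_t3:
  fixes c l :: real
  assumes fin: "finite A" and n: "n > 0" and no: "\<And>I. I \<subseteq> A \<Longrightarrow> independent I \<Longrightarrow> card I \<noteq> n"
    and c: "c > 0" and l: "l > 0"
    and large: "2 * real n ^ 2 \<le> c * card A * l"
    and e: "c * real (card A) ^ 2 * l / n \<le> e2 A"
  shows "c ^ 2 / 2 * l ^ 2 / real n ^ 3 * real (card A) ^ 3 \<le> t3 A"
proof -
  define a where "a = real (card A)"
  have "a \<noteq> 0"
  proof
    assume "a = 0"
    then have "2 * real n ^ 2 \<le> 0" using large by (simp add: a_def)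
    then show False using n by simp
  qed
  then have a: "a > 0" by (simp add: a_def)
  have nn: "real n > 0" using n by simp
  have "2 * a * n \<le> c * a ^ 2 * l / n"
    using mult_left_mono[OF large, of a] a nn
    by (simp add: a_def pos_le_divide_eq power2_eq_square mult_ac)
  then have e': "2 * a * n \<le> e2 A" using e by (simp add: a_def)
  then have e0: "real (e2 A) > 0" using a nn by (smt (verit) mult_pos_pos)
  have "real (e2 A) * (2 * a * n) \<le> real (e2 A) * e2 A" using e' e0 by (intro mult_left_mono) auto
  then have h: "real (e2 A) \<le> real (e2 A) ^ 2 / (a * n) / 2"
    using a nn by (simp add: pos_le_divide_eq power2_eq_square mult_ac)
  have "(c * a ^ 2 * l / n) ^ 2 \<le> real (e2 A) ^ 2" using e c l by (intro power_mono) (auto simp: a_def)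
  then have "(c * a ^ 2 * l / n) ^ 2 / (a * n) / 2 \<le> real (e2 A) ^ 2 / (a * n) / 2"
    using a nn by (intro divide_right_mono) auto
  also have "\<dots> \<le> real (e2 A) ^ 2 / (a * n) - e2 A" using h by simp
  also have "\<dots> \<le> t3 A" using t3_lower_bound[OF fin n no] by (simp add: a_def)
  finally have "(c * a ^ 2 * l / n) ^ 2 / (a * n) / 2 \<le> t3 A" .
  moreover have "(c * a ^ 2 * l / n) ^ 2 / (a * n) / 2 = c ^ 2 / 2 * l ^ 2 / real n ^ 3 * a ^ 3"
    using a nn by (simp add: field_simps power2_eq_square power3_eq_cube)
  ultimately show ?thesis by (simp add: a_def)
qed

text \<open>\<open>\<theta>\<close> is the triangle density in the second alternative of
  \<open>density_dichotomy\<close>. The conditions on it and on \<open>n * k\<close> compare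
  functions of \<open>n\<close> alone once \<open>k\<close> and \<open>l\<close> are chosen; they
  hold for large \<open>n\<close> if \<open>k\<close> is a small power of \<open>n\<close>.\<close>

lemma k4_dense_lower_bound:
  fixes c l \<theta> :: real
  assumes fin: "finite V" and n: "0 < n" and k: "0 < k" and l: "0 < l" and c: "c = 1 / 2048"
    and D1: "1 \<le> k * l / 256" and D2: "l / 8 \<le> ln (k * l / 256)"
    and no: "\<And>I. I \<subseteq> V \<Longrightarrow> independent I \<Longrightarrow> card I \<noteq> n"
    and N: "4 / c ^ 2 * real n ^ 3 / l ^ 2 \<le> card V"
    and \<theta>: "\<theta> = 1 / (16 * real n ^ 2 * k ^ 2)"
    and nk: "real (n * k) \<le> 2 / c * real n ^ 2 / l" "real (n * k) \<le> 4 / c ^ 2 * real n ^ 3 / l ^ 2"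
    and \<theta>1: "c ^ 2 / 2 * l ^ 2 / real n ^ 3 \<le> \<theta>"
    and \<theta>2: "2 * c * l \<le> \<theta> * (4 / c ^ 2 * real n ^ 3 / l ^ 2)"
    and \<theta>3: "c ^ 5 / 16 * l ^ 5 / real n ^ 6 \<le> \<theta> ^ 2 / (2 * c * l)"
  shows "c ^ 5 / 16 * l ^ 5 / real n ^ 6 * real (card V) ^ 4 \<le> k4 V"
proof -
  define M where "M = real (card V)"
  have nn: "real n > 0" and cp: "c > 0" using n c by simp_all
  have \<theta>0: "\<theta> > 0" using n k by (simp add: \<theta>)
  have M0: "M > 0"
  proof -
    have "0 < 4 / c ^ 2 * real n ^ 3 / l ^ 2" using cp l nn by simp
    then show ?thesis using N by (simp add: M_def)
  qed
  have dich: "c * real (card A) ^ 2 * l / n < e2 A \<or> \<theta> * real (card A) ^ 3 < t3 A"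
    if "A \<subseteq> V" "n * k \<le> card A" for A
  proof -
    have "finite A" using that fin finite_subset by blast
    from density_dichotomy[OF this n k that(2) l D1 D2] no that(1)
    show ?thesis by (simp add: c \<theta> mult_ac)
  qed
  show ?thesis
  proof (cases "c * real (card V) ^ 2 * l / n < e2 V")
    case True
    \<comment> \<open>Less than half of the average degree. The lower bound on \<open>card V\<close>
      brings it to at least \<open>2 / c * n ^ 2 / l\<close>, from where \<open>dense_t3\<close> and
      \<open>dich\<close> apply to a neighbourhood.\<close>
    define d where "d = c / 2 * M * l / n"
    define \<gamma> where "\<gamma> = c ^ 2 / 2 * l ^ 2 / real n ^ 3"
    have d0: "d > 0" and g0: "\<gamma> > 0" using cp M0 l nn by (simp_all add: d_def \<gamma>_def)
    \<comment> \<open>A bound linear in the degree replaces the cubic one. It is negative below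
      \<open>d\<close>, so small neighbourhoods are harmless, and its sum over all vertices depends
      only on \<open>e2 V\<close>.\<close>
    have loc: "\<gamma> * d ^ 2 * (card (nbrs V v) - d) \<le> t3 (nbrs V v)" if "v \<in> V" for v
    proof (cases "real (card (nbrs V v)) < d")
      case True
      then have "\<gamma> * d ^ 2 * (card (nbrs V v) - d) \<le> 0"
        using g0 by (intro mult_nonneg_nonpos) auto
      then show ?thesis by linarith
    next
      case False
      let ?A = "nbrs V v" and ?a = "real (card (nbrs V v))"
      have sub: "?A \<subseteq> V" by (rule nbrs_subset)
      have finA: "finite ?A" using fin by (rule finite_nbrs)
      have "2 / c * real n ^ 2 / l = c / 2 * (4 / c ^ 2 * real n ^ 3 / l ^ 2) * l / n"
        using cp l nn by (simp add: field_simps power2_eq_square power3_eq_cube)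
      also have "\<dots> \<le> d"
        unfolding d_def M_def using N cp l nn by (intro divide_right_mono mult_right_mono mult_left_mono) auto
      finally have da: "2 / c * real n ^ 2 / l \<le> d" .
      then have a1: "2 / c * real n ^ 2 / l \<le> ?a" using False by linarith
      then have "real (n * k) \<le> ?a" using nk(1) by linarith
      then have nka: "n * k \<le> card ?A" by (simp only: of_nat_le_iff)
      have lb: "\<gamma> * ?a ^ 3 \<le> t3 ?A"
      proof (cases "c * real (card ?A) ^ 2 * l / n < e2 ?A")
        case True
        have "2 * real n ^ 2 \<le> c * ?a * l" using a1 cp l by (simp add: field_simps)
        then show ?thesis
          unfolding \<gamma>_def using True no sub by (intro dense_t3[OF finA n _ cp l]) auto
      next
        case False
        then have "\<theta> * ?a ^ 3 < t3 ?A" using dich[OF sub nka] by simp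
        moreover have "\<gamma> * ?a ^ 3 \<le> \<theta> * ?a ^ 3"
          using \<theta>1 unfolding \<gamma>_def by (intro mult_right_mono) auto
        ultimately show ?thesis by linarith
      qed
      have "d ^ 2 * (?a - d) \<le> ?a ^ 2 * ?a" using False d0 by (intro mult_mono power_mono) auto
      then have "\<gamma> * (d ^ 2 * (?a - d)) \<le> \<gamma> * ?a ^ 3"
        using g0 by (intro mult_left_mono) (auto simp: power2_eq_square power3_eq_cube)
      then show ?thesis using lb by (simp add: mult_ac)
    qed
    have "2 * M * d \<le> e2 V" using True by (simp add: d_def M_def power2_eq_square mult_ac)
    then have "\<gamma> * d ^ 2 * (M * d) \<le> \<gamma> * d ^ 2 * (e2 V - M * d)"
      using g0 by (intro mult_left_mono) auto
    also have "\<dots> = (\<Sum>v\<in>V. \<gamma> * d ^ 2 * (card (nbrs V v) - d))"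
      by (simp add: e2_def M_def sum_subtractf flip: sum_distrib_left)
    also have "\<dots> \<le> (\<Sum>v\<in>V. real (t3 (nbrs V v)))" by (rule sum_mono[OF loc])
    also have "\<dots> = k4 V" by (simp add: k4_def)
    also have "\<gamma> * d ^ 2 * (M * d) = c ^ 5 / 16 * l ^ 5 / real n ^ 6 * M ^ 4"
      using nn by (simp add: \<gamma>_def d_def field_simps eval_nat_numeral)
    finally show ?thesis by (simp add: M_def)
  next
    case False
    \<comment> \<open>With few edges but more than \<open>\<theta> * M ^ 3\<close> ordered
      triangles, an edge lies in many triangles on average; Cauchy-Schwarz over the edges gives the
      bound that \<open>\<theta>3\<close> compares with the target.\<close>
    then have e: "e2 V \<le> c * M ^ 2 * l / n" by (simp add: M_def)
    have "real (n * k) \<le> card V" using nk(2) N by linarith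
    then have "n * k \<le> card V" by (simp only: of_nat_le_iff)
    then have t: "\<theta> * M ^ 3 < t3 V" using dich[of V] False by (simp add: M_def)
    have t0: "real (t3 V) > 0"
    proof -
      have "0 < \<theta> * M ^ 3" using \<theta>0 M0 by simp
      then show ?thesis using t by linarith
    qed
    have e0: "e2 V \<noteq> 0"
    proof
      assume "e2 V = 0"
      then have "\<forall>v\<in>V. nbrs V v = {}" using fin finite_nbrs by (simp add: e2_def)
      then have "t3 V = 0" by (simp add: t3_def e2_def)
      then show False using t0 by simp
    qed
    then have en0: "real (e2 V) * n > 0" using nn by simp
    have en: "real (e2 V) * n \<le> c * M ^ 2 * l" using e nn by (simp add: pos_le_divide_eq)
    have "2 * c * l \<le> \<theta> * M"
      using \<theta>2 mult_left_mono[OF N, of \<theta>] \<theta>0 by (simp add: M_def)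
    then have "2 * c * l * M ^ 2 \<le> \<theta> * M * M ^ 2" by (rule mult_right_mono) simp
    then have "2 * (real (e2 V) * n) \<le> t3 V"
      using en t by (simp add: power2_eq_square power3_eq_cube mult_ac)
    then have "t3 V * (2 * (real (e2 V) * n)) \<le> t3 V * real (t3 V)" using t0 by (intro mult_left_mono) auto
    then have "t3 V \<le> t3 V ^ 2 / (real (e2 V) * n) / 2"
      using en0 by (simp add: pos_le_divide_eq power2_eq_square mult_ac)
    then have A: "real (t3 V) ^ 2 / (real (e2 V) * n) / 2 \<le> k4 V"
      using k4_lower_bound[OF fin n no] by simp
    have "(\<theta> * M ^ 3) ^ 2 \<le> real (t3 V) ^ 2" using t \<theta>0 M0 by (intro power_mono) auto
    then have "(\<theta> * M ^ 3) ^ 2 / (c * M ^ 2 * l) \<le> real (t3 V) ^ 2 / (real (e2 V) * n)"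
      using en en0 by (intro frac_le) auto
    then have "(\<theta> * M ^ 3) ^ 2 / (c * M ^ 2 * l) / 2 \<le> k4 V"
      by (intro order_trans[OF divide_right_mono A]) simp_all
    moreover have "(\<theta> * M ^ 3) ^ 2 / (c * M ^ 2 * l) / 2 = \<theta> ^ 2 / (2 * c * l) * M ^ 4"
      using M0 cp l by (simp add: field_simps eval_nat_numeral)
    moreover have "c ^ 5 / 16 * l ^ 5 / real n ^ 6 * M ^ 4 \<le> \<theta> ^ 2 / (2 * c * l) * M ^ 4"
      using \<theta>3 by (rule mult_right_mono) simp
    ultimately show ?thesis by (simp add: M_def)
  qed
qed

end

section \<open>Asymptotics\<close>

lemma half_le_ln_2: "1 / 2 \<le> ln (2::real)"
  using ln_le_minus_one[of "1 / 2 :: real"] by (simp add: ln_div)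

definition rate :: "nat \<Rightarrow> real" where "rate n = (ln n / n) ^ 6 * (1 / ln n)"

lemma rate_eq: "2 \<le> n \<Longrightarrow> rate n = ln n ^ 5 / n ^ 6"
proof -
  assume "2 \<le> n"
  then have "ln (real n) > 0" by simp
  then show ?thesis by (simp add: rate_def field_simps eval_nat_numeral)
qed

lemma rate_pos: "2 \<le> n \<Longrightarrow> 0 < rate n"
  by (simp add: rate_eq)

lemma rate_le_1:
  assumes "2 \<le> n"
  shows "rate n \<le> 1"
proof -
  have l: "0 < ln (real n)" "ln (real n) \<le> n" using assms ln_le_minus_one[of "real n"] by simp_all
  then have "ln n ^ 5 \<le> real n ^ 5" by (intro power_mono) auto
  also have "\<dots> \<le> real n ^ 6" using assms by (intro power_increasing) auto
  finally show ?thesis using assms by (simp add: rate_eq)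
qed

lemma independence_number_less:
  assumes "finite V" and no: "\<not> (\<exists>S \<subseteq> V. card S = n \<and> indep S E)"
  shows "independence_number V E < n"
proof -
  have "card S < n" if S: "S \<subseteq> V" "indep S E" for S
  proof (rule ccontr)
    assume "\<not> card S < n"
    then obtain T where T: "T \<subseteq> S" "card T = n" by (meson not_less obtain_subset_with_card_n)
    then have "indep T E" using S(2) by (auto simp: indep_def)
    then show False using no T S(1) by blast
  qed
  moreover have "finite {card S |S. S \<subseteq> V \<and> indep S E}" using assms(1) by simp
  moreover have "{card S |S. S \<subseteq> V \<and> indep S E} \<noteq> {}" using null_indep by blast
  ultimately show ?thesis unfolding independence_number_def by (subst Max_less_iff) auto
qed

lemma complete_graph:
  fixes N :: nat
  assumes "2 \<le> n"
  shows "simple_graph {..<N} (nsets {..<N} 2)"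
    "\<not> (\<exists>S \<subseteq> {..<N}. card S = n \<and> indep S (nsets {..<N} 2))"
    "num_cliques 4 {..<N} (nsets {..<N} 2) \<le> N choose 4"
proof -
  show "simple_graph {..<N} (nsets {..<N} 2)" by (simp add: simple_graph_def)
  show "\<not> (\<exists>S \<subseteq> {..<N}. card S = n \<and> indep S (nsets {..<N} 2))"
  proof
    assume "\<exists>S \<subseteq> {..<N}. card S = n \<and> indep S (nsets {..<N} 2)"
    then obtain S where S: "S \<subseteq> {..<N}" "card S = n" "indep S (nsets {..<N} 2)" by blast
    then obtain T where "T \<subseteq> S" "card T = 2" using assms by (metis obtain_subset_with_card_n)
    then obtain x y where "x \<in> S" "y \<in> S" "x \<noteq> y" by (auto simp: card_2_iff)
    then show False using S by (auto simp: indep_def)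
  qed
  have "num_cliques 4 {..<N} (nsets {..<N} 2) \<le> card {K. K \<subseteq> {..<N} \<and> card K = 4}"
    unfolding num_cliques_def by (intro card_mono) auto
  then show "num_cliques 4 {..<N} (nsets {..<N} 2) \<le> N choose 4" by (simp add: n_subsets)
qed

text \<open>Taking \<open>4 ^ k\<close> within a factor of four of \<open>n div 2\<close> gives
  \<open>2 * q ^ 2 \<le> n \<le> 8 * q ^ 2\<close>. The factor \<open>32 * 8 ^ 6\<close> turns
  \<open>k ^ 5 / q ^ 12\<close> into the rate, through \<open>k \<le> 2 * ln n\<close> and the upper
  bound on \<open>n\<close>.\<close>

lemma upper_large:
  assumes n: "2 * 4 ^ 12 \<le> n"
  shows "\<exists>E. simple_graph {..<N} E \<and> \<not> (\<exists>S \<subseteq> {..<N}. card S = n \<and> indep S E) \<and>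
    real (num_cliques 4 {..<N} E) \<le> (1008 * 256 ^ 5 + 12) * 32 * 8 ^ 6 * real (N choose 4) * rate n"
proof -
  have n4: "4 ^ 12 \<le> n div 2" using n by simp
  then have "1 \<le> n div 2" by simp
  then obtain k where k: "4 ^ k \<le> n div 2" "n div 2 < 4 ^ (k + 1)"
    using ex_power_ivl1[of 4 "n div 2"] by auto
  define q :: nat where "q = 2 ^ k"
  have q2: "q\<^sup>2 = 4 ^ k" by (simp add: q_def power2_eq_square flip: power_mult_distrib)
  have "(4::nat) ^ 12 < 4 ^ (k + 1)" using n4 k(2) by (rule le_less_trans)
  then have "12 < k + 1" by (subst (asm) power_strict_increasing_iff) auto
  then have k12: "12 \<le> k" by simp
  have nq: "2 * q\<^sup>2 \<le> n" "n \<le> 8 * q\<^sup>2" using k by (auto simp: q2)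
  from sparse_reflexive_graph_exists[OF k12 q_def nq(1)]
  obtain W :: "((bit alg_closure \<times> bit alg_closure) set \<times> nat) set" and J
    where W: "finite W" "W \<noteq> {}" and refl: "\<And>x. J x x" and sym: "\<And>x y. J x y \<Longrightarrow> J y x"
      and dep: "\<And>S. S \<subseteq> W \<Longrightarrow> card S = n \<Longrightarrow> \<exists>x\<in>S. \<exists>y\<in>S. x \<noteq> y \<and> J x y"
      and cq: "real (card (joined_quads W J)) \<le> (1008 * 256 ^ 5 + 12) * real k ^ 5 / real q ^ 12 * real (card W) ^ 4"
    by blast
  from pullback_graph_exists[OF W refl sym dep, of n N]
  obtain E where E: "simple_graph {..<N} E" "\<not> (\<exists>S \<subseteq> {..<N}. card S = n \<and> indep S E)"
    and le: "num_cliques 4 {..<N} E * card W ^ 4 \<le> (N choose 4) * card (joined_quads W J)"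
    by blast
  define w where "w = real (card W) ^ 4"
  have w0: "w > 0" using W by (simp add: w_def card_gt_0_iff)
  have "real (num_cliques 4 {..<N} E) * w \<le> real (N choose 4) * card (joined_quads W J)"
    using of_nat_mono[OF le, where 'a = real] by (simp add: w_def)
  also have "\<dots> \<le> real (N choose 4) * ((1008 * 256 ^ 5 + 12) * real k ^ 5 / real q ^ 12 * w)"
    using cq by (intro mult_left_mono) (auto simp: w_def)
  also have "\<dots> = real (N choose 4) * ((1008 * 256 ^ 5 + 12) * (real k ^ 5 / real q ^ 12)) * w"
    by simp
  finally have "real (num_cliques 4 {..<N} E) \<le> real (N choose 4) * ((1008 * 256 ^ 5 + 12) * (real k ^ 5 / real q ^ 12))"
    by (rule mult_right_le_imp_le[OF _ w0])
  moreover have kq: "real k ^ 5 / real q ^ 12 \<le> 32 * 8 ^ 6 * rate n"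
  proof -
    have n2: "2 \<le> n" using n by simp
    have "q \<le> q\<^sup>2" by (simp add: power2_eq_square)
    then have "real q \<le> real n" using nq(1) by simp
    then have "ln (real q) \<le> ln (real n)" using n2 by (subst ln_le_cancel_iff) (auto simp: q_def)
    moreover have "ln (real q) = real k * ln 2" by (simp add: q_def ln_realpow)
    moreover have "1 / 2 \<le> ln (2::real)"
      by (rule half_le_ln_2)
    then have "real k * (1 / 2) \<le> real k * ln 2" by (intro mult_left_mono) auto
    ultimately have kl: "real k \<le> 2 * ln n" by simp
    have A: "real k ^ 5 \<le> (2 * ln n) ^ 5" using kl by (intro power_mono) auto
    have "real n \<le> 8 * real q ^ 2" using of_nat_mono[OF nq(2), where 'a = real] by simp
    then have "real n ^ 6 \<le> (8 * real q ^ 2) ^ 6" by (intro power_mono) auto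
    also have "\<dots> = 8 ^ 6 * real q ^ 12" by (simp add: power_mult_distrib flip: power_mult)
    finally have B: "real n ^ 6 \<le> 8 ^ 6 * real q ^ 12" .
    have q0: "real q > 0" by (simp add: q_def)
    have "real k ^ 5 / real q ^ 12 \<le> (2 * ln n) ^ 5 / real q ^ 12"
      using A by (intro divide_right_mono) auto
    also have "\<dots> = 8 ^ 6 * (2 * ln n) ^ 5 / (8 ^ 6 * real q ^ 12)" by simp
    also have "\<dots> \<le> 8 ^ 6 * (2 * ln n) ^ 5 / real n ^ 6"
      using B n2 q0 by (intro divide_left_mono mult_pos_pos) auto
    also have "\<dots> = 32 * 8 ^ 6 * rate n" using n2 by (simp add: rate_eq power_mult_distrib)
    finally show ?thesis .
  qed
  then have "real (N choose 4) * ((1008 * 256 ^ 5 + 12) * (real k ^ 5 / real q ^ 12))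
      \<le> real (N choose 4) * ((1008 * 256 ^ 5 + 12) * (32 * 8 ^ 6 * rate n))"
    by (intro mult_left_mono) auto
  ultimately have "real (num_cliques 4 {..<N} E) \<le> real (N choose 4) * ((1008 * 256 ^ 5 + 12) * (32 * 8 ^ 6 * rate n))"
    by (rule order_trans)
  then have "real (num_cliques 4 {..<N} E) \<le> (1008 * 256 ^ 5 + 12) * 32 * 8 ^ 6 * real (N choose 4) * rate n"
    by (simp only: mult_ac)
  then show ?thesis using E by blast
qed

lemma upper_bound:
  "\<exists>C > 0. \<forall>n \<ge> 2. \<forall>N. \<exists>E. simple_graph {..<N} E \<and> \<not> (\<exists>S \<subseteq> {..<N}. card S = n \<and> indep S E) \<and>
    real (num_cliques 4 {..<N} E) \<le> C * real (N choose 4) * rate n"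
proof -
  define C1 :: real where "C1 = (1008 * 256 ^ 5 + 12) * 32 * 8 ^ 6"
  \<comment> \<open>For the finitely many \<open>n\<close> below \<open>2 * 4 ^ 12\<close> the rate
    is at least \<open>1 / C2\<close>, so complete graphs suffice.\<close>
  define C2 :: real where "C2 = 32 * (2 * 4 ^ 12) ^ 6"
  have pos: "C1 > 0" "C2 > 0" by (simp_all add: C1_def C2_def)
  have "\<exists>E. simple_graph {..<N} E \<and> \<not> (\<exists>S \<subseteq> {..<N}. card S = n \<and> indep S E) \<and>
    real (num_cliques 4 {..<N} E) \<le> (C1 + C2) * real (N choose 4) * rate n" if n: "2 \<le> n" for n N
  proof (cases "2 * 4 ^ 12 \<le> n")
    case True
    from upper_large[OF True, of N] obtain E where E: "simple_graph {..<N} E"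
      "\<not> (\<exists>S \<subseteq> {..<N}. card S = n \<and> indep S E)"
      "real (num_cliques 4 {..<N} E) \<le> C1 * real (N choose 4) * rate n"
      unfolding C1_def by blast
    have "C1 * (real (N choose 4) * rate n) \<le> (C1 + C2) * (real (N choose 4) * rate n)"
      using pos rate_pos[OF n] by (intro mult_right_mono) auto
    then have "real (num_cliques 4 {..<N} E) \<le> (C1 + C2) * real (N choose 4) * rate n"
      using E(3) by (simp add: mult.assoc)
    then show ?thesis using E by blast
  next
    case False
    have "1 / 2 \<le> ln (2::real)" by (rule half_le_ln_2)
    also have "\<dots> \<le> ln (real n)" using n by simp
    finally have "(1 / 2) ^ 5 \<le> ln (real n) ^ 5" by (rule power_mono) simp
    then have "(1 / 2) ^ 5 / real n ^ 6 \<le> rate n" unfolding rate_eq[OF n] by (intro divide_right_mono) auto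
    moreover have "(1 / 2) ^ 5 / (2 * 4 ^ 12) ^ 6 \<le> (1 / 2) ^ 5 / real n ^ 6"
      using False n by (intro divide_left_mono power_mono mult_pos_pos) auto
    ultimately have "1 \<le> C2 * rate n" unfolding C2_def by (simp add: field_simps)
    also have "\<dots> \<le> (C1 + C2) * rate n" using pos rate_pos[OF n] by (intro mult_right_mono) auto
    finally have "real (N choose 4) * 1 \<le> real (N choose 4) * ((C1 + C2) * rate n)"
      by (intro mult_left_mono) auto
    then have "real (num_cliques 4 {..<N} (nsets {..<N} 2)) \<le> (C1 + C2) * real (N choose 4) * rate n"
      using of_nat_mono[OF complete_graph(3)[OF n, of N], where 'a = real] by (simp add: mult_ac)
    then show ?thesis using complete_graph[OF n, of N] by blast
  qed
  then show ?thesis using pos by (intro exI[of _ "C1 + C2"]) auto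
qed

lemma card_tuples_of_4set:
  assumes "card K = 4"
  shows "card {(u, v, w, x). distinct [u, v, w, x] \<and> {u, v, w, x} = K} \<le> 24"
proof -
  have fin: "finite K" using assms card.infinite by fastforce
  let ?T = "{(u, v, w, x). distinct [u, v, w, x] \<and> {u, v, w, x} = K}"
  let ?L = "{xs. length xs = 4 \<and> distinct xs \<and> set xs \<subseteq> K}"
  have "card ?L = \<Prod>{card K - 4 + 1..card K}"
    using fin assms by (intro card_lists_distinct_length_eq) auto
  also have "\<dots> = fact 4" by (simp add: assms fact_prod)
  finally have cL: "card ?L = 24" by (simp add: fact_numeral)
  have "card ?T \<le> card ?L"
  proof (rule card_inj_on_le[where f = "\<lambda>(u, v, w, x). [u, v, w, x]"])
    show "finite ?L" by (rule card_ge_0_finite) (simp add: cL)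
  qed (auto simp: inj_on_def)
  then show ?thesis by (simp add: cL)
qed

lemma lower_bound_large:
  obtains c0 :: real and n0 :: nat where "0 < c0" "2 \<le> n0"
    and "\<And>n V E. n0 \<le> n \<Longrightarrow> simple_graph (V :: nat set) E \<Longrightarrow> \<not> (\<exists>S \<subseteq> V. card S = n \<and> indep S E)
      \<Longrightarrow> 4 / (1 / 2048) ^ 2 * real n ^ 3 / ln (real n) ^ 2 \<le> card V
      \<Longrightarrow> c0 * real (card V choose 4) * rate n \<le> num_cliques 4 V E"
proof -
  define c :: real where "c = 1 / 2048"
  \<comment> \<open>Any exponent strictly between 1/8 and 1/2 would serve: the lower end comes from
    \<open>l / 8 \<le> ln (k * l / 256)\<close>, the upper end from the conditions on
    \<open>\<theta>\<close>. The integer \<open>k\<close> will lie between \<open>x n / 2\<close>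
    and \<open>x n\<close>, and each condition uses the unfavourable end.\<close>
  define x where "x n = real n powr (1 / 4)" for n :: nat
  have "\<forall>\<^sub>F n in sequentially. 2 \<le> n \<and> 2 \<le> x n \<and> 1 \<le> (x n / 2) * ln (real n) / 256 \<and>
      ln (real n) / 8 \<le> ln ((x n / 2) * ln (real n) / 256) \<and>
      real n * x n \<le> 2 / c * real n ^ 2 / ln (real n) \<and>
      real n * x n \<le> 4 / c ^ 2 * real n ^ 3 / ln (real n) ^ 2 \<and>
      c ^ 2 / 2 * ln (real n) ^ 2 / real n ^ 3 \<le> 1 / (16 * real n ^ 2 * x n ^ 2) \<and>
      2 * c * ln (real n) \<le> 1 / (16 * real n ^ 2 * x n ^ 2) * (4 / c ^ 2 * real n ^ 3 / ln (real n) ^ 2) \<and>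
      c ^ 5 / 16 * ln (real n) ^ 5 / real n ^ 6 \<le> (1 / (16 * real n ^ 2 * x n ^ 2)) ^ 2 / (2 * c * ln (real n))"
    unfolding x_def c_def by (intro eventually_conj; real_asymp)
  then obtain n0 where n0: "\<And>n. n0 \<le> n \<Longrightarrow> 2 \<le> n \<and> 2 \<le> x n \<and> 1 \<le> (x n / 2) * ln (real n) / 256 \<and>
      ln (real n) / 8 \<le> ln ((x n / 2) * ln (real n) / 256) \<and>
      real n * x n \<le> 2 / c * real n ^ 2 / ln (real n) \<and>
      real n * x n \<le> 4 / c ^ 2 * real n ^ 3 / ln (real n) ^ 2 \<and>
      c ^ 2 / 2 * ln (real n) ^ 2 / real n ^ 3 \<le> 1 / (16 * real n ^ 2 * x n ^ 2) \<and>
      2 * c * ln (real n) \<le> 1 / (16 * real n ^ 2 * x n ^ 2) * (4 / c ^ 2 * real n ^ 3 / ln (real n) ^ 2) \<and>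
      c ^ 5 / 16 * ln (real n) ^ 5 / real n ^ 6 \<le> (1 / (16 * real n ^ 2 * x n ^ 2)) ^ 2 / (2 * c * ln (real n))"
    unfolding eventually_sequentially by blast
  have "c ^ 5 / 16 * real (card V choose 4) * rate n \<le> num_cliques 4 V E"
    if nn: "n0 \<le> n" and G: "simple_graph V E" and noE: "\<not> (\<exists>S \<subseteq> V. card S = n \<and> indep S E)"
      and N: "4 / (1 / 2048) ^ 2 * real n ^ 3 / ln (real n) ^ 2 \<le> card V" for n and V :: "nat set" and E
  proof -
    define adj where "adj u v \<longleftrightarrow> u \<noteq> v \<and> {u, v} \<in> E" for u v
    interpret adjacency adj
      by standard (auto simp: adj_def insert_commute)
    define l where "l = ln (real n)"
    define k where "k = nat \<lfloor>x n\<rfloor>"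
    define \<theta> where "\<theta> = 1 / (16 * real n ^ 2 * real k ^ 2)"
    note A = n0[OF nn, folded l_def]
    have n2: "2 \<le> n" and x2: "2 \<le> x n" using A by blast+
    have kx: "real k \<le> x n" "x n / 2 \<le> real k"
      using x2 unfolding k_def by linarith+
    have k0: "0 < k" using kx x2 by linarith
    have l0: "0 < l" using n2 by (simp add: l_def)
    have fin: "finite V" using G by (simp add: simple_graph_def)
    have no: "card I \<noteq> n" if "I \<subseteq> V" "independent I" for I
    proof -
      have "indep I E" using that(2) by (auto simp: independent_def adj_def indep_def)
      then show ?thesis using noE that(1) by blast
    qed
    have cp: "c > 0" by (simp add: c_def)
    have np: "real n > 0" using n2 by simp
    have m: "(x n / 2) * l / 256 \<le> k * l / 256"
      using kx(2) l0 by (intro divide_right_mono mult_right_mono) auto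
    have D1: "1 \<le> k * l / 256" using m A by linarith
    have p: "0 < (x n / 2) * l / 256" "0 < k * l / 256" using A D1 by linarith+
    have "ln ((x n / 2) * l / 256) \<le> ln (k * l / 256)"
      by (subst ln_le_cancel_iff[OF p]) (rule m)
    then have D2: "l / 8 \<le> ln (k * l / 256)" using A by linarith
    have th: "1 / (16 * real n ^ 2 * x n ^ 2) \<le> \<theta>"
      unfolding \<theta>_def using kx k0 np x2 by (intro divide_left_mono mult_left_mono power_mono mult_pos_pos) auto
    have nkx: "real (n * k) \<le> real n * x n" using kx by (simp add: mult_left_mono)
    have "c ^ 5 / 16 * l ^ 5 / real n ^ 6 * real (card V) ^ 4 \<le> k4 V"
    proof (rule k4_dense_lower_bound[OF fin _ k0 l0 c_def D1 D2 no _ \<theta>_def])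
      show "0 < n" using n2 by simp
      show "4 / c ^ 2 * real n ^ 3 / l ^ 2 \<le> card V" using N by (simp add: c_def l_def)
      show "real (n * k) \<le> 2 / c * real n ^ 2 / l" using nkx A by linarith
      show "real (n * k) \<le> 4 / c ^ 2 * real n ^ 3 / l ^ 2" using nkx A by linarith
      show "c ^ 2 / 2 * l ^ 2 / real n ^ 3 \<le> \<theta>" using th A by linarith
      have "1 / (16 * real n ^ 2 * x n ^ 2) * (4 / c ^ 2 * real n ^ 3 / l ^ 2) \<le> \<theta> * (4 / c ^ 2 * real n ^ 3 / l ^ 2)"
        using th by (intro mult_right_mono) auto
      then show "2 * c * l \<le> \<theta> * (4 / c ^ 2 * real n ^ 3 / l ^ 2)" using A by linarith
      have "(1 / (16 * real n ^ 2 * x n ^ 2)) ^ 2 / (2 * c * l) \<le> \<theta> ^ 2 / (2 * c * l)"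
        using th cp l0 by (intro divide_right_mono power_mono) auto
      then show "c ^ 5 / 16 * l ^ 5 / real n ^ 6 \<le> \<theta> ^ 2 / (2 * c * l)" using A by linarith
    qed auto
    then have low: "c ^ 5 / 16 * rate n * real (card V) ^ 4 \<le> k4 V"
      using n2 by (simp add: rate_eq l_def mult.assoc)
    let ?T = "{(u, v, w, x). {u, v, w, x} \<subseteq> V \<and> adj u v \<and> adj u w \<and> adj u x \<and> adj v w \<and> adj v x \<and> adj w x}"
    let ?K = "{K. K \<subseteq> V \<and> card K = 4 \<and> clique K E}"
    let ?F = "\<lambda>K. {(u, v, w, x). distinct [u, v, w, x] \<and> {u, v, w, x} = K}"
    have finK: "finite ?K" using fin by simp
    have "?T \<subseteq> (\<Union>K\<in>?K. ?F K)"
    proof clarify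
      fix u v w x assume V: "{u, v, w, x} \<subseteq> V"
        and a: "adj u v" "adj u w" "adj u x" "adj v w" "adj v x" "adj w x"
      have d: "distinct [u, v, w, x]" using a by (simp add: adj_def)
      moreover have "clique {u, v, w, x} E" using a by (auto simp: clique_def adj_def insert_commute)
      ultimately have "{u, v, w, x} \<in> ?K" "(u, v, w, x) \<in> ?F {u, v, w, x}" using V by auto
      then show "(u, v, w, x) \<in> (\<Union>K\<in>?K. ?F K)" by blast
    qed
    moreover have "finite (?F K)" if "K \<in> ?K" for K
      by (rule finite_subset[of _ "K \<times> K \<times> K \<times> K"]) (use that finite_subset[of K V] fin in auto)
    ultimately have "card ?T \<le> card (\<Union>K\<in>?K. ?F K)" using finK by (intro card_mono) auto
    also have "\<dots> \<le> (\<Sum>K\<in>?K. card (?F K))" by (rule card_UN_le[OF finK])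
    also have "\<dots> \<le> (\<Sum>K\<in>?K. 24)" by (intro sum_mono card_tuples_of_4set) auto
    finally have "k4 V \<le> 24 * num_cliques 4 V E"
      by (simp add: k4_tuples[OF fin] num_cliques_def)
    then have up: "real (k4 V) \<le> 24 * real (num_cliques 4 V E)" by linarith
    have "(card V choose 4) * fact 4 \<le> card V ^ 4" by (rule binomial_fact_pow)
    then have "24 * (card V choose 4) \<le> card V ^ 4" by (simp add: fact_numeral)
    then have "24 * real (card V choose 4) \<le> real (card V) ^ 4"
      using of_nat_mono[where 'a = real] by fastforce
    then have "c ^ 5 / 16 * rate n * (24 * real (card V choose 4)) \<le> c ^ 5 / 16 * rate n * real (card V) ^ 4"
      using cp rate_pos[OF n2] by (intro mult_left_mono) auto
    then show ?thesis using low up by (simp add: mult_ac)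
  qed
  moreover have "2 \<le> n0" using n0[of n0] by blast
  moreover have "0 < c ^ 5 / 16" by (simp add: c_def)
  ultimately show thesis using that by blast
qed

text \<open>Small \<open>n\<close> are reduced to \<open>n0\<close>: a graph without independent
  sets of size \<open>n < n0\<close> has none of size \<open>n0\<close>. The factor
  \<open>T n0\<close> in the threshold makes the graph large enough for \<open>n0\<close>, because
  \<open>T n \<ge> 1\<close>, and \<open>rate n \<le> 1\<close> limits the loss to the constant
  \<open>rate n0\<close>.\<close>

lemma lower_bound:
  "\<exists>C > 0. \<exists>c0 > 0. \<forall>n \<ge> 2. \<forall>(V :: nat set) E. simple_graph V E \<longrightarrow>
    \<not> (\<exists>S \<subseteq> V. card S = n \<and> indep S E) \<longrightarrow> C * real n ^ 3 / (ln (real n))\<^sup>2 \<le> card V \<longrightarrow>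
    c0 * real (card V choose 4) * rate n \<le> num_cliques 4 V E"
proof -
  obtain c0 :: real and n0 :: nat where c0: "0 < c0" and n02: "2 \<le> n0"
    and large: "\<And>n V E. n0 \<le> n \<Longrightarrow> simple_graph (V :: nat set) E \<Longrightarrow> \<not> (\<exists>S \<subseteq> V. card S = n \<and> indep S E)
      \<Longrightarrow> 4 / (1 / 2048) ^ 2 * real n ^ 3 / ln (real n) ^ 2 \<le> card V
      \<Longrightarrow> c0 * real (card V choose 4) * rate n \<le> num_cliques 4 V E"
    using lower_bound_large by blast
  define B :: real where "B = 4 / (1 / 2048) ^ 2"
  define T where "T n = real n ^ 3 / ln (real n) ^ 2" for n :: nat
  have B0: "B > 0" by (simp add: B_def)
  have T1: "1 \<le> T n" if "2 \<le> n" for n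
  proof -
    have l: "0 < ln (real n)" "ln (real n) \<le> n" using that ln_le_minus_one[of "real n"] by simp_all
    have "ln n ^ 2 \<le> real n ^ 2" using l by (intro power_mono) auto
    also have "\<dots> \<le> real n ^ 3" using that by (intro power_increasing) auto
    finally show ?thesis using l(1) unfolding T_def by (subst le_divide_eq_1_pos) simp_all
  qed
  have main: "c0 * rate n0 * real (card V choose 4) * rate n \<le> num_cliques 4 V E"
    if n: "2 \<le> n" and G: "simple_graph V E" and no: "\<not> (\<exists>S \<subseteq> V. card S = n \<and> indep S E)"
      and N: "B * T n0 * real n ^ 3 / (ln (real n))\<^sup>2 \<le> card V" for n and V :: "nat set" and E
  proof -
    have N': "B * T n0 * T n \<le> card V" using N by (simp add: T_def)
    have r: "0 < rate n" "rate n \<le> 1" "0 < rate n0" "rate n0 \<le> 1"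
      using rate_pos rate_le_1 n n02 by auto
    show ?thesis
    proof (cases "n0 \<le> n")
      case True
      have "B * 1 * T n \<le> B * T n0 * T n"
        using B0 T1[OF n02] T1[OF n] by (intro mult_right_mono mult_left_mono) auto
      then have "B * real n ^ 3 / ln (real n) ^ 2 \<le> card V" using N' by (simp add: T_def)
      then have "c0 * real (card V choose 4) * rate n \<le> num_cliques 4 V E"
        unfolding B_def by (rule large[OF True G no])
      moreover have "rate n0 * (c0 * real (card V choose 4) * rate n) \<le> 1 * (c0 * real (card V choose 4) * rate n)"
        using r c0 by (intro mult_right_mono) auto
      ultimately show ?thesis by (simp add: mult_ac)
    next
      case False
      have no': "\<not> (\<exists>S \<subseteq> V. card S = n0 \<and> indep S E)"
      proof
        assume "\<exists>S \<subseteq> V. card S = n0 \<and> indep S E"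
        then obtain S where S: "S \<subseteq> V" "card S = n0" "indep S E" by blast
        then obtain S' where "S' \<subseteq> S" "card S' = n" using False by (metis nat_le_linear obtain_subset_with_card_n)
        moreover from this have "indep S' E" using S(3) by (auto simp: indep_def)
        ultimately show False using no S(1) by blast
      qed
      have "B * T n0 * 1 \<le> B * T n0 * T n"
        using B0 T1[OF n02] T1[OF n] by (intro mult_left_mono) auto
      then have "B * real n0 ^ 3 / ln (real n0) ^ 2 \<le> card V" using N' by (simp add: T_def)
      then have "c0 * real (card V choose 4) * rate n0 \<le> num_cliques 4 V E"
        unfolding B_def by (rule large[OF order_refl G no'])
      moreover have "rate n * (c0 * real (card V choose 4) * rate n0) \<le> 1 * (c0 * real (card V choose 4) * rate n0)"
        using r c0 by (intro mult_right_mono) auto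
      ultimately show ?thesis by (simp add: mult_ac)
    qed
  qed
  have "0 < B * T n0" "0 < c0 * rate n0"
    using B0 T1[OF n02] c0 rate_pos[OF n02] by (auto intro: mult_pos_pos)
  then show ?thesis using main by (intro exI[of _ "B * T n0"] conjI exI[of _ "c0 * rate n0"]) auto
qed

theorem theorem2p5:
  shows "\<exists>C\<^sub>0 > (0::real). \<exists>C\<^sub>1 > (0::real).
    (\<forall>n N :: nat. n \<ge> 2 \<longrightarrow> real N \<ge> C\<^sub>0 * real n ^ 3 / (ln (real n))\<^sup>2 \<longrightarrow>
      (\<exists>(V :: nat set) E. simple_graph V E \<and> card V = N \<and> independence_number V E < n \<and>
        real (num_cliques 4 V E)
          \<le> C\<^sub>1 * real (N choose 4) * (ln (real n) / real n) ^ 6 * (1 / ln (real n)))) \<and>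
    (\<exists>c > (0::real). \<forall>n N :: nat. n \<ge> 2 \<longrightarrow> real N \<ge> C\<^sub>0 * real n ^ 3 / (ln (real n))\<^sup>2 \<longrightarrow>
      c * real (N choose 4) * (ln (real n) / real n) ^ 6 * (1 / ln (real n))
        \<le> real (min_cliques N 4 n) \<and>
      real (min_cliques N 4 n)
        \<le> C\<^sub>1 * real (N choose 4) * (ln (real n) / real n) ^ 6 * (1 / ln (real n)))"
proof -
  from upper_bound obtain C1 where C1: "C1 > 0" and up: "\<forall>n \<ge> 2. \<forall>N. \<exists>E. simple_graph {..<N} E \<and>
      \<not> (\<exists>S \<subseteq> {..<N}. card S = n \<and> indep S E) \<and>
      real (num_cliques 4 {..<N} E) \<le> C1 * real (N choose 4) * rate n"
    by (elim exE conjE)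
  note up = up[rule_format]
  from lower_bound obtain C0 c where C0: "C0 > 0" and c: "c > 0" and low: "\<forall>n \<ge> 2. \<forall>(V :: nat set) E.
      simple_graph V E \<longrightarrow> \<not> (\<exists>S \<subseteq> V. card S = n \<and> indep S E) \<longrightarrow>
      C0 * real n ^ 3 / (ln (real n))\<^sup>2 \<le> card V \<longrightarrow>
      c * real (card V choose 4) * rate n \<le> num_cliques 4 V E"
    by (elim exE conjE)
  note low = low[rule_format]
  have A: "\<exists>(V :: nat set) E. simple_graph V E \<and> card V = N \<and> independence_number V E < n \<and>
      real (num_cliques 4 V E) \<le> C1 * real (N choose 4) * rate n" if "2 \<le> n" for n N
  proof -
    obtain E where E: "simple_graph {..<N} E" "\<not> (\<exists>S \<subseteq> {..<N}. card S = n \<and> indep S E)"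
      "real (num_cliques 4 {..<N} E) \<le> C1 * real (N choose 4) * rate n"
      using up[OF \<open>2 \<le> n\<close>, of N] by blast
    then show ?thesis
      using independence_number_less[OF finite_lessThan E(2)] by (intro exI[of _ "{..<N}"] exI[of _ E]) simp
  qed
  have B: "c * real (N choose 4) * rate n \<le> min_cliques N 4 n \<and>
      min_cliques N 4 n \<le> C1 * real (N choose 4) * rate n"
    if n: "2 \<le> n" and N: "C0 * real n ^ 3 / (ln (real n))\<^sup>2 \<le> N" for n N
  proof
    let ?P = "\<lambda>m. \<exists>(V :: nat set) E. simple_graph V E \<and> card V = N \<and>
      \<not> (\<exists>S \<subseteq> V. card S = n \<and> indep S E) \<and> m = num_cliques 4 V E"
    obtain E where E: "simple_graph {..<N} E" "\<not> (\<exists>S \<subseteq> {..<N}. card S = n \<and> indep S E)"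
      "real (num_cliques 4 {..<N} E) \<le> C1 * real (N choose 4) * rate n"
      using up[OF n, of N] by blast
    \<comment> \<open>Some value is attained, so the \<open>LEAST\<close> is itself the clique count
      of an admissible graph, to which the lower bound can be applied.\<close>
    have P: "?P (num_cliques 4 {..<N} E)"
      using E(1,2) by (intro exI[of _ "{..<N}"] exI[of _ E]) simp
    have "min_cliques N 4 n \<le> num_cliques 4 {..<N} E"
      unfolding min_cliques_def by (rule Least_le[of ?P, OF P])
    then show "min_cliques N 4 n \<le> C1 * real (N choose 4) * rate n" using E(3) by linarith
    have "?P (min_cliques N 4 n)"
      unfolding min_cliques_def by (rule LeastI[of ?P, OF P])
    then obtain V :: "nat set" and E' where V: "simple_graph V E'" "card V = N"
      "\<not> (\<exists>S \<subseteq> V. card S = n \<and> indep S E')" "min_cliques N 4 n = num_cliques 4 V E'"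
      by blast
    show "c * real (N choose 4) * rate n \<le> min_cliques N 4 n"
      using low[OF n V(1,3)] N V(2,4) by simp
  qed
  show ?thesis
    using C0 C1 c A B unfolding rate_def
    by (intro exI[of _ C0] exI[of _ C1] conjI exI[of _ c]) (simp_all add: mult.assoc)
qed

end
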